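(* Let $K$ be an algebraically closed valued field with value group $\Gamma$. Let $V \subset \mathbb{A}_K^N$ and $W \subset \mathbb{A}_K^M$ be closed affine subvarieties, and let $\phi(X_1,\ldots,X_N;Y_1,\ldots,Y_M)$ be a formula of the language $\mathcal{L}$ with parameters in $(K;\Gamma\cup\{0_\Gamma\})$ whose free variables are all of the field sort. Let $k=\dim V$. Then there exists a constant $C=C_{\phi,V,W}$ such that for all $n>0$, \[ \chi_{\mathcal{R}(\phi,V\times W)(K),\,V(K),\,W(K)}(n) \le C\cdot n^{k}. \]
   Context: The valuation of $K$ is written multiplicatively as an absolute value $|\cdot|:K\to\Gamma\cup\{0_\Gamma\}$ (non-archimedean: $|x+y|\le\max(|x|,|y|)$, $|xy|=|x||y|$, $|0|=0_\Gamma$), with $\Gamma$ an ordered multiplicative group. $\mathcal{L}$ is the two-sorted language $(0_K,1_K,+_K,\times_K,|\cdot|:K\to\Gamma\cup\{0_\Gamma\},\le_\Gamma,\times_\Gamma)$ with a field sort and a value sort. For a closed affine subvariety $Z\subset\mathbb{A}^{P}_K$ and an $\mathcal{L}$-formula $\psi$ in $P$ free field-sort variables, $\mathcal{R}(\psi,Z)(K)$ denotes the set of points of $Z(K)$ satisfying $\psi$ in $(K;\Gamma\cup\{0_\Gamma\})$. For sets $V',W'$ and $X\subset V'\times W'$, and $w\in W'$, let $X_w=\{v\in V' : (v,w)\in X\}$. For $n>0$, $v\in V'$ and $\bar w=(w_1,\dots,w_n)\in W'^n$, define $\chi_{X,V',W';n}(v,\bar w)\in\{0,1\}^n$ by setting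 its $i$-th coordinate to $1$ if $v\in X_{w_i}$ and to $0$ otherwise. Define $\chi_{X,V',W'}(n)=\max_{\bar w\in W'^n}\mathrm{card}\{\chi_{X,V',W';n}(v,\bar w): v\in V'\}$, i.e. the maximum number of $0/1$ patterns realized by $n$ fibers $(X_{w_1},\dots,X_{w_n})$ in $V'$. *)

theory Defs
  imports
    Complex_Main
    "HOL-Library.Poly_Mapping"
    "HOL-Library.Extended_Nat"
    "HOL-Computational_Algebra.Polynomial"
begin

section \<open>Valued fields\<close>

text \<open>
  A type of this class is \<open>\<Gamma> \<union> {0}\<close> for a linearly ordered commutative group \<open>\<Gamma>\<close>,
  namely \<open>\<Gamma> = {a. a \<noteq> 0}\<close>: the order is total, 0 is its least element, and 0 is absorbing.
\<close>

class linordered_comm_group_with_zero =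
  comm_monoid_mult + mult_zero + zero_neq_one + linorder +
  assumes ex_right_inverse: "a \<noteq> 0 \<Longrightarrow> \<exists>b. a * b = 1"
    and mult_left_mono_value: "a \<le> b \<Longrightarrow> c * a \<le> c * b"
    and zero_le_value: "0 \<le> a"

text \<open>
  Surjectivity of \<open>v\<close> says that \<open>\<Gamma>\<close> is the value group of \<open>v\<close>, rather than an ordered group
  containing it. The trivial valuation is not excluded.
\<close>

definition valuation :: "('k::field \<Rightarrow> 'g::linordered_comm_group_with_zero) \<Rightarrow> bool" where
  "valuation v \<longleftrightarrow>
     (\<forall>x. v x = 0 \<longleftrightarrow> x = 0) \<and>
     (\<forall>x y. v (x * y) = v x * v y) \<and>
     (\<forall>x y. v (x + y) \<le> max (v x) (v y)) \<and>
     surj v"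


section \<open>The two-sorted language of valued fields\<close>

text \<open>
  Both sorts have their own supply of variables, indexed by \<^typ>\<open>nat\<close>. The constructors
  \<open>FConst\<close> and \<open>VConst\<close> name the parameters from the field and from \<open>\<Gamma> \<union> {0}\<close>.
\<close>

datatype 'k fterm =
    FVar nat
  | FConst 'k
  | FZero
  | FOne
  | FAdd "'k fterm" "'k fterm"
  | FMul "'k fterm" "'k fterm"

datatype ('k, 'g) vterm =
    VVar nat
  | VConst 'g
  | VAbs "'k fterm"
  | VMul "('k, 'g) vterm" "('k, 'g) vterm"

datatype ('k, 'g) fm =
    FEq "'k fterm" "'k fterm"
  | VEq "('k, 'g) vterm" "('k, 'g) vterm"
  | VLe "('k, 'g) vterm" "('k, 'g) vterm"
  | Neg "('k, 'g) fm"
  | Conj "('k, 'g) fm" "('k, 'g) fm"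
  | ExF nat "('k, 'g) fm"
  | ExV nat "('k, 'g) fm"

fun fterm_val :: "(nat \<Rightarrow> 'k::field) \<Rightarrow> 'k fterm \<Rightarrow> 'k" where
  "fterm_val e (FVar i) = e i"
| "fterm_val e (FConst c) = c"
| "fterm_val e FZero = 0"
| "fterm_val e FOne = 1"
| "fterm_val e (FAdd s t) = fterm_val e s + fterm_val e t"
| "fterm_val e (FMul s t) = fterm_val e s * fterm_val e t"

fun vterm_val :: "('k::field \<Rightarrow> 'g::linordered_comm_group_with_zero) \<Rightarrow>
    (nat \<Rightarrow> 'k) \<Rightarrow> (nat \<Rightarrow> 'g) \<Rightarrow> ('k, 'g) vterm \<Rightarrow> 'g" where
  "vterm_val v e h (VVar i) = h i"
| "vterm_val v e h (VConst c) = c"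
| "vterm_val v e h (VAbs t) = v (fterm_val e t)"
| "vterm_val v e h (VMul s t) = vterm_val v e h s * vterm_val v e h t"

fun sat :: "('k::field \<Rightarrow> 'g::linordered_comm_group_with_zero) \<Rightarrow>
    (nat \<Rightarrow> 'k) \<Rightarrow> (nat \<Rightarrow> 'g) \<Rightarrow> ('k, 'g) fm \<Rightarrow> bool" where
  "sat v e h (FEq s t) \<longleftrightarrow> fterm_val e s = fterm_val e t"
| "sat v e h (VEq s t) \<longleftrightarrow> vterm_val v e h s = vterm_val v e h t"
| "sat v e h (VLe s t) \<longleftrightarrow> vterm_val v e h s \<le> vterm_val v e h t"
| "sat v e h (Neg \<phi>) \<longleftrightarrow> \<not> sat v e h \<phi>"
| "sat v e h (Conj \<phi> \<psi>) \<longleftrightarrow> sat v e h \<phi> \<and> sat v e h \<psi>"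
| "sat v e h (ExF i \<phi>) \<longleftrightarrow> (\<exists>x. sat v (e(i := x)) h \<phi>)"
| "sat v e h (ExV i \<phi>) \<longleftrightarrow> (\<exists>g. sat v e (h(i := g)) \<phi>)"

fun fterm_vars :: "'k fterm \<Rightarrow> nat set" where
  "fterm_vars (FVar i) = {i}"
| "fterm_vars (FConst c) = {}"
| "fterm_vars FZero = {}"
| "fterm_vars FOne = {}"
| "fterm_vars (FAdd s t) = fterm_vars s \<union> fterm_vars t"
| "fterm_vars (FMul s t) = fterm_vars s \<union> fterm_vars t"

fun vterm_fvars :: "('k, 'g) vterm \<Rightarrow> nat set" where
  "vterm_fvars (VVar i) = {}"
| "vterm_fvars (VConst c) = {}"
| "vterm_fvars (VAbs t) = fterm_vars t"
| "vterm_fvars (VMul s t) = vterm_fvars s \<union> vterm_fvars t"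

fun vterm_vvars :: "('k, 'g) vterm \<Rightarrow> nat set" where
  "vterm_vvars (VVar i) = {i}"
| "vterm_vvars (VConst c) = {}"
| "vterm_vvars (VAbs t) = {}"
| "vterm_vvars (VMul s t) = vterm_vvars s \<union> vterm_vvars t"

fun free_fvars :: "('k, 'g) fm \<Rightarrow> nat set" where
  "free_fvars (FEq s t) = fterm_vars s \<union> fterm_vars t"
| "free_fvars (VEq s t) = vterm_fvars s \<union> vterm_fvars t"
| "free_fvars (VLe s t) = vterm_fvars s \<union> vterm_fvars t"
| "free_fvars (Neg \<phi>) = free_fvars \<phi>"
| "free_fvars (Conj \<phi> \<psi>) = free_fvars \<phi> \<union> free_fvars \<psi>"
| "free_fvars (ExF i \<phi>) = free_fvars \<phi> - {i}"
| "free_fvars (ExV i \<phi>) = free_fvars \<phi>"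

fun free_vvars :: "('k, 'g) fm \<Rightarrow> nat set" where
  "free_vvars (FEq s t) = {}"
| "free_vvars (VEq s t) = vterm_vvars s \<union> vterm_vvars t"
| "free_vvars (VLe s t) = vterm_vvars s \<union> vterm_vvars t"
| "free_vvars (Neg \<phi>) = free_vvars \<phi>"
| "free_vvars (Conj \<phi> \<psi>) = free_vvars \<phi> \<union> free_vvars \<psi>"
| "free_vvars (ExF i \<phi>) = free_vvars \<phi>"
| "free_vvars (ExV i \<phi>) = free_vvars \<phi> - {i}"


section \<open>Closed affine subvarieties and their dimension\<close>

text \<open>
  Points of affine \<open>N\<close>-space over \<open>K\<close> are lists of length \<open>N\<close>. The type
  \<open>(nat \<Rightarrow>\<^sub>0 nat) \<Rightarrow>\<^sub>0 'k\<close> is the ring of polynomials over \<open>'k\<close> in variables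
  indexed by \<^typ>\<open>nat\<close>: a monomial is a finitely supported map from variables to exponents.
\<close>

definition mpoly_vars :: "((nat \<Rightarrow>\<^sub>0 nat) \<Rightarrow>\<^sub>0 'k::zero) \<Rightarrow> nat set" where
  "mpoly_vars p = (\<Union>m\<in>Poly_Mapping.keys p. Poly_Mapping.keys m)"

definition mpoly_eval :: "(nat \<Rightarrow> 'k) \<Rightarrow> ((nat \<Rightarrow>\<^sub>0 nat) \<Rightarrow>\<^sub>0 'k::comm_ring_1) \<Rightarrow> 'k" where
  "mpoly_eval x p =
     (\<Sum>m\<in>Poly_Mapping.keys p. Poly_Mapping.lookup p m *
        (\<Prod>i\<in>Poly_Mapping.keys m. x i ^ Poly_Mapping.lookup m i))"

text \<open>
  Over an algebraically closed field a closed affine subvariety is determined by its set of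
  rational points, and is represented by it. It may be reducible or empty.
\<close>

definition closed_subvariety :: "nat \<Rightarrow> 'k::field list set \<Rightarrow> bool" where
  "closed_subvariety N V \<longleftrightarrow>
     (\<exists>P. (\<forall>p\<in>P. mpoly_vars p \<subseteq> {..<N}) \<and>
          V = {x. length x = N \<and> (\<forall>p\<in>P. mpoly_eval ((!) x) p = 0)})"

definition irreducible_subvariety :: "nat \<Rightarrow> 'k::field list set \<Rightarrow> bool" where
  "irreducible_subvariety N Z \<longleftrightarrow>
     closed_subvariety N Z \<and> Z \<noteq> {} \<and>
     (\<forall>A B. closed_subvariety N A \<longrightarrow> closed_subvariety N B \<longrightarrow> Z = A \<union> B \<longrightarrow> Z = A \<or> Z = B)"

text \<open>
  The Krull dimension for the Zariski topology: the supremum of the lengths \<open>m\<close> of chains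
  \<open>Z 0 \<subset> \<dots> \<subset> Z m\<close> of irreducible closed subsets. The empty variety gets dimension 0.
\<close>

definition variety_dim :: "nat \<Rightarrow> 'k::field list set \<Rightarrow> enat" where
  "variety_dim N V =
     (SUP m \<in> {m. \<exists>Z. (\<forall>i\<le>m. irreducible_subvariety N (Z i) \<and> Z i \<subseteq> V) \<and>
                       (\<forall>i<m. Z i \<subset> Z (Suc i))}. enat m)"

text \<open>
  The product of varieties as a subset of affine \<open>(N + M)\<close>-space; a pair of points is identified
  with the concatenation of their coordinate lists.
\<close>

definition affine_prod :: "'k list set \<Rightarrow> 'k list set \<Rightarrow> 'k list set" where
  "affine_prod V W = {x @ y | x y. x \<in> V \<and> y \<in> W}"

text \<open>
  The set \<open>\<R>(\<psi>, Z)(K)\<close>. The \<open>i\<close>-th coordinate is assigned to the variable \<open>FVar i\<close>. The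
  assignment of the remaining variables is irrelevant when the free variables of \<open>\<psi>\<close> are field
  variables with index less than the dimension of the ambient space, so they are assigned 0.
\<close>

definition realization :: "('k::field \<Rightarrow> 'g::linordered_comm_group_with_zero) \<Rightarrow>
    ('k, 'g) fm \<Rightarrow> 'k list set \<Rightarrow> 'k list set" where
  "realization v \<psi> Z =
     {z \<in> Z. sat v (\<lambda>i. if i < length z then z ! i else 0) (\<lambda>_. 0) \<psi>}"


section \<open>Patterns realized by the fibers of a set\<close>

definition fiber :: "('a \<times> 'b) set \<Rightarrow> 'a set \<Rightarrow> 'b \<Rightarrow> 'a set" where
  "fiber X V w = {x \<in> V. (x, w) \<in> X}"

definition pattern :: "('a \<times> 'b) set \<Rightarrow> 'a set \<Rightarrow> 'a \<Rightarrow> 'b list \<Rightarrow> nat list" where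
  "pattern X V x ws = map (\<lambda>w. if x \<in> fiber X V w then 1 else 0) ws"

text \<open>
  The cardinalities below are at most \<open>2 ^ n\<close>, so the supremum is a maximum if \<open>W\<close> is nonempty.
  It is 0 if \<open>W\<close> is empty and \<open>n > 0\<close>.
\<close>

definition pattern_number :: "('a \<times> 'b) set \<Rightarrow> 'a set \<Rightarrow> 'b set \<Rightarrow> nat \<Rightarrow> nat" where
  "pattern_number X V W n =
     (SUP ws \<in> {ws. set ws \<subseteq> W \<and> length ws = n}. card ((\<lambda>x. pattern X V x ws) ` V))"

end

theory Submission
  imports Defs "HOL-Library.Function_Algebras" "Jordan_Normal_Form.Determinant"
begin

text \<open>
  Quantifier elimination for algebraically closed valued fields reduces the formula to comparisons
  \<open>|p| \<le> |q|\<close> of polynomials, so \<open>n\<close> fibers give \<open>O(n)\<close> comparisons of polynomials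
  of bounded degree in the coordinates of \<open>V\<close>. To a realized pattern attach the product, over the
  comparisons, of the factor that dominates on this pattern. The values of these products at points
  realizing the patterns form a matrix that is triangular modulo ultrametrically smaller terms, so
  the products are linearly independent on \<open>V\<close>. Being polynomials of degree \<open>O(n)\<close>, they are at
  most \<open>O(n^k)\<close> in number by the growth of the Hilbert function of \<open>V\<close>.

  For quantifier elimination, a point is described by a nearest root of the polynomials
  involved and its distance to this root, and roots satisfying a given condition are counted by
  Gauss norms of products over all the roots, which are polynomial in the coefficients.
\<close>

section \<open>Valuations and the Gauss norm\<close>

text \<open>The obstacle in quantifier elimination is that the roots of a polynomial are not
  polynomial functions of its coefficients, so no root can be substituted into a condition. Products
  over all the roots do stay in the coefficient ring. Such a product reveals how many roots satisfy
  |\<alpha>| \<le> |\<beta>|, and a root with a given property exists iff the number of such roots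
  is nonzero. Counts are additive, but conjunctions need products of indicators; comparing Gauss
  norms of polynomials instead of values of field elements makes the basic indicators closed under
  products. Elimination is used once more for the trivial valuation: it turns independent
  coordinates on a closed set into chains of irreducible closed sets, which is how the Krull
  dimension bounds their number. In the count, \<open>L\<close> comparisons of degree at most
  \<open>D\<close> per fiber lead to products of degree at most \<open>n * L * D\<close>, so the
  constant is that of the Hilbert function times \<open>Suc (L * D) ^ k\<close>. Patterns also
  record common zeros, since there both factors would annihilate the product.\<close>

context linordered_comm_group_with_zero
begin

lemma mult_right_mono_value: "a \<le> b \<Longrightarrow> a * c \<le> b * c"
  using mult_left_mono_value[of a b c] by (simp add: mult.commute)

lemma mult_mono_value: "a \<le> b \<Longrightarrow> c \<le> d \<Longrightarrow> a * c \<le> b * d"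
  by (meson mult_left_mono_value mult_right_mono_value order_trans)

lemma mult_left_cancel_value: "c \<noteq> 0 \<Longrightarrow> c * a = c * b \<longleftrightarrow> a = b"
  by (metis ex_right_inverse mult.left_commute mult.right_neutral)

lemma mult_eq_0_iff_value: "a * b = 0 \<longleftrightarrow> a = 0 \<or> b = 0"
  by (metis mult_left_cancel_value mult_zero_left mult_zero_right)

lemma mult_left_le_cancel_value: "c \<noteq> 0 \<Longrightarrow> c * a \<le> c * b \<longleftrightarrow> a \<le> b"
  by (metis mult_left_cancel_value mult_left_mono_value nle_le)

lemma mult_left_less_cancel_value: "c \<noteq> 0 \<Longrightarrow> c * a < c * b \<longleftrightarrow> a < b"
  by (meson mult_left_le_cancel_value not_le)

lemma le_0_iff_value: "a \<le> 0 \<longleftrightarrow> a = 0"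
  using zero_le_value[of a] by auto

lemma pos_iff_value: "0 < a \<longleftrightarrow> a \<noteq> 0"
  using zero_le_value[of a] by auto

lemma mult_strict_mono_value:
  assumes "a < b" "c \<le> d" "d \<noteq> 0"
  shows "a * c < b * d"
proof -
  have "a * c \<le> a * d" by (rule mult_left_mono_value) fact
  also have "\<dots> < b * d"
    using mult_left_less_cancel_value[OF \<open>d \<noteq> 0\<close>, of a b] assms(1) by (simp add: mult.commute)
  finally show ?thesis .
qed

lemma power_eq_0_value: "a ^ n = 0 \<longleftrightarrow> a = 0 \<and> n > 0"
  by (induction n) (auto simp: mult_eq_0_iff_value)

lemma power_mono_value: "a \<le> b \<Longrightarrow> a ^ n \<le> b ^ n"
  by (induction n) (auto intro: mult_mono_value)

lemma power_less_value: "a < b \<Longrightarrow> n > 0 \<Longrightarrow> a ^ n < b ^ n"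
proof (induction n)
  case (Suc n)
  have "b \<noteq> 0" using Suc.prems by (metis zero_le_value leD)
  then show ?case using Suc
    by (simp add: mult_strict_mono_value power_mono_value power_eq_0_value)
qed simp

lemma power_le_iff_value: "n > 0 \<Longrightarrow> a ^ n \<le> b ^ n \<longleftrightarrow> a \<le> b"
  by (meson not_le power_less_value power_mono_value)

lemma power_eq_iff_value: "n > 0 \<Longrightarrow> a ^ n = b ^ n \<longleftrightarrow> a = b"
  by (metis power_le_iff_value order_refl order_antisym)

end

section \<open>Non-archimedean absolute values on integral domains\<close>

locale dval =
  fixes w :: "'a::idom \<Rightarrow> 'g::linordered_comm_group_with_zero"
  assumes eq_0_iff: "w x = 0 \<longleftrightarrow> x = 0"
    and mult: "w (x * y) = w x * w y"
    and add_le: "w (x + y) \<le> max (w x) (w y)"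
begin

lemma zero [simp]: "w 0 = 0"
  by (simp add: eq_0_iff)

lemma one [simp]: "w 1 = 1"
  using mult[of 1 1] eq_0_iff[of 1] mult_left_cancel_value[of "w 1" "w 1" 1] by auto

text \<open>Squaring is injective in an ordered group with zero, and -1 has square 1.\<close>

lemma minus_one: "w (- 1) = 1"
  using mult[of "-1" "-1"] power_eq_iff_value[of 2 "w (-1)" 1] by (simp add: power2_eq_square)

lemma minus [simp]: "w (- x) = w x"
  using mult[of "-1" x] minus_one by simp

lemma diff_le: "w (x - y) \<le> max (w x) (w y)"
  using add_le[of x "-y"] by simp

lemma diff_commute: "w (x - y) = w (y - x)"
  using minus[of "x - y"] by simp

lemma power: "w (x ^ n) = w x ^ n"
  by (induction n) (auto simp: mult)

lemma prod: "w (prod f A) = (\<Prod>i\<in>A. w (f i))"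
  by (induction A rule: infinite_finite_induct) (auto simp: mult)

lemma prod_mset: "w (\<Prod>x\<in>#A. f x) = (\<Prod>x\<in>#A. w (f x))"
  by (induction A) (auto simp: mult)

lemma sum_le: "(\<And>i. i \<in> A \<Longrightarrow> w (f i) \<le> b) \<Longrightarrow> w (sum f A) \<le> b"
proof (induction A rule: infinite_finite_induct)
  case (insert x A)
  then show ?case using add_le[of "f x" "sum f A"] by (auto simp: le_max_iff_disj dest: order_trans)
qed (auto simp: zero_le_value)

lemma sum_less: "b \<noteq> 0 \<Longrightarrow> (\<And>i. i \<in> A \<Longrightarrow> w (f i) < b) \<Longrightarrow> w (sum f A) < b"
proof (induction A rule: infinite_finite_induct)
  case (insert x A)
  then show ?case using add_le[of "f x" "sum f A"]
    by (metis insertCI le_less_trans max_less_iff_conj sum.insert)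
qed (auto simp: pos_iff_value)

lemma add_eq_right: "w x < w y \<Longrightarrow> w (x + y) = w y"
  using add_le[of x y] add_le[of "x + y" "- x"] by (auto simp: max_def split: if_splits)

lemma add_eq_left: "w y < w x \<Longrightarrow> w (x + y) = w x"
  using add_eq_right[of y x] by (simp add: add.commute)

end

section \<open>Gauss norms, their multiplicativity and top indices\<close>

definition gauss_norm :: "('a::zero \<Rightarrow> 'g::linorder) \<Rightarrow> 'a poly \<Rightarrow> 'g" where
  "gauss_norm w p = Max ((\<lambda>i. w (coeff p i)) ` {..degree p})"

text \<open>The Weierstrass degree: for a product of factors X - r it is the number of r with norm
  at most 1. Root counting rests on this.\<close>

definition top_index :: "('a::zero \<Rightarrow> 'g::linorder) \<Rightarrow> 'a poly \<Rightarrow> nat" where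
  "top_index w p = Max {i. i \<le> degree p \<and> w (coeff p i) = gauss_norm w p}"

context dval
begin

lemma coeff_le_gauss_norm: "w (coeff p i) \<le> gauss_norm w p"
proof (cases "i \<le> degree p")
  case False
  then show ?thesis by (simp add: coeff_eq_0 zero_le_value)
qed (simp add: gauss_norm_def)

lemma gauss_norm_attained: "\<exists>i\<le>degree p. gauss_norm w p = w (coeff p i)"
  using Max_in[of "(\<lambda>i. w (coeff p i)) ` {..degree p}"] unfolding gauss_norm_def by fastforce

lemma gauss_norm_le_iff: "gauss_norm w p \<le> b \<longleftrightarrow> (\<forall>i. w (coeff p i) \<le> b)"
  by (metis coeff_le_gauss_norm gauss_norm_attained order_trans)

lemma gauss_norm_eq_0_iff: "gauss_norm w p = 0 \<longleftrightarrow> p = 0"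
  using gauss_norm_le_iff[of p 0] by (auto simp: le_0_iff_value eq_0_iff poly_eq_iff)

lemma gauss_norm_const [simp]: "gauss_norm w [:c:] = w c"
  by (simp add: gauss_norm_def)

text \<open>Fixed bounds \<open>m\<close> and \<open>n\<close> stand in for the degrees, which vary
  with parameters; the comparison becomes one finite Boolean combination valid for a whole
  family.\<close>

lemma gauss_norm_le_bounded_iff:
  assumes "degree p \<le> m" "degree q \<le> n"
  shows "gauss_norm w p \<le> gauss_norm w q \<longleftrightarrow> (\<forall>i\<le>m. \<exists>j\<le>n. w (coeff p i) \<le> w (coeff q j))"
proof
  assume "gauss_norm w p \<le> gauss_norm w q"
  then show "\<forall>i\<le>m. \<exists>j\<le>n. w (coeff p i) \<le> w (coeff q j)"
    by (metis assms(2) coeff_le_gauss_norm gauss_norm_attained order_trans)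
next
  assume *: "\<forall>i\<le>m. \<exists>j\<le>n. w (coeff p i) \<le> w (coeff q j)"
  show "gauss_norm w p \<le> gauss_norm w q"
    by (metis * assms(1) coeff_le_gauss_norm gauss_norm_attained order_trans)
qed

lemma top_index:
  assumes "p \<noteq> 0"
  shows coeff_top_index: "w (coeff p (top_index w p)) = gauss_norm w p"
    and coeff_above_top_index: "i > top_index w p \<Longrightarrow> w (coeff p i) < gauss_norm w p"
proof -
  let ?A = "{i. i \<le> degree p \<and> w (coeff p i) = gauss_norm w p}"
  have fin: "finite ?A" by simp
  have "?A \<noteq> {}" using gauss_norm_attained[of p] by auto
  from Max_in[OF fin this] show "w (coeff p (top_index w p)) = gauss_norm w p"
    by (simp add: top_index_def)
  assume i: "i > top_index w p"
  have "i \<notin> ?A" using Max_ge[OF fin, of i] i unfolding top_index_def by linarith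
  then have "w (coeff p i) \<noteq> gauss_norm w p"
    using gauss_norm_eq_0_iff[of p] assms by (cases "i \<le> degree p") (auto simp: coeff_eq_0)
  then show "w (coeff p i) < gauss_norm w p"
    using coeff_le_gauss_norm[of p i] by simp
qed

lemma top_index_unique:
  assumes "w (coeff p t) = gauss_norm w p" "\<And>i. i > t \<Longrightarrow> w (coeff p i) < gauss_norm w p"
  shows "top_index w p = t"
proof -
  have "p \<noteq> 0" using assms(2)[of "Suc t"] by (auto simp: gauss_norm_def)
  then show ?thesis
    using assms top_index[OF \<open>p \<noteq> 0\<close>] by (metis less_irrefl linorder_neqE_nat)
qed

text \<open>Gauss's lemma. In the coefficient at the sum of the top indices the product of the two
  top coefficients strictly dominates; beyond that sum every term has an index past one of the
  tops.\<close>

lemma mult_top: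
  assumes "p \<noteq> 0" "q \<noteq> 0"
  shows gauss_norm_mult': "gauss_norm w (p * q) = gauss_norm w p * gauss_norm w q"
    and top_index_mult: "top_index w (p * q) = top_index w p + top_index w q"
proof -
  let ?g = "gauss_norm w" and ?s = "top_index w p" and ?t = "top_index w q"
  have nz: "?g p \<noteq> 0" "?g q \<noteq> 0" using assms by (auto simp: gauss_norm_eq_0_iff)
  then have nz2: "?g p * ?g q \<noteq> 0" by (simp add: mult_eq_0_iff_value)
  have term_less: "w (coeff p i * coeff q j) < ?g p * ?g q" if "i > ?s \<or> j > ?t" for i j
    using that
  proof
    assume "i > ?s"
    then show ?thesis unfolding mult
      by (intro mult_strict_mono_value coeff_above_top_index assms coeff_le_gauss_norm nz)
  next
    assume "j > ?t"
    then have "w (coeff q j) * w (coeff p i) < ?g q * ?g p"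
      by (intro mult_strict_mono_value coeff_above_top_index assms coeff_le_gauss_norm nz)
    then show ?thesis by (simp add: mult mult.commute)
  qed
  have le: "w (coeff (p * q) i) \<le> ?g p * ?g q" for i
    unfolding coeff_mult
    by (rule sum_le) (simp add: mult mult_mono_value coeff_le_gauss_norm)
  have less: "w (coeff (p * q) i) < ?g p * ?g q" if "i > ?s + ?t" for i
    unfolding coeff_mult
    by (rule sum_less[OF nz2], rule term_less) (use that in auto)
  have "coeff (p * q) (?s + ?t) = (\<Sum>i\<in>{..?s+?t} - {?s}. coeff p i * coeff q (?s + ?t - i))
      + coeff p ?s * coeff q ?t"
    unfolding coeff_mult by (subst sum.remove[of _ ?s]) (auto simp: add.commute)
  moreover have "w (\<Sum>i\<in>{..?s+?t} - {?s}. coeff p i * coeff q (?s + ?t - i)) < ?g p * ?g q"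
    by (rule sum_less[OF nz2], rule term_less) auto
  moreover have "w (coeff p ?s * coeff q ?t) = ?g p * ?g q"
    by (simp add: mult coeff_top_index assms)
  ultimately have eq: "w (coeff (p * q) (?s + ?t)) = ?g p * ?g q"
    by (simp add: add_eq_right)
  show g: "?g (p * q) = ?g p * ?g q"
    using le eq gauss_norm_le_iff[of "p * q" "?g p * ?g q"]
    by (metis coeff_le_gauss_norm order_antisym)
  show "top_index w (p * q) = ?s + ?t"
    by (rule top_index_unique) (auto simp: g eq less)
qed

lemma gauss_norm_mult: "gauss_norm w (p * q) = gauss_norm w p * gauss_norm w q"
  using gauss_norm_mult'[of p q] gauss_norm_eq_0_iff[of 0] by (cases "p = 0 \<or> q = 0") auto

lemma gauss_norm_add_le: "gauss_norm w (p + q) \<le> max (gauss_norm w p) (gauss_norm w q)"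
  unfolding gauss_norm_le_iff
proof
  fix i
  have "w (coeff (p + q) i) \<le> max (w (coeff p i)) (w (coeff q i))"
    using add_le by simp
  also have "\<dots> \<le> max (gauss_norm w p) (gauss_norm w q)"
    by (intro max.mono coeff_le_gauss_norm)
  finally show "w (coeff (p + q) i) \<le> max (gauss_norm w p) (gauss_norm w q)" .
qed

text \<open>Makes the construction iterable: \<open>top_index (gauss_norm v)\<close> is available
  for polynomials over polynomials.\<close>

lemma dval_gauss_norm: "dval (gauss_norm w)"
  by unfold_locales (auto simp: gauss_norm_eq_0_iff gauss_norm_mult gauss_norm_add_le)

lemma gauss_norm_linear: "gauss_norm w [:a, b:] = max (w a) (w b)"
proof (cases "b = 0")
  case False
  then show ?thesis by (simp add: gauss_norm_def atMost_Suc max.commute)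
qed (simp add: zero_le_value max_def le_0_iff_value)

lemma top_index_linear:
  assumes "a \<noteq> 0 \<or> b \<noteq> 0"
  shows "top_index w [:a, b:] = (if b \<noteq> 0 \<and> w a \<le> w b then 1 else 0)"
proof (cases "b \<noteq> 0 \<and> w a \<le> w b")
  case True
  then show ?thesis
    by (intro top_index_unique)
       (auto simp: gauss_norm_linear max_def coeff_pCons pos_iff_value eq_0_iff split: nat.splits if_splits)
next
  case False
  then have "w b < w a" using assms by (cases "b = 0") (auto simp: pos_iff_value eq_0_iff)
  then show ?thesis using False
    by (intro top_index_unique)
       (auto simp: gauss_norm_linear max_def coeff_pCons pos_iff_value zero_le_value le_0_iff_value split: nat.splits)
qed

lemma top_index_1: "top_index w 1 = 0"
  by (rule top_index_unique) (auto simp: gauss_norm_def pos_iff_value)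

lemma top_index_prod:
  assumes "finite A" "\<And>j. j \<in> A \<Longrightarrow> f j \<noteq> 0"
  shows "top_index w (prod f A) = (\<Sum>j\<in>A. top_index w (f j))"
  using assms
proof (induction A rule: finite_induct)
  case (insert x A)
  then show ?case by (simp add: top_index_mult)
qed (simp add: top_index_1)

text \<open>The shift places the coefficients of \<open>q\<close> beyond those of \<open>p\<close>.
  A maximum of two norms is thus the norm of one polynomial, which later merges two conditions into
  one.\<close>

lemma gauss_norm_add_shift:
  assumes "degree p < m"
  shows "gauss_norm w (p + monom 1 m * q) = max (gauss_norm w p) (gauss_norm w q)"
proof (rule antisym)
  have [simp]: "gauss_norm w (monom 1 m * q) = gauss_norm w q"
  proof -
    have "gauss_norm w (monom 1 m) = 1"
    proof (rule antisym)
      show "gauss_norm w (monom 1 m) \<le> 1" unfolding gauss_norm_le_iff by (simp add: zero_le_value)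
      show "1 \<le> gauss_norm w (monom 1 m)" using coeff_le_gauss_norm[of "monom 1 m" m] by simp
    qed
    then show ?thesis by (simp add: gauss_norm_mult)
  qed
  show "gauss_norm w (p + monom 1 m * q) \<le> max (gauss_norm w p) (gauss_norm w q)"
    using gauss_norm_add_le[of p "monom 1 m * q"] by simp
  have "w (coeff p i) \<le> gauss_norm w (p + monom 1 m * q)" for i
  proof (cases "i \<le> degree p")
    case True
    then have "coeff (p + monom 1 m * q) i = coeff p i"
      using assms by (simp add: coeff_monom_mult)
    then show ?thesis by (metis coeff_le_gauss_norm)
  qed (simp add: coeff_eq_0 zero_le_value)
  moreover have "w (coeff q i) \<le> gauss_norm w (p + monom 1 m * q)" for i
  proof -
    have "coeff (p + monom 1 m * q) (i + m) = coeff q i"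
      using assms by (simp add: coeff_monom_mult coeff_eq_0)
    then show ?thesis by (metis coeff_le_gauss_norm)
  qed
  ultimately show "max (gauss_norm w p) (gauss_norm w q) \<le> gauss_norm w (p + monom 1 m * q)"
    by (simp add: gauss_norm_le_iff)
qed

end

subsection \<open>Valuations of an algebraically closed field\<close>

locale acval = dval v for v :: "'k::alg_closed_field \<Rightarrow> 'g::linordered_comm_group_with_zero"
begin

lemma v_divide: "y \<noteq> 0 \<Longrightarrow> v y * v (x / y) = v x"
  using mult[of y "x / y"] by simp

lemma divide_less_iff: "y \<noteq> 0 \<Longrightarrow> v (x / y) < c \<longleftrightarrow> v x < c * v y"
  using mult_left_less_cancel_value[of "v y" "v (x / y)" c]
  by (simp add: eq_0_iff v_divide mult.commute)

lemma less_divide_iff: "y \<noteq> 0 \<Longrightarrow> c < v (x / y) \<longleftrightarrow> c * v y < v x"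
  using mult_left_less_cancel_value[of "v y" c "v (x / y)"]
  by (simp add: eq_0_iff v_divide mult.commute)

lemma divide_le_iff: "y \<noteq> 0 \<Longrightarrow> v (x / y) \<le> c \<longleftrightarrow> v x \<le> c * v y"
  by (simp add: less_divide_iff flip: not_less)

text \<open>A root \<open>u\<close> of \<open>q - 1\<close>, where \<open>q\<close> has the roots 0
  and \<open>Z\<close>, makes the product of the \<open>u - z\<close> equal to 1. All factors have
  norm at most 1, so each has norm exactly 1; the root 0 gives |u| = 1. This is the infinitude of
  the residue field.\<close>

lemma generic_unit:
  assumes "finite Z" "\<And>z. z \<in> Z \<Longrightarrow> v z \<le> 1"
  obtains u where "v u = 1" "\<And>z. z \<in> Z \<Longrightarrow> v (u - z) = 1"
proof -
  define q where "q = (\<Prod>z\<in>insert 0 Z. [:-z, 1:])"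
  have fin: "finite (insert 0 Z)" using assms by simp
  have degq: "degree q = card (insert 0 Z)"
    unfolding q_def by (simp add: degree_prod_sum_eq del: prod.insert)
  then have "degree q > 0" using fin by (simp add: card_gt_0_iff)
  then have "degree (q - 1) > 0"
    using degq degree_add_eq_left[of "- 1" q] by simp
  then obtain u where "poly (q - 1) u = 0" using alg_closed_imp_poly_has_root by blast
  then have prod1: "(\<Prod>z\<in>insert 0 Z. u - z) = 1"
    by (simp add: q_def poly_prod del: prod.insert)
  have le1: "v z \<le> 1" if "z \<in> insert 0 Z" for z
    using that assms(2) by (auto simp: zero_le_value)
  have u1: "v u \<le> 1"
  proof (rule ccontr)
    assume "\<not> v u \<le> 1"
    then have gt: "v u > 1" by simp
    have "v (u - z) = v u" if "z \<in> insert 0 Z" for z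
      using add_eq_left[of "-z" u] le1[OF that] gt by auto
    then have "v (\<Prod>z\<in>insert 0 Z. u - z) = v u ^ card (insert 0 Z)"
      unfolding prod by (simp del: prod.insert)
    then show False
      using prod1 gt power_less_value[of 1 "v u" "card (insert 0 Z)"] fin
      by (auto simp: card_gt_0_iff simp del: prod.insert)
  qed
  have le: "v (u - z) \<le> 1" if "z \<in> insert 0 Z" for z
    using diff_le[of u z] le1[OF that] u1 by (meson max.boundedI order_trans)
  have eq1: "v (u - z) = 1" if z: "z \<in> insert 0 Z" for z
  proof (rule ccontr)
    assume "v (u - z) \<noteq> 1"
    then have lt: "v (u - z) < 1" using le[OF z] by simp
    have prod_le: "(\<Prod>z\<in>B. v (u - z)) \<le> 1" if "B \<subseteq> insert 0 Z" for B
      using that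
    proof (induction B rule: infinite_finite_induct)
      case (insert x F)
      have "v (u - x) * (\<Prod>z\<in>F. v (u - z)) \<le> 1 * 1"
        by (rule mult_mono_value) (use insert le in auto)
      then show ?case using insert by simp
    qed auto
    have "(\<Prod>z\<in>insert 0 Z - {z}. v (u - z)) \<le> 1" by (rule prod_le) blast
    then have "v (u - z) * (\<Prod>z\<in>insert 0 Z - {z}. v (u - z)) < 1 * 1"
      by (intro mult_strict_mono_value lt) auto
    moreover have "(\<Prod>z\<in>insert 0 Z. v (u - z)) = v (u - z) * (\<Prod>z\<in>insert 0 Z - {z}. v (u - z))"
      by (rule prod.remove[OF fin z])
    moreover have "(\<Prod>z\<in>insert 0 Z. v (u - z)) = 1"
      unfolding prod[symmetric] prod1 by simp
    ultimately show False by simp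
  qed
  show ?thesis using that[of u] eq1[of 0] eq1 by simp
qed

lemma linear_factors:
  fixes a :: "'k poly"
  assumes "a \<noteq> 0"
  obtains c A where "a = Polynomial.smult c (\<Prod>x\<in>#A. [:-x, 1:])" "c \<noteq> 0" "\<And>s. s \<in># A \<Longrightarrow> poly a s = 0"
proof -
  obtain A where A: "a = Polynomial.smult (lead_coeff a) (\<Prod>x\<in>#A. [:-x, 1:])"
    using alg_closed_imp_factorization[OF assms] by blast
  have "poly a s = 0" if "s \<in># A" for s
  proof -
    have "(\<Prod>x\<in>#A. [:-x, 1:]) = [:-s, 1:] * (\<Prod>x\<in>#A - {#s#}. [:-x, 1:])"
      using that by (metis insert_DiffM image_mset_add_mset prod_mset.add_mset)
    then show ?thesis by (subst A) simp
  qed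
  with A assms show ?thesis by (intro that[of "lead_coeff a" A]) auto
qed

text \<open>Each factor X - x becomes (r - x) + t X, of Gauss norm max(|r - x|, |t|). The result is
  the norm of \<open>a\<close> at a generic point of the ball with center \<open>r\<close> and
  radius |t|.\<close>

lemma gauss_norm_pcompose_linear:
  assumes "a = Polynomial.smult c (\<Prod>x\<in>#A. [:-x, 1:])"
  shows "gauss_norm v (pcompose a [:r, t:]) = v c * (\<Prod>x\<in>#A. max (v (r - x)) (v t))"
proof -
  interpret g: dval "gauss_norm v" by (rule dval_gauss_norm)
  have "pcompose a [:r, t:] = [:c:] * (\<Prod>x\<in>#A. [:r - x, t:])"
  proof -
    have "pcompose (\<Prod>x\<in>#A. [:-x, 1:]) [:r, t:] = (\<Prod>x\<in>#A. [:r - x, t:])"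
      proof (induction A)
      case (add x A)
      have "pcompose [:-x, 1:] [:r, t:] = [:r - x, t:]" by (simp add: pcompose_pCons)
      then show ?case using add by (simp add: pcompose_mult del: mult_pCons_left)
    qed (simp add: pcompose_1)
    then show ?thesis by (simp add: assms pcompose_smult)
  qed
  then show ?thesis by (simp add: g.mult g.prod_mset gauss_norm_linear del: mult_pCons_left)
qed

lemma v_poly_linear_factors:
  assumes "a = Polynomial.smult c (\<Prod>x\<in>#A. [:-x, 1:])"
  shows "v (poly a y) = v c * (\<Prod>x\<in>#A. v (y - x))"
proof -
  have "poly (\<Prod>x\<in>#A. [:-x, 1:]) y = (\<Prod>x\<in>#A. y - x)"
    by (induction A) (auto simp: algebra_simps)
  then show ?thesis by (simp add: assms mult prod_mset)
qed

text \<open>Relative to a nearest root, a point behaves like the generic point of a ball.\<close>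

lemma nearest_root:
  assumes "finite L" "[:0, 1:] \<in> L"
  shows "\<exists>q\<in>L. q \<noteq> 0 \<and> (\<exists>r. poly q r = 0 \<and>
           (x = r \<or> (\<exists>t. t \<noteq> 0 \<and> (\<forall>a\<in>L. v (poly a x) = gauss_norm v (pcompose a [:r, t:])))))"
proof -
  define R where "R = (\<Union>q\<in>L - {0}. {r. poly q r = 0})"
  have finR: "finite R" unfolding R_def using assms(1) poly_roots_finite by blast
  \<comment> \<open>The polynomial X guarantees that there is a root to be nearest to.\<close>
  have "0 \<in> R" unfolding R_def using assms(2) by (auto intro!: bexI[of _ "[:0,1:]"])
  then have ne: "R \<noteq> {}" by blast
  define D where "D = Min ((\<lambda>r. v (x - r)) ` R)"
  obtain r where r: "r \<in> R" "D = v (x - r)"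
    using Min_in[of "(\<lambda>r. v (x - r)) ` R"] finR ne unfolding D_def by blast
  have near: "v (x - r) \<le> v (x - s)" if "s \<in> R" for s
    using Min_le[OF finite_imageI[OF finR] imageI[OF that], of "\<lambda>r. v (x - r)"] r(2)
    unfolding D_def by simp
  obtain q where q: "q \<in> L" "q \<noteq> 0" "poly q r = 0" using r(1) by (auto simp: R_def)
  have "v (poly a x) = gauss_norm v (pcompose a [:r, x - r:])" if aL: "a \<in> L" and "x \<noteq> r" for a
  proof (cases "a = 0")
    case False
    obtain c A where A: "a = Polynomial.smult c (\<Prod>x\<in>#A. [:-x, 1:])" "\<And>s. s \<in># A \<Longrightarrow> poly a s = 0"
      using linear_factors[OF False] by metis
    have "v (x - s) = max (v (r - s)) (v (x - r))" if "s \<in># A" for s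
    proof -
      have sR: "s \<in> R" using A(2)[OF that] aL False by (auto simp: R_def)
      \<comment> \<open>As \<open>r\<close> is nearest, |x - r| and hence |r - s| are at most |x -
        s|; the ultrametric inequality for x - s = (r - s) + (x - r) then gives equality with their
        maximum.\<close>
      have 1: "v (r - s) \<le> v (x - s)"
        using diff_le[of "x - s" "x - r"] near[OF sR] by (simp add: max_def)
      show ?thesis
        using near[OF sR] 1 add_le[of "r - s" "x - r"] by (simp add: max_def split: if_splits)
    qed
    then show ?thesis
      unfolding v_poly_linear_factors[OF A(1)] gauss_norm_pcompose_linear[OF A(1)]
      by (metis (mono_tags, lifting) image_mset_cong)
  qed (simp add: gauss_norm_def)
  then show ?thesis using q by (intro bexI[of _ q] conjI exI[of _ r]) (auto intro!: exI[of _ "x - r"])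
qed

text \<open>Converse of \<open>nearest_root\<close>: the point is \<open>r + t * u\<close>, with
  \<open>u\<close> a unit whose residue class avoids those of the finitely many roots in the ball,
  rescaled to the unit ball.\<close>

lemma generic_point_of_ball:
  assumes "finite L" "t \<noteq> 0"
  shows "\<exists>x. \<forall>a\<in>L. v (poly a x) = gauss_norm v (pcompose a [:r, t:])"
proof -
  define R where "R = (\<Union>q\<in>L - {0}. {r. poly q r = 0})"
  have finR: "finite R" unfolding R_def using assms(1) poly_roots_finite by blast
  define Z where "Z = (\<lambda>s. (s - r) / t) ` {s \<in> R. v (r - s) \<le> v t}"
  have "finite Z" using finR by (simp add: Z_def)
  moreover have "v z \<le> 1" if "z \<in> Z" for z
    using that assms(2) diff_commute[of r] by (auto simp: Z_def divide_le_iff)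
  ultimately obtain u where u: "v u = 1" "\<And>z. z \<in> Z \<Longrightarrow> v (u - z) = 1"
    using generic_unit by metis
  define x where "x = r + t * u"
  have "v (poly a x) = gauss_norm v (pcompose a [:r, t:])" if aL: "a \<in> L" for a
  proof (cases "a = 0")
    case False
    obtain c A where A: "a = Polynomial.smult c (\<Prod>x\<in>#A. [:-x, 1:])" "\<And>s. s \<in># A \<Longrightarrow> poly a s = 0"
      using linear_factors[OF False] by metis
    have "v (x - s) = max (v (r - s)) (v t)" if "s \<in># A" for s
    proof (cases "v (r - s) \<le> v t")
      case True
      have "s \<in> R" using A(2)[OF that] aL False by (auto simp: R_def)
      then have "(s - r) / t \<in> Z" using True by (auto simp: Z_def)
      then have "v (u - (s - r) / t) = 1" by (rule u)
      moreover have "x - s = t * (u - (s - r) / t)"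
        using assms(2) by (simp add: x_def field_simps)
      ultimately show ?thesis using True by (simp add: mult max_def)
    next
      case False
      then have "v (t * u) < v (r - s)" by (simp add: mult u)
      then have "v ((r - s) + t * u) = v (r - s)" by (rule add_eq_left)
      then show ?thesis using False by (simp add: x_def max_def algebra_simps)
    qed
    then show ?thesis
      unfolding v_poly_linear_factors[OF A(1)] gauss_norm_pcompose_linear[OF A(1)]
      by (metis (mono_tags, lifting) image_mset_cong)
  qed (simp add: gauss_norm_def)
  then show ?thesis by blast
qed

end

section \<open>Boolean combinations and rings of functions\<close>

text \<open>Quantifier-free definability is a property of predicates rather than of syntax, so
  predicates may be replaced by equal ones; formulas enter through \<open>sat_qf\<close>.\<close>

inductive boolc :: "('e \<Rightarrow> bool) set \<Rightarrow> ('e \<Rightarrow> bool) \<Rightarrow> bool" for A where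
  atom: "X \<in> A \<Longrightarrow> boolc A X"
| true: "boolc A (\<lambda>e. True)"
| neg: "boolc A X \<Longrightarrow> boolc A (\<lambda>e. \<not> X e)"
| conj: "boolc A X \<Longrightarrow> boolc A Y \<Longrightarrow> boolc A (\<lambda>e. X e \<and> Y e)"

lemma boolc_const: "boolc A (\<lambda>e. b)"
proof (cases b)
  case True
  then show ?thesis using boolc.true[of A] by simp
next
  case False
  then show ?thesis using boolc.neg[OF boolc.true, of A] by simp
qed

lemma boolc_disj:
  assumes "boolc A X" "boolc A Y"
  shows "boolc A (\<lambda>e. X e \<or> Y e)"
proof -
  have "boolc A (\<lambda>e. \<not> (\<not> X e \<and> \<not> Y e))"
    by (rule boolc.neg, rule boolc.conj; rule boolc.neg; fact)
  then show ?thesis by simp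
qed

lemma boolc_ball:
  assumes "finite I" "\<And>i. i \<in> I \<Longrightarrow> boolc A (X i)"
  shows "boolc A (\<lambda>e. \<forall>i\<in>I. X i e)"
  using assms
proof (induction I rule: finite_induct)
  case (insert i I)
  then have "boolc A (\<lambda>e. X i e \<and> (\<forall>i\<in>I. X i e))" by (intro boolc.conj) auto
  then show ?case by simp
qed (simp add: boolc_const)

lemma boolc_bex:
  assumes "finite I" "\<And>i. i \<in> I \<Longrightarrow> boolc A (X i)"
  shows "boolc A (\<lambda>e. \<exists>i\<in>I. X i e)"
  using assms
proof (induction I rule: finite_induct)
  case (insert i I)
  then have "boolc A (\<lambda>e. X i e \<or> (\<exists>i\<in>I. X i e))" by (intro boolc_disj) auto
  then show ?case by simp
qed (simp add: boolc_const)

lemma boolc_map: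
  assumes "\<And>x. x \<in> set xs \<Longrightarrow> boolc A (X x)"
  shows "boolc A (\<lambda>e. B (map (\<lambda>x. X x e) xs))"
  using assms
proof (induction xs arbitrary: B)
  case (Cons x xs)
  have "(\<lambda>e. B (map (\<lambda>x. X x e) (x # xs))) =
     (\<lambda>e. X x e \<and> B (True # map (\<lambda>x. X x e) xs) \<or> \<not> X x e \<and> B (False # map (\<lambda>x. X x e) xs))"
    by (rule ext, case_tac "X x e") simp_all
  moreover have "boolc A (\<lambda>e. B (b # map (\<lambda>x. X x e) xs))" for b
    using Cons.IH[of "\<lambda>bs. B (b # bs)"] Cons.prems by simp
  ultimately show ?case
    using Cons.prems by (simp add: boolc_disj boolc.conj boolc.neg)
qed (simp add: boolc_const)

text \<open>Together with \<open>boolc_map\<close> this lets an elimination step alter finitely many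
  atoms while the truth function \<open>B\<close> stays unspecified.\<close>

lemma boolc_finite_rep:
  assumes "boolc A X"
  shows "\<exists>as B. set as \<subseteq> A \<and> X = (\<lambda>e. B (map (\<lambda>a. a e) as))"
  using assms
proof induction
  case (atom X)
  then show ?case by (intro exI[of _ "[X]"] exI[of _ hd]) auto
next
  case true
  show ?case by (intro exI[of _ "[]"] exI[of _ "\<lambda>_. True"]) auto
next
  case (neg X)
  then obtain as B where "set as \<subseteq> A" "X = (\<lambda>e. B (map (\<lambda>a. a e) as))" by blast
  then show ?case by (intro exI[of _ as] exI[of _ "\<lambda>bs. \<not> B bs"]) auto
next
  case (conj X Y)
  then obtain as B cs D where "set as \<subseteq> A" "X = (\<lambda>e. B (map (\<lambda>a. a e) as))"
    "set cs \<subseteq> A" "Y = (\<lambda>e. D (map (\<lambda>a. a e) cs))" by blast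
  then show ?case
    by (intro exI[of _ "as @ cs"] exI[of _ "\<lambda>bs. B (take (length as) bs) \<and> D (drop (length as) bs)"]) auto
qed

lemma boolc_subst:
  assumes "boolc A X" "\<And>a. a \<in> A \<Longrightarrow> boolc A' (\<lambda>e. a (f e))"
  shows "boolc A' (\<lambda>e. X (f e))"
  using assms(1)
proof induction
  case (atom X)
  then show ?case by (rule assms(2))
next
  case true
  show ?case by (rule boolc.true)
next
  case (neg X)
  then show ?case by (intro boolc.neg)
next
  case (conj X Y)
  then show ?case by (intro boolc.conj)
qed

section \<open>Rings of functions of the parameters, and families of polynomials over them\<close>

definition funring :: "('e \<Rightarrow> 'a::comm_ring_1) set \<Rightarrow> bool" where
  "funring F \<longleftrightarrow> (\<lambda>e. 0) \<in> F \<and> (\<lambda>e. 1) \<in> F \<and> (\<forall>f\<in>F. (\<lambda>e. - f e) \<in> F) \<and>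
     (\<forall>f\<in>F. \<forall>g\<in>F. (\<lambda>e. f e + g e) \<in> F \<and> (\<lambda>e. f e * g e) \<in> F)"

lemma
  assumes "funring F"
  shows funring_0: "(\<lambda>e. 0) \<in> F"
    and funring_1: "(\<lambda>e. 1) \<in> F"
    and funring_minus: "f \<in> F \<Longrightarrow> (\<lambda>e. - f e) \<in> F"
    and funring_add: "f \<in> F \<Longrightarrow> g \<in> F \<Longrightarrow> (\<lambda>e. f e + g e) \<in> F"
    and funring_mult: "f \<in> F \<Longrightarrow> g \<in> F \<Longrightarrow> (\<lambda>e. f e * g e) \<in> F"
  using assms by (simp_all add: funring_def)

lemma funring_diff: "funring F \<Longrightarrow> f \<in> F \<Longrightarrow> g \<in> F \<Longrightarrow> (\<lambda>e. f e - g e) \<in> F"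
  using funring_add[of F f "\<lambda>e. - g e"] funring_minus[of F g] by simp

lemma funring_power: "funring F \<Longrightarrow> f \<in> F \<Longrightarrow> (\<lambda>e. f e ^ n) \<in> F"
  by (induction n) (simp_all add: funring_1 funring_mult)

lemma funring_sum: "funring F \<Longrightarrow> (\<And>i. i \<in> I \<Longrightarrow> f i \<in> F) \<Longrightarrow> (\<lambda>e. \<Sum>i\<in>I. f i e) \<in> F"
  by (induction I rule: infinite_finite_induct) (simp_all add: funring_0 funring_add)

lemma funring_prod: "funring F \<Longrightarrow> (\<And>i. i \<in> I \<Longrightarrow> f i \<in> F) \<Longrightarrow> (\<lambda>e. \<Prod>i\<in>I. f i e) \<in> F"
  by (induction I rule: infinite_finite_induct) (simp_all add: funring_1 funring_mult)

text \<open>The degree may drop at some parameters, but its uniform bound keeps every condition on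
  the coefficients finite. Iterating \<open>fpoly\<close> adjoins further variables.\<close>

definition fpoly :: "('e \<Rightarrow> 'a::comm_ring_1) set \<Rightarrow> ('e \<Rightarrow> 'a poly) set" where
  "fpoly F = {p. (\<exists>d. \<forall>e. degree (p e) \<le> d) \<and> (\<forall>n. (\<lambda>e. coeff (p e) n) \<in> F)}"

lemma fpolyI: "(\<And>e. degree (p e) \<le> d) \<Longrightarrow> (\<And>n. (\<lambda>e. coeff (p e) n) \<in> F) \<Longrightarrow> p \<in> fpoly F"
  by (auto simp: fpoly_def)

lemma fpoly_coeff: "p \<in> fpoly F \<Longrightarrow> (\<lambda>e. coeff (p e) n) \<in> F"
  by (auto simp: fpoly_def)

lemma fpoly_degree:
  assumes "p \<in> fpoly F"
  obtains d where "\<And>e. degree (p e) \<le> d"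
  using assms unfolding fpoly_def by blast

lemma fpoly_mono: "F \<subseteq> F' \<Longrightarrow> fpoly F \<subseteq> fpoly F'"
  unfolding fpoly_def by blast

lemma fpoly_pCons:
  assumes "funring F" "f \<in> F" "p \<in> fpoly F"
  shows "(\<lambda>e. pCons (f e) (p e)) \<in> fpoly F"
proof -
  obtain d where d: "\<And>e. degree (p e) \<le> d" using fpoly_degree[OF assms(3)] by blast
  show ?thesis
  proof (rule fpolyI)
    show "degree (pCons (f e) (p e)) \<le> Suc d" for e
      using d[of e] degree_pCons_le[of "f e" "p e"] by simp
    show "(\<lambda>e. coeff (pCons (f e) (p e)) n) \<in> F" for n
      using assms(2) fpoly_coeff[OF assms(3)] by (cases n) auto
  qed
qed

lemma funring_fpoly:
  assumes F: "funring F"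
  shows "funring (fpoly F)"
proof -
  have 0: "(\<lambda>e. 0) \<in> fpoly F"
    by (rule fpolyI[of _ 0]) (auto intro: funring_0[OF F])
  have 1: "(\<lambda>e. 1) \<in> fpoly F"
    using fpoly_pCons[OF F funring_1[OF F] 0] by (simp add: one_pCons)
  have m: "(\<lambda>e. - p e) \<in> fpoly F" if "p \<in> fpoly F" for p
    using that by (auto simp: fpoly_def intro: funring_minus[OF F])
  have a: "(\<lambda>e. p e + q e) \<in> fpoly F" if pq: "p \<in> fpoly F" "q \<in> fpoly F" for p q
  proof -
    obtain c where c: "\<And>e. degree (p e) \<le> c" using fpoly_degree[OF pq(1)] by blast
    obtain d where d: "\<And>e. degree (q e) \<le> d" using fpoly_degree[OF pq(2)] by blast
    have "degree (p e + q e) \<le> max c d" for e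
      using c[of e] d[of e] by (intro degree_add_le) auto
    then show ?thesis
      using pq by (intro fpolyI) (auto intro: funring_add[OF F] fpoly_coeff)
  qed
  have t: "(\<lambda>e. p e * q e) \<in> fpoly F" if pq: "p \<in> fpoly F" "q \<in> fpoly F" for p q
  proof -
    obtain c where c: "\<And>e. degree (p e) \<le> c" using fpoly_degree[OF pq(1)] by blast
    obtain d where d: "\<And>e. degree (q e) \<le> d" using fpoly_degree[OF pq(2)] by blast
    have "degree (p e * q e) \<le> c + d" for e
      using degree_mult_le[of "p e" "q e"] c[of e] d[of e] by linarith
    then show ?thesis
      using pq
      by (intro fpolyI) (auto simp: coeff_mult intro!: funring_sum[OF F] funring_mult[OF F] fpoly_coeff)
  qed
  show ?thesis using 0 1 m a t by (auto simp: funring_def)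
qed

lemma fpoly_const: "funring F \<Longrightarrow> f \<in> F \<Longrightarrow> (\<lambda>e. [:f e:]) \<in> fpoly F"
  by (simp add: fpoly_pCons funring_0 funring_fpoly)

lemma fpoly_monom: "funring F \<Longrightarrow> f \<in> F \<Longrightarrow> (\<lambda>e. monom (f e) n) \<in> fpoly F"
  by (induction n) (simp_all add: monom_0 monom_Suc fpoly_const fpoly_pCons funring_0)

lemma poly_bounded_degree: "degree (p :: 'a::comm_ring_1 poly) \<le> d \<Longrightarrow> poly p x = (\<Sum>i\<le>d. coeff p i * x ^ i)"
  unfolding poly_altdef by (rule sum.mono_neutral_left) (auto simp: coeff_eq_0)

lemma poly_bounded_degree_monom: "degree p \<le> d \<Longrightarrow> p = (\<Sum>i\<le>d. monom (coeff p i) i)"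
  by (metis poly_as_sum_of_monoms')

text \<open>The function ring with one more argument \<open>x\<close> adjoined. With the identity as
  \<open>\<kappa>\<close> this is F[x]; the other choices embed \<open>x\<close> as a constant of an
  iterated polynomial ring.\<close>

definition feval :: "('k \<Rightarrow> 'a) \<Rightarrow> ('e \<Rightarrow> 'a::comm_ring_1) set \<Rightarrow> ('e \<times> 'k \<Rightarrow> 'a) set" where
  "feval \<kappa> F = {\<lambda>(e, x). poly (a e) (\<kappa> x) | a. a \<in> fpoly F}"

lemma fevalI: "a \<in> fpoly F \<Longrightarrow> f = (\<lambda>(e, x). poly (a e) (\<kappa> x)) \<Longrightarrow> f \<in> feval \<kappa> F"
  by (auto simp: feval_def)

lemma funring_feval:
  assumes F: "funring F"
  shows "funring (feval \<kappa> F)"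
proof -
  note P = funring_fpoly[OF F]
  show ?thesis
    unfolding funring_def
  proof (intro conjI ballI)
    show "(\<lambda>e. 0) \<in> feval \<kappa> F" by (rule fevalI[OF funring_0[OF P]]) auto
    show "(\<lambda>e. 1) \<in> feval \<kappa> F" by (rule fevalI[OF funring_1[OF P]]) auto
  next
    fix f assume "f \<in> feval \<kappa> F"
    then obtain a where a: "a \<in> fpoly F" "f = (\<lambda>(e, x). poly (a e) (\<kappa> x))" by (auto simp: feval_def)
    show "(\<lambda>e. - f e) \<in> feval \<kappa> F" by (rule fevalI[OF funring_minus[OF P a(1)]]) (auto simp: a)
    fix g assume "g \<in> feval \<kappa> F"
    then obtain b where b: "b \<in> fpoly F" "g = (\<lambda>(e, x). poly (b e) (\<kappa> x))" by (auto simp: feval_def)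
    show "(\<lambda>e. f e + g e) \<in> feval \<kappa> F"
      by (rule fevalI[OF funring_add[OF P a(1) b(1)]]) (auto simp: a b)
    show "(\<lambda>e. f e * g e) \<in> feval \<kappa> F"
      by (rule fevalI[OF funring_mult[OF P a(1) b(1)]]) (auto simp: a b)
  qed
qed

lemma feval_fst: "funring F \<Longrightarrow> f \<in> F \<Longrightarrow> (\<lambda>(e, x). f e) \<in> feval \<kappa> F"
  by (rule fevalI[of "\<lambda>e. [:f e:]"]) (simp_all add: fpoly_const)

lemma feval_snd: "funring F \<Longrightarrow> (\<lambda>(e, x). \<kappa> x) \<in> feval \<kappa> F"
  by (rule fevalI[of "\<lambda>e. [:0, 1:]"])
     (simp_all add: fpoly_pCons fpoly_const funring_0 funring_1)

text \<open>Interchange of variables, from F[x][T] to F[T][x]. It allows a root to be substituted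
  for \<open>x\<close> while T remains formal.\<close>

lemma fpoly_feval_subset:
  fixes F :: "('e \<Rightarrow> 'a::comm_ring_1) set"
  assumes F: "funring F"
  shows "fpoly (feval \<kappa> F) \<subseteq> feval (\<lambda>x. [:\<kappa> x:]) (fpoly F)"
proof
  fix f assume f: "f \<in> fpoly (feval \<kappa> F)"
  let ?R = "feval (\<lambda>x. [:\<kappa> x:]) (fpoly F)"
  have R: "funring ?R" by (intro funring_feval funring_fpoly F)
  have const: "(\<lambda>z. [:g z:]) \<in> ?R" if g: "g \<in> feval \<kappa> F" for g
  proof -
    obtain a where a: "a \<in> fpoly F" "g = (\<lambda>(e, x). poly (a e) (\<kappa> x))"
      using g unfolding feval_def by blast
    have "(\<lambda>e. map_poly (\<lambda>c. [:c:]) (a e)) \<in> fpoly (fpoly F)"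
    proof -
      obtain d where d: "\<And>e. degree (a e) \<le> d" using fpoly_degree[OF a(1)] by blast
      show ?thesis
        by (rule fpolyI[of _ d]) (auto simp: coeff_map_poly intro!: fpoly_const F fpoly_coeff a
            order_trans[OF map_poly_degree_leq d])
    qed
    moreover have "[:poly p y:] = poly (map_poly (\<lambda>c. [:c:]) p) [:y:]" for p :: "'a poly" and y
    proof (induction p)
      case (pCons c p)
      then show ?case by (simp add: map_poly_pCons flip: pCons.IH)
    qed simp
    ultimately show ?thesis by (intro fevalI) (auto simp: a(2))
  qed
  obtain d where d: "\<And>z. degree (f z) \<le> d" using fpoly_degree[OF f] by blast
  have eq: "f = (\<lambda>z. \<Sum>i\<le>d. [:coeff (f z) i:] * monom 1 i)"
  proof (rule ext)
    fix z
    show "f z = (\<Sum>i\<le>d. [:coeff (f z) i:] * monom 1 i)"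
      using poly_bounded_degree_monom[OF d[of z]] by (simp add: smult_monom)
  qed
  have monom: "(\<lambda>z. monom 1 i) \<in> ?R" for i
    using feval_fst[OF funring_fpoly[OF F] fpoly_monom[OF F funring_1[OF F]], of i "\<lambda>x. [:\<kappa> x:]"]
    by (simp add: case_prod_beta')
  show "f \<in> ?R"
    by (subst eq) (intro funring_sum[OF R] funring_mult[OF R] const fpoly_coeff[OF f] monom)
qed

section \<open>Norms over the roots of a monic polynomial\<close>

text \<open>Division by a monic polynomial requires no inverses in \<open>F\<close>. The induction
  lowers a bound \<open>n\<close> on the nonzero coefficients, cancelling the coefficient at
  \<open>n\<close> for all parameters at once.\<close>

lemma fpoly_reduce:
  assumes F: "funring F" and p: "p \<in> fpoly F" and monic: "\<And>e. degree (p e) = d" "\<And>e. coeff (p e) d = 1"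
    and g: "g \<in> fpoly F"
  shows "\<exists>\<rho>\<in>fpoly F. \<forall>e. (\<forall>i\<ge>d. coeff (\<rho> e) i = 0) \<and> p e dvd g e - \<rho> e"
proof -
  note P = funring_fpoly[OF F]
  have "\<exists>\<rho>\<in>fpoly F. \<forall>e. (\<forall>i\<ge>d. coeff (\<rho> e) i = 0) \<and> p e dvd g e - \<rho> e"
    if "g \<in> fpoly F" "\<And>e i. i \<ge> n \<Longrightarrow> coeff (g e) i = 0" for n g
    using that
  proof (induction n arbitrary: g)
    case 0
    then show ?case by (intro bexI[of _ g]) auto
  next
    case (Suc n)
    show ?case
    proof (cases "n < d")
      case True
      then show ?thesis using Suc.prems by (intro bexI[of _ g]) auto
    next
      case False
      define h where "h = (\<lambda>e. g e - monom (coeff (g e) n) (n - d) * p e)"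
      have "h \<in> fpoly F"
        unfolding h_def using Suc.prems(1) p
        by (intro funring_diff[OF P] funring_mult[OF P] fpoly_monom[OF F] fpoly_coeff)
      moreover have "coeff (h e) i = 0" if "i \<ge> n" for e i
      proof (cases "i = n")
        case True
        then show ?thesis using False by (simp add: h_def coeff_monom_mult monic)
      next
        case ne: False
        then have "coeff (p e) (i - (n - d)) = 0"
          using that False by (intro coeff_eq_0) (simp add: monic)
        then show ?thesis
          using ne that Suc.prems(2)[of i e] by (simp add: h_def coeff_monom_mult)
      qed
      ultimately obtain \<rho> where \<rho>: "\<rho> \<in> fpoly F" "\<And>e i. i \<ge> d \<Longrightarrow> coeff (\<rho> e) i = 0"
        "\<And>e. p e dvd h e - \<rho> e"
        using Suc.IH by blast
      have "p e dvd g e - \<rho> e" for e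
      proof -
        have *: "g e - \<rho> e = (h e - \<rho> e) + monom (coeff (g e) n) (n - d) * p e" by (simp add: h_def)
        show ?thesis unfolding * by (intro dvd_add \<rho>(3) dvd_triv_right)
      qed
      then show ?thesis using \<rho> by blast
    qed
  qed
  moreover obtain n where "\<And>e. degree (g e) \<le> n" using fpoly_degree[OF g] by blast
  then have "coeff (g e) i = 0" if "i \<ge> Suc n" for e i
    using that by (intro coeff_eq_0) (metis Suc_le_lessD le_less_trans)
  ultimately show ?thesis using g by blast
qed

lemma monic_dvd_imp_0:
  fixes p :: "'a::idom poly"
  assumes "p dvd q" "degree p = d" "p \<noteq> 0" "\<forall>i\<ge>d. coeff q i = 0"
  shows "q = 0"
proof (rule ccontr)
  assume "q \<noteq> 0"
  then have "degree q \<ge> d" using assms dvd_imp_degree_le by blast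
  then show False using assms(4) \<open>q \<noteq> 0\<close> by auto
qed

text \<open>Multiplication by \<open>g\<close> modulo \<open>p\<close> is triangular in the Newton basis of the roots.\<close>

lemma det_multiplication_matrix:
  fixes p g :: "'a::idom poly" and r :: "nat \<Rightarrow> 'a" and \<rho> :: "nat \<Rightarrow> 'a poly"
  assumes p: "p = (\<Prod>j<d. [:- r j, 1:])"
    and \<rho>: "\<And>k i. i \<ge> d \<Longrightarrow> coeff (\<rho> k) i = 0" "\<And>k. p dvd g * monom 1 k - \<rho> k"
  shows "det (mat d d (\<lambda>(i, j). coeff (\<rho> i) j)) = (\<Prod>j<d. poly g (r j))"
proof -
  define N where "N = (\<lambda>i. \<Prod>l<i. [:- r l, 1:])"
  have degN: "degree (N i) = i" for i
    unfolding N_def by (subst degree_prod_sum_eq) auto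
  have lcN: "coeff (N i) i = 1" for i
    using lead_coeff_prod[of "\<lambda>l. [:- r l, 1:]" "{..<i}"] degN[of i] by (simp add: N_def)
  have degp: "degree p = d" and p0: "p \<noteq> 0" using degN[of d] lcN[of d] by (auto simp: N_def p)
  \<comment> \<open>Expansion of \<open>N i * h\<close> in the Newton basis modulo \<open>p\<close>,
    descending from \<open>i = d\<close>, where \<open>N d = p\<close>. Write h = h(r i) + (X - r i)
    h'; the factor X - r i turns \<open>N i\<close> into \<open>N (Suc i)\<close>.\<close>
  have tri: "\<exists>t. (i < d \<longrightarrow> t i = poly h (r i)) \<and> p dvd N i * h - (\<Sum>k\<in>{i..<d}. Polynomial.smult (t k) (N k))"
    if "i \<le> d" for i h
    using that
  proof (induction i arbitrary: h rule: inc_induct)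
    case base
    show ?case by (rule exI[of _ "\<lambda>_. 0"]) (simp add: p N_def)
  next
    case (step i)
    have "[:- r i, 1:] dvd h - [:poly h (r i):]" by (simp add: poly_eq_0_iff_dvd[symmetric])
    then obtain h' where h': "h = [:poly h (r i):] + [:- r i, 1:] * h'"
      by (metis dvd_def diff_eq_eq add.commute)
    obtain t where t: "p dvd N (Suc i) * h' - (\<Sum>k\<in>{Suc i..<d}. Polynomial.smult (t k) (N k))"
      using step.IH by blast
    define t' where "t' = t(i := poly h (r i))"
    have "(\<Sum>k\<in>{i..<d}. Polynomial.smult (t' k) (N k)) = Polynomial.smult (poly h (r i)) (N i) + (\<Sum>k\<in>{Suc i..<d}. Polynomial.smult (t k) (N k))"
      using step.hyps by (subst sum.atLeast_Suc_lessThan) (auto simp: t'_def intro!: sum.cong)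
    moreover have "N i * h = Polynomial.smult (poly h (r i)) (N i) + N (Suc i) * h'"
    proof -
      have "N i * h = N i * [:poly h (r i):] + N i * [:- r i, 1:] * h'"
        by (subst h') (simp only: distrib_left mult.assoc)
      also have "N i * [:- r i, 1:] = N (Suc i)" by (simp add: N_def mult.commute)
      finally show ?thesis by (simp add: mult.commute[of "N i"])
    qed
    ultimately have "p dvd N i * h - (\<Sum>k\<in>{i..<d}. Polynomial.smult (t' k) (N k))" using t by simp
    then show ?case by (intro exI[of _ t']) (simp add: t'_def)
  qed
  have "\<forall>i\<in>{..<d}. \<exists>t. t i = poly g (r i) \<and> p dvd N i * g - (\<Sum>k\<in>{i..<d}. Polynomial.smult (t k) (N k))"
    using tri less_imp_le by (metis lessThan_iff)
  then obtain t where t: "\<And>i. i < d \<Longrightarrow> t i i = poly g (r i)"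
    "\<And>i. i < d \<Longrightarrow> p dvd N i * g - (\<Sum>k\<in>{i..<d}. Polynomial.smult (t i k) (N k))"
    by (metis lessThan_iff)
  define M U T where "M = mat d d (\<lambda>(i, j). coeff (\<rho> i) j)"
    and "U = mat d d (\<lambda>(i, j). coeff (N i) j)"
    and "T = mat d d (\<lambda>(i, j). if i \<le> j then t i j else 0)"
  have carr: "M \<in> carrier_mat d d" "U \<in> carrier_mat d d" "T \<in> carrier_mat d d"
    by (auto simp: M_def U_def T_def)
  \<comment> \<open>The remainder of \<open>N i * g\<close> obtained from monomials on one side and
    from the Newton basis on the other: both have degree below \<open>d\<close> and their difference
    is divisible by \<open>p\<close>.\<close>
  have row: "(\<Sum>k<d. Polynomial.smult (coeff (N i) k) (\<rho> k)) = (\<Sum>k\<in>{i..<d}. Polynomial.smult (t i k) (N k))" if i: "i < d" for i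
  proof -
    have "N i = (\<Sum>k<d. monom (coeff (N i) k) k)"
      using poly_bounded_degree_monom[of "N i" "d - 1"] i degN[of i]
      by (cases d) (auto simp: lessThan_Suc_atMost)
    then have "N i * g = (\<Sum>k<d. monom (coeff (N i) k) k) * g" by simp
    also have "\<dots> = (\<Sum>k<d. Polynomial.smult (coeff (N i) k) (g * monom 1 k))"
      unfolding sum_distrib_right
      by (intro sum.cong) (simp_all add: mult.commute[of g] smult_monom flip: mult_smult_left)
    finally have "N i * g - (\<Sum>k<d. Polynomial.smult (coeff (N i) k) (\<rho> k)) =
        (\<Sum>k<d. Polynomial.smult (coeff (N i) k) (g * monom 1 k - \<rho> k))"
      by (simp add: sum_subtractf smult_diff_right)
    also have "p dvd \<dots>" by (intro dvd_sum dvd_smult \<rho>(2))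
    finally have "p dvd N i * g - (\<Sum>k<d. Polynomial.smult (coeff (N i) k) (\<rho> k))" .
    from dvd_diff[OF t(2)[OF i] this]
    have "p dvd (\<Sum>k<d. Polynomial.smult (coeff (N i) k) (\<rho> k)) - (\<Sum>k\<in>{i..<d}. Polynomial.smult (t i k) (N k))" by simp
    moreover have "\<forall>j\<ge>d. coeff ((\<Sum>k<d. Polynomial.smult (coeff (N i) k) (\<rho> k)) - (\<Sum>k\<in>{i..<d}. Polynomial.smult (t i k) (N k))) j = 0"
      by (auto simp: coeff_sum \<rho>(1) coeff_eq_0 degN)
    ultimately show ?thesis using monic_dvd_imp_0[OF _ degp p0] eq_iff_diff_eq_0 by blast
  qed
  \<comment> \<open>\<open>U\<close> is the unitriangular change of basis, so \<open>M\<close> has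
    the determinant of the triangular \<open>T\<close>, and \<open>U\<close> need not be
    inverted.\<close>
  have "U * M = T * U"
  proof (rule eq_matI)
    fix i j assume "i < dim_row (T * U)" "j < dim_col (T * U)"
    then have ij: "i < d" "j < d" using carr by auto
    have "(U * M) $$ (i, j) = (\<Sum>k<d. coeff (N i) k * coeff (\<rho> k) j)"
      using ij by (simp add: U_def M_def scalar_prod_def lessThan_atLeast0)
    also have "\<dots> = coeff (\<Sum>k<d. Polynomial.smult (coeff (N i) k) (\<rho> k)) j" by (simp add: coeff_sum)
    also have "\<dots> = coeff (\<Sum>k\<in>{i..<d}. Polynomial.smult (t i k) (N k)) j" by (simp add: row[OF ij(1)])
    also have "\<dots> = (\<Sum>k\<in>{i..<d}. t i k * coeff (N k) j)" by (simp add: coeff_sum)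
    also have "\<dots> = (\<Sum>k\<in>{0..<d}. (if i \<le> k then t i k else 0) * coeff (N k) j)"
      by (rule sum.mono_neutral_cong_left) auto
    also have "\<dots> = (T * U) $$ (i, j)"
      using ij by (simp add: U_def T_def scalar_prod_def)
    finally show "(U * M) $$ (i, j) = (T * U) $$ (i, j)" .
  qed (use carr in auto)
  then have "det U * det M = det T * det U" using carr by (metis det_mult)
  moreover have "det U = 1"
  proof -
    have "det U = prod_list (diag_mat U)"
      by (rule det_lower_triangular[OF _ carr(2)]) (auto simp: U_def coeff_eq_0 degN)
    also have "\<dots> = (\<Prod>i = 0..<d. U $$ (i, i))" using carr by (simp add: prod_list_diag_prod)
    also have "\<dots> = 1" by (simp add: U_def lcN)
    finally show ?thesis .
  qed
  moreover have "det T = (\<Prod>j<d. poly g (r j))"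
  proof -
    have "det T = prod_list (diag_mat T)"
      by (rule det_upper_triangular[OF _ carr(3)]) (auto simp: T_def upper_triangular_def)
    also have "\<dots> = (\<Prod>i = 0..<d. T $$ (i, i))" using carr by (simp add: prod_list_diag_prod)
    also have "\<dots> = (\<Prod>j<d. poly g (r j))" by (simp add: T_def t(1) lessThan_atLeast0)
    finally show ?thesis .
  qed
  ultimately show ?thesis by (simp add: M_def)
qed

text \<open>The product equals a determinant whose entries are coefficients of remainders, hence lie
  in \<open>F\<close>. The roots themselves may depend on the parameter in an arbitrary way.\<close>

lemma norm_in_funring:
  fixes F :: "('e \<Rightarrow> 'a::idom) set" and r :: "'e \<Rightarrow> nat \<Rightarrow> 'a"
  assumes F: "funring F" and p: "p \<in> fpoly F" and r: "\<And>e. p e = (\<Prod>j<d. [:- r e j, 1:])"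
    and g: "g \<in> fpoly F"
  shows "(\<lambda>e. \<Prod>j<d. poly (g e) (r e j)) \<in> F"
proof -
  have deg: "degree (p e) = d" for e
    unfolding r by (subst degree_prod_sum_eq) auto
  have lc: "coeff (p e) d = 1" for e
    using lead_coeff_prod[of "\<lambda>l. [:- r e l, 1:]" "{..<d}"] deg[of e] by (simp add: r)
  have "\<exists>\<rho>\<in>fpoly F. \<forall>e. (\<forall>i\<ge>d. coeff (\<rho> e) i = 0) \<and> p e dvd g e * monom 1 k - \<rho> e" for k
    by (intro fpoly_reduce[OF F p deg lc] funring_mult[OF funring_fpoly[OF F]] g fpoly_monom funring_1 F)
  then obtain \<rho> where \<rho>: "\<And>k. \<rho> k \<in> fpoly F" "\<And>k e i. i \<ge> d \<Longrightarrow> coeff (\<rho> k e) i = 0"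
    "\<And>k e. p e dvd g e * monom 1 k - \<rho> k e"
    by metis
  have "(\<lambda>e. \<Prod>j<d. poly (g e) (r e j)) = (\<lambda>e. det (mat d d (\<lambda>(i, j). coeff (\<rho> i e) j)))"
    using det_multiplication_matrix[OF r \<rho>(2) \<rho>(3)] by auto
  also have "\<dots> = (\<lambda>e. \<Sum>\<pi> | \<pi> permutes {0..<d}. of_int (sign \<pi>) * (\<Prod>i=0..<d. coeff (\<rho> i e) (\<pi> i)))"
  proof (rule ext)
    fix e
    have "\<pi> i < d" if "\<pi> permutes {0..<d}" "i < d" for \<pi> i
      using that permutes_in_image[of \<pi> "{0..<d}" i] by simp
    then show "det (mat d d (\<lambda>(i, j). coeff (\<rho> i e) j)) =
        (\<Sum>\<pi> | \<pi> permutes {0..<d}. of_int (sign \<pi>) * (\<Prod>i=0..<d. coeff (\<rho> i e) (\<pi> i)))"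
      by (subst det_def'[of _ d]) (auto intro!: sum.cong prod.cong)
  qed
  also have "\<dots> \<in> F"
  proof (intro funring_sum[OF F] funring_mult[OF F] funring_prod[OF F] fpoly_coeff \<rho>)
    show "(\<lambda>e. of_int (sign \<pi>)) \<in> F" for \<pi> :: "nat \<Rightarrow> nat"
      using funring_1[OF F] funring_minus[OF F funring_1[OF F]] by (simp add: sign_def)
  qed
  finally show ?thesis .
qed

lemma map_poly_hom_mult:
  assumes "\<kappa> 0 = 0" "\<And>x y. \<kappa> (x + y) = \<kappa> x + \<kappa> y" "\<And>x y. \<kappa> (x * y) = \<kappa> x * (\<kappa> y :: 'b::comm_ring_1)"
  shows "map_poly \<kappa> (p * q) = map_poly \<kappa> p * map_poly \<kappa> (q :: 'a::comm_ring_1 poly)"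
proof (rule poly_eqI)
  fix n
  have "\<kappa> (sum f A) = (\<Sum>i\<in>A. \<kappa> (f i))" for f :: "nat \<Rightarrow> 'a" and A
    by (induction A rule: infinite_finite_induct) (auto simp: assms)
  then show "coeff (map_poly \<kappa> (p * q)) n = coeff (map_poly \<kappa> p * map_poly \<kappa> q) n"
    by (simp add: coeff_map_poly assms coeff_mult)
qed

text \<open>The images of the roots under \<open>\<kappa>\<close> are the roots of the image of
  \<open>p\<close>, so \<open>norm_in_funring\<close> applies over the larger ring and the factors
  may carry formal variables.\<close>

lemma norm_feval:
  fixes F :: "('e \<Rightarrow> 'k::idom) set" and R :: "('e \<Rightarrow> 'a::idom) set" and r :: "'e \<Rightarrow> nat \<Rightarrow> 'k"
  assumes R: "funring R" and p: "p \<in> fpoly F" and r: "\<And>e. p e = (\<Prod>j<d. [:- r e j, 1:])"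
    and hom: "\<kappa> 0 = 0" "\<kappa> 1 = 1" "\<And>x y. \<kappa> (x + y) = \<kappa> x + \<kappa> y" "\<And>x y. \<kappa> (x * y) = \<kappa> x * \<kappa> y"
    and FR: "\<And>f. f \<in> F \<Longrightarrow> (\<lambda>e. \<kappa> (f e)) \<in> R"
    and \<gamma>: "\<gamma> \<in> feval \<kappa> R"
  shows "(\<lambda>e. \<Prod>j<d. \<gamma> (e, r e j)) \<in> R"
proof -
  obtain g where g: "g \<in> fpoly R" "\<gamma> = (\<lambda>(e, x). poly (g e) (\<kappa> x))"
    using \<gamma> by (auto simp: feval_def)
  obtain n where n: "\<And>e. degree (p e) \<le> n" using fpoly_degree[OF p] by blast
  have "(\<lambda>e. map_poly \<kappa> (p e)) \<in> fpoly R"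
    by (rule fpolyI[of _ n])
       (auto simp: coeff_map_poly hom intro!: FR fpoly_coeff p order_trans[OF map_poly_degree_leq n])
  moreover have "map_poly \<kappa> (p e) = (\<Prod>j<d. [:- \<kappa> (r e j), 1:])" for e
  proof -
    have neg: "\<kappa> (- x) = - \<kappa> x" for x
      using hom(3)[of x "-x"] hom(1) by (simp add: eq_neg_iff_add_eq_0 add.commute)
    have "map_poly \<kappa> (\<Prod>j\<in>A. [:- r e j, 1:]) = (\<Prod>j\<in>A. [:- \<kappa> (r e j), 1:])" for A
    proof (induction A rule: infinite_finite_induct)
      case (insert x A)
      have "map_poly \<kappa> [:- r e x, 1:] = [:- \<kappa> (r e x), 1:]"
        by (simp add: map_poly_pCons hom neg)
      then show ?case using insert
        by (simp add: map_poly_hom_mult[of \<kappa>] hom del: mult_pCons_left)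
    qed (simp_all add: hom)
    then show ?thesis by (simp add: r)
  qed
  ultimately have "(\<lambda>e. \<Prod>j<d. poly (g e) (\<kappa> (r e j))) \<in> R"
    by (intro norm_in_funring[OF R _ _ g(1)])
  then show ?thesis by (simp add: g(2))
qed

section \<open>Counting roots definably\<close>

definition val_atoms :: "('k \<Rightarrow> 'g::ord) \<Rightarrow> ('e \<Rightarrow> 'k) set \<Rightarrow> ('e \<Rightarrow> bool) set" where
  "val_atoms v F = {\<lambda>e. v (a e) \<le> v (b e) | a b. a \<in> F \<and> b \<in> F}"

abbreviation qf :: "('k \<Rightarrow> 'g::ord) \<Rightarrow> ('e \<Rightarrow> 'k) set \<Rightarrow> ('e \<Rightarrow> bool) \<Rightarrow> bool" where
  "qf v F \<equiv> boolc (val_atoms v F)"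

lemma qf_le: "a \<in> F \<Longrightarrow> b \<in> F \<Longrightarrow> qf v F (\<lambda>e. v (a e) \<le> v (b e))"
  by (rule boolc.atom) (auto simp: val_atoms_def)

text \<open>A definable integer-valued function. The finite range turns an equation between
  combinations of such functions into a finite disjunction.\<close>

definition qfun :: "('k \<Rightarrow> 'g::ord) \<Rightarrow> ('e \<Rightarrow> 'k) set \<Rightarrow> ('e \<Rightarrow> int) \<Rightarrow> bool" where
  "qfun v F f \<longleftrightarrow> finite (range f) \<and> (\<forall>t. qf v F (\<lambda>e. f e = t))"

lemma qfun_comb:
  assumes "qfun v F f" "qfun v F g"
  shows "qfun v F (\<lambda>e. c (f e) (g e))"
  unfolding qfun_def
proof
  have fin: "finite (range f \<times> range g)" using assms by (simp add: qfun_def)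
  have "range (\<lambda>e. c (f e) (g e)) \<subseteq> case_prod c ` (range f \<times> range g)" by auto
  then show "finite (range (\<lambda>e. c (f e) (g e)))" using fin finite_surj by blast
  show "\<forall>t. qf v F (\<lambda>e. c (f e) (g e) = t)"
  proof
    fix t
    have "qf v F (\<lambda>e. \<exists>p\<in>{p \<in> range f \<times> range g. case_prod c p = t}. f e = fst p \<and> g e = snd p)"
      by (rule boolc_bex) (use fin assms in \<open>auto simp: qfun_def intro!: boolc.conj\<close>)
    moreover have "(\<lambda>e. c (f e) (g e) = t) =
        (\<lambda>e. \<exists>p\<in>{p \<in> range f \<times> range g. case_prod c p = t}. f e = fst p \<and> g e = snd p)"
      by (rule ext) auto
    ultimately show "qf v F (\<lambda>e. c (f e) (g e) = t)" by simp
  qed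
qed

text \<open>Each vanishing \<open>f j\<close> contributes a factor X, so the product starts at
  degree \<open>card Z\<close>, with the product of the other \<open>f j\<close> as its lowest
  coefficient.\<close>

lemma coeff_prod_linear:
  fixes f :: "'j \<Rightarrow> 'a::idom"
  assumes "finite A"
  defines "Z \<equiv> {j \<in> A. f j = 0}"
  shows "i < card Z \<Longrightarrow> coeff (\<Prod>j\<in>A. [:f j, 1:]) i = 0"
    and "coeff (\<Prod>j\<in>A. [:f j, 1:]) (card Z) = (\<Prod>j\<in>A - Z. f j)"
proof -
  have "(\<Prod>j\<in>Z. [:f j, 1:]) = (\<Prod>j\<in>Z. monom 1 1)"
    by (rule prod.cong) (auto simp: Z_def monom_altdef)
  also have "\<dots> = monom 1 (card Z)" by (simp add: monom_power)
  finally have eq: "(\<Prod>j\<in>A. [:f j, 1:]) = monom 1 (card Z) * (\<Prod>j\<in>A - Z. [:f j, 1:])"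
    using prod.subset_diff[of Z A "\<lambda>j. [:f j, 1:]"] assms by (auto simp: Z_def mult.commute)
  show "i < card Z \<Longrightarrow> coeff (\<Prod>j\<in>A. [:f j, 1:]) i = 0"
    by (simp add: eq coeff_monom_mult)
  have "coeff (\<Prod>j\<in>A - Z. [:f j, 1:]) 0 = (\<Prod>j\<in>A - Z. f j)"
    by (simp add: poly_prod flip: poly_0_coeff_0)
  then show "coeff (\<Prod>j\<in>A. [:f j, 1:]) (card Z) = (\<Prod>j\<in>A - Z. f j)"
    by (simp add: eq coeff_monom_mult)
qed

text \<open>An additive group of integer-valued functions, because summation over roots is additive.
  The generators demand \<open>\<beta> z \<noteq> 0\<close> since that is the condition measured by
  \<open>top_index_linear\<close>.\<close>

inductive cspan :: "('k::zero \<Rightarrow> 'g::linorder) \<Rightarrow> ('z \<Rightarrow> 'k poly) set \<Rightarrow> ('z \<Rightarrow> int) \<Rightarrow> bool"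
  for v and G where
  base: "\<alpha> \<in> G \<Longrightarrow> \<beta> \<in> G \<Longrightarrow>
    cspan v G (\<lambda>z. of_bool (\<beta> z \<noteq> 0 \<and> gauss_norm v (\<alpha> z) \<le> gauss_norm v (\<beta> z)))"
| add: "cspan v G f \<Longrightarrow> cspan v G g \<Longrightarrow> cspan v G (\<lambda>z. f z + g z)"
| neg: "cspan v G f \<Longrightarrow> cspan v G (\<lambda>z. - f z)"

context acval
begin

lemma gauss_norm_0 [simp]: "gauss_norm v 0 = 0"
  by (simp add: gauss_norm_def)

lemma qf_eq_0:
  assumes "funring F" "a \<in> F"
  shows "qf v F (\<lambda>e. a e = 0)"
  using qf_le[OF assms(2) funring_0[OF assms(1)], of v] by (simp add: le_0_iff_value eq_0_iff)

lemma qf_fpoly_eq_0: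
  assumes "\<And>a. a \<in> F \<Longrightarrow> qf v G (\<lambda>e. a e = 0)" and p: "p \<in> fpoly F"
  shows "qf v G (\<lambda>e. p e = 0)"
proof -
  obtain d where d: "\<And>e. degree (p e) \<le> d" using fpoly_degree[OF p] by blast
  have "qf v G (\<lambda>e. \<forall>i\<in>{..d}. coeff (p e) i = 0)"
    by (rule boolc_ball) (auto intro!: assms(1) fpoly_coeff[OF p])
  moreover have "p e = 0 \<longleftrightarrow> (\<forall>i\<in>{..d}. coeff (p e) i = 0)" for e
    using d[of e] by (metis atMost_iff coeff_0 leading_coeff_0_iff)
  ultimately show ?thesis by simp
qed

lemma qf_gauss_norm_le:
  assumes p: "p \<in> fpoly F" and q: "q \<in> fpoly F"
  shows "qf v F (\<lambda>e. gauss_norm v (p e) \<le> gauss_norm v (q e))"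
proof -
  obtain m where m: "\<And>e. degree (p e) \<le> m" using fpoly_degree[OF p] by blast
  obtain n where n: "\<And>e. degree (q e) \<le> n" using fpoly_degree[OF q] by blast
  have "qf v F (\<lambda>e. \<forall>i\<in>{..m}. \<exists>j\<in>{..n}. v (coeff (p e) i) \<le> v (coeff (q e) j))"
    by (intro boolc_ball boolc_bex qf_le fpoly_coeff p q) auto
  moreover have "gauss_norm v (p e) \<le> gauss_norm v (q e) \<longleftrightarrow>
      (\<forall>i\<in>{..m}. \<exists>j\<in>{..n}. v (coeff (p e) i) \<le> v (coeff (q e) j))" for e
    using gauss_norm_le_bounded_iff[OF m n, of e e] by auto
  ultimately show ?thesis by simp
qed

lemma qf_top_index:
  assumes F: "funring F" and h: "h \<in> fpoly (fpoly F)"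
  shows "qf v F (\<lambda>e. h e \<noteq> 0 \<and> top_index (gauss_norm v) (h e) = t)"
proof -
  interpret g: dval "gauss_norm v" by (rule dval_gauss_norm)
  let ?g = "gauss_norm v"
  obtain d where d: "\<And>e. degree (h e) \<le> d" using fpoly_degree[OF h] by blast
  have nz: "qf v F (\<lambda>e. \<not> h e = 0)"
    by (rule boolc.neg, rule qf_fpoly_eq_0[OF qf_fpoly_eq_0[OF qf_eq_0[OF F]] h])
  have le: "qf v F (\<lambda>e. \<forall>i\<in>{..d}. ?g (coeff (h e) i) \<le> ?g (coeff (h e) t))"
    by (intro boolc_ball qf_gauss_norm_le fpoly_coeff h) auto
  have less: "qf v F (\<lambda>e. \<forall>i\<in>{t<..d}. \<not> ?g (coeff (h e) t) \<le> ?g (coeff (h e) i))"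
    by (intro boolc_ball boolc.neg qf_gauss_norm_le fpoly_coeff h) auto
  have "h e \<noteq> 0 \<and> top_index ?g (h e) = t \<longleftrightarrow> \<not> h e = 0 \<and>
      (\<forall>i\<in>{..d}. ?g (coeff (h e) i) \<le> ?g (coeff (h e) t)) \<and>
      (\<forall>i\<in>{t<..d}. \<not> ?g (coeff (h e) t) \<le> ?g (coeff (h e) i))" (is "?L \<longleftrightarrow> ?R") for e
  proof
    assume ?L
    then show ?R
      using g.coeff_top_index[of "h e"] g.coeff_above_top_index[of "h e"] g.coeff_le_gauss_norm[of "h e"]
      by (auto simp: not_le)
  next
    assume R: ?R
    have le': "?g (coeff (h e) i) \<le> ?g (coeff (h e) t)" for i
      using R d[of e] by (cases "i \<le> d") (auto simp: coeff_eq_0 zero_le_value gauss_norm_eq_0_iff)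
    then have eq: "?g (coeff (h e) t) = gauss_norm ?g (h e)"
      by (intro antisym g.coeff_le_gauss_norm) (simp add: g.gauss_norm_le_iff)
    have "?g (coeff (h e) i) < gauss_norm ?g (h e)" if "i > t" for i
    proof (cases "i \<le> d")
      case True
      then show ?thesis using R that by (simp add: eq[symmetric] not_le)
    next
      case False
      then have "coeff (h e) i = 0" using d[of e] by (intro coeff_eq_0) linarith
      moreover have "gauss_norm ?g (h e) \<noteq> 0" using R by (simp add: g.gauss_norm_eq_0_iff)
      ultimately show ?thesis by (simp add: pos_iff_value)
    qed
    then show ?L using R g.top_index_unique[OF eq] by blast
  qed
  moreover have "qf v F (\<lambda>e. \<not> h e = 0 \<and>
      (\<forall>i\<in>{..d}. ?g (coeff (h e) i) \<le> ?g (coeff (h e) t)) \<and>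
      (\<forall>i\<in>{t<..d}. \<not> ?g (coeff (h e) t) \<le> ?g (coeff (h e) i)))"
    by (rule boolc.conj[OF nz boolc.conj[OF le less]])
  ultimately show ?thesis by simp
qed

text \<open>
  The product over the roots of \<open>\<alpha> + T \<beta> + U\<close>, with new variables \<open>T\<close> and \<open>U\<close>, has coefficients
  in the ring. Its lowest nonzero coefficient in \<open>U\<close> discards the roots where \<open>\<alpha> = \<beta> = 0\<close>, and the
  top index in \<open>T\<close> of that coefficient is the number of the other roots with \<open>|\<alpha>| \<le> |\<beta>|\<close>.
\<close>

lemma qfun_count_base:
  fixes r :: "'e \<Rightarrow> nat \<Rightarrow> 'k"
  assumes F: "funring F" and p: "p \<in> fpoly F" and r: "\<And>e. p e = (\<Prod>j<d. [:- r e j, 1:])"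
    and \<alpha>: "\<alpha> \<in> fpoly (feval (\<lambda>x. x) F)" and \<beta>: "\<beta> \<in> fpoly (feval (\<lambda>x. x) F)"
  shows "qfun v F (\<lambda>e. \<Sum>j<d. of_bool (\<beta> (e, r e j) \<noteq> 0 \<and>
      gauss_norm v (\<alpha> (e, r e j)) \<le> gauss_norm v (\<beta> (e, r e j))))" (is "qfun v F ?N")
proof -
  interpret g: dval "gauss_norm v" by (rule dval_gauss_norm)
  let ?g = "gauss_norm v" and ?F = "feval (\<lambda>x. x) F"
  \<comment> \<open>U is the outermost variable, T the next, and \<open>\<alpha>\<close>,
    \<open>\<beta>\<close> are polynomials in a variable of their own. Because of U the factor is
    nonzero even where both of them vanish.\<close>
  define \<gamma> where "\<gamma> = (\<lambda>z. [:[:\<alpha> z, \<beta> z:], 1:])"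
  note F' = funring_feval[OF F, of "\<lambda>x. x"]
  note F1 = funring_fpoly[OF F'] and F2 = funring_fpoly[OF funring_fpoly[OF F']]
    and F3 = funring_fpoly[OF funring_fpoly[OF funring_fpoly[OF F']]]
  note P1 = funring_fpoly[OF F] and P2 = funring_fpoly[OF funring_fpoly[OF F]]
    and P3 = funring_fpoly[OF funring_fpoly[OF funring_fpoly[OF F]]]
  have "(\<lambda>z. [:\<alpha> z, \<beta> z:]) \<in> fpoly (fpoly ?F)"
    by (intro fpoly_pCons[OF F1] \<alpha> fpoly_const[OF F1] \<beta>)
  then have "\<gamma> \<in> fpoly (fpoly (fpoly ?F))"
    unfolding \<gamma>_def by (intro fpoly_pCons[OF F2] fpoly_const[OF F2] funring_1[OF F2])
  \<comment> \<open>The argument \<open>x\<close> is moved outward past the three formal variables,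
    one interchange each.\<close>
  moreover have "fpoly (fpoly (fpoly ?F)) \<subseteq> feval (\<lambda>x. [:[:[:x:]:]:]) (fpoly (fpoly (fpoly F)))"
    by (rule order_trans[OF fpoly_mono[OF fpoly_mono[OF fpoly_feval_subset[OF F]]]
          order_trans[OF fpoly_mono[OF fpoly_feval_subset[OF P1]] fpoly_feval_subset[OF P2]]])
  ultimately have \<gamma>: "\<gamma> \<in> feval (\<lambda>x. [:[:[:x:]:]:]) (fpoly (fpoly (fpoly F)))" by blast
  define H where "H = (\<lambda>e. \<Prod>j<d. \<gamma> (e, r e j))"
  have H: "H \<in> fpoly (fpoly (fpoly F))"
    unfolding H_def
  proof (rule norm_feval[OF P3 p r _ _ _ _ _ \<gamma>])
    show "(\<lambda>e. [:[:[:f e:]:]:]) \<in> fpoly (fpoly (fpoly F))" if "f \<in> F" for f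
      by (intro fpoly_const[OF P2] fpoly_const[OF P1] fpoly_const[OF F] that)
  qed (simp_all add: one_pCons)
  have count: "\<exists>m\<le>d. (\<forall>i<m. coeff (H e) i = 0) \<and> coeff (H e) m \<noteq> 0 \<and>
      int (top_index ?g (coeff (H e) m)) = ?N e" for e
  proof -
    define f where "f = (\<lambda>j. [:\<alpha> (e, r e j), \<beta> (e, r e j):])"
    define Z where "Z = {j \<in> {..<d}. f j = 0}"
    have HE: "H e = (\<Prod>j<d. [:f j, 1:])" by (simp add: H_def \<gamma>_def f_def)
    have c: "i < card Z \<Longrightarrow> coeff (H e) i = 0" "coeff (H e) (card Z) = (\<Prod>j\<in>{..<d} - Z. f j)" for i
      using coeff_prod_linear[where A = "{..<d}" and f = f] unfolding HE Z_def by auto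
    have nz: "f j \<noteq> 0" if "j \<in> {..<d} - Z" for j using that by (auto simp: Z_def)
    have "int (top_index ?g (\<Prod>j\<in>{..<d} - Z. f j)) = (\<Sum>j\<in>{..<d} - Z. int (top_index ?g (f j)))"
      using g.top_index_prod[of "{..<d} - Z" f, OF _ nz] by simp
    also have "\<dots> = (\<Sum>j\<in>{..<d} - Z. of_bool (\<beta> (e, r e j) \<noteq> 0 \<and> ?g (\<alpha> (e, r e j)) \<le> ?g (\<beta> (e, r e j))))"
    proof (rule sum.cong)
      fix j assume "j \<in> {..<d} - Z"
      then have "\<alpha> (e, r e j) \<noteq> 0 \<or> \<beta> (e, r e j) \<noteq> 0" using nz[of j] by (auto simp: f_def)
      then show "int (top_index ?g (f j)) = of_bool (\<beta> (e, r e j) \<noteq> 0 \<and> ?g (\<alpha> (e, r e j)) \<le> ?g (\<beta> (e, r e j)))"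
        by (simp add: f_def g.top_index_linear)
    qed simp
    also have "\<dots> = ?N e"
      by (rule sum.mono_neutral_left) (auto simp: Z_def f_def)
    finally have "int (top_index ?g (coeff (H e) (card Z))) = ?N e" by (simp add: c)
    moreover have "card Z \<le> d" using card_mono[of "{..<d}" Z] by (auto simp: Z_def)
    moreover have "coeff (H e) (card Z) \<noteq> 0" using nz by (simp add: c)
    ultimately show ?thesis using c by blast
  qed
  \<comment> \<open>\<open>m\<close> is the position of the lowest nonzero coefficient in U. The
    conjunct on \<open>t\<close> is needed because \<open>nat\<close> sends negative integers to
    0.\<close>
  have iff: "?N e = t \<longleftrightarrow> (\<exists>m\<in>{..d}. (\<forall>i\<in>{..<m}. coeff (H e) i = 0) \<and>
      coeff (H e) m \<noteq> 0 \<and> top_index ?g (coeff (H e) m) = nat t) \<and> 0 \<le> t" for e t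
  proof
    assume t: "?N e = t"
    moreover have "0 \<le> ?N e" by (intro sum_nonneg) simp
    moreover obtain m where "m \<le> d" "\<forall>i<m. coeff (H e) i = 0" "coeff (H e) m \<noteq> 0"
      "int (top_index ?g (coeff (H e) m)) = ?N e" using count[of e] by blast
    ultimately show "(\<exists>m\<in>{..d}. (\<forall>i\<in>{..<m}. coeff (H e) i = 0) \<and>
        coeff (H e) m \<noteq> 0 \<and> top_index ?g (coeff (H e) m) = nat t) \<and> 0 \<le> t"
      by (intro conjI bexI[of _ m]) auto
  next
    assume R: "(\<exists>m\<in>{..d}. (\<forall>i\<in>{..<m}. coeff (H e) i = 0) \<and>
      coeff (H e) m \<noteq> 0 \<and> top_index ?g (coeff (H e) m) = nat t) \<and> 0 \<le> t"
    then obtain m where m: "\<forall>i<m. coeff (H e) i = 0" "coeff (H e) m \<noteq> 0"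
      "top_index ?g (coeff (H e) m) = nat t" by auto
    obtain m' where m': "\<forall>i<m'. coeff (H e) i = 0" "coeff (H e) m' \<noteq> 0"
      "int (top_index ?g (coeff (H e) m')) = ?N e" using count[of e] by blast
    have "m' = m" using m(1,2) m'(1,2) by (metis linorder_neqE_nat)
    then show "?N e = t" using m(3) m'(3) R by simp
  qed
  have coeffH: "(\<lambda>e. coeff (H e) i) \<in> fpoly (fpoly F)" for i by (rule fpoly_coeff[OF H])
  have "qf v F (\<lambda>e. ?N e = t)" for t
    unfolding iff
    by (intro boolc.conj boolc_const boolc_bex boolc_ball
          qf_fpoly_eq_0[OF qf_fpoly_eq_0[OF qf_eq_0[OF F]] coeffH] qf_top_index[OF F coeffH]) auto
  moreover have "range ?N \<subseteq> {0..int d}"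
  proof -
    have "?N e \<le> (\<Sum>j<d. 1)" for e by (rule sum_mono) auto
    moreover have "0 \<le> ?N e" for e by (intro sum_nonneg) simp
    ultimately show ?thesis by auto
  qed
  then have "finite (range ?N)" by (rule finite_subset) simp
  ultimately show ?thesis by (simp add: qfun_def)
qed

section \<open>Root counts for arbitrary quantifier-free conditions, and existence of roots\<close>

lemma cspan_1: "funring F \<Longrightarrow> cspan v (fpoly F) (\<lambda>z. 1)"
  using cspan.base[of "\<lambda>z. 0" "fpoly F" "\<lambda>z. 1" v, OF funring_0 funring_1]
  by (simp add: funring_fpoly gauss_norm_def zero_le_value)

text \<open>For nonzero \<open>\<beta>\<close> and \<open>\<beta>'\<close> both comparisons hold iff
  the norms of \<alpha>\<beta>' and \<alpha>'\<beta> are at most that of \<beta>\<beta>'. The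
  polynomial \<open>\<delta>\<close> has the larger of these two norms, so a product of two
  generators is again a generator.\<close>

lemma cspan_mult:
  assumes F: "funring F" and f: "cspan v (fpoly F) f" and g: "cspan v (fpoly F) g"
  shows "cspan v (fpoly F) (\<lambda>z. f z * g z)"
  using f
proof induction
  case (base \<alpha> \<beta>)
  note P = funring_fpoly[OF F]
  show ?case
    using g
  proof induction
    case (base \<alpha>' \<beta>')
    interpret g: dval "gauss_norm v" by (rule dval_gauss_norm)
    let ?g = "gauss_norm v"
    obtain m where m: "\<And>z. degree (\<alpha> z * \<beta>' z) \<le> m"
      using fpoly_degree[OF funring_mult[OF P \<open>\<alpha> \<in> fpoly F\<close> \<open>\<beta>' \<in> fpoly F\<close>]] by blast
    define \<delta> where "\<delta> = (\<lambda>z. \<alpha> z * \<beta>' z + monom 1 (Suc m) * (\<alpha>' z * \<beta> z))"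
    have "\<delta> \<in> fpoly F"
      unfolding \<delta>_def
      by (intro funring_add[OF P] funring_mult[OF P] fpoly_monom[OF F] funring_1[OF F] base \<open>\<alpha> \<in> fpoly F\<close> \<open>\<beta> \<in> fpoly F\<close>)
    moreover have "(\<lambda>z. \<beta> z * \<beta>' z) \<in> fpoly F"
      by (intro funring_mult[OF P] base \<open>\<beta> \<in> fpoly F\<close>)
    ultimately have "cspan v (fpoly F) (\<lambda>z. of_bool (\<beta> z * \<beta>' z \<noteq> 0 \<and> ?g (\<delta> z) \<le> ?g (\<beta> z * \<beta>' z)))"
      by (rule cspan.base)
    moreover have "of_bool (\<beta> z * \<beta>' z \<noteq> 0 \<and> ?g (\<delta> z) \<le> ?g (\<beta> z * \<beta>' z)) =
      (of_bool (\<beta> z \<noteq> 0 \<and> ?g (\<alpha> z) \<le> ?g (\<beta> z)) * of_bool (\<beta>' z \<noteq> 0 \<and> ?g (\<alpha>' z) \<le> ?g (\<beta>' z)) :: int)" for z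
    proof (cases "\<beta> z = 0 \<or> \<beta>' z = 0")
      case False
      then have nz: "?g (\<beta> z) \<noteq> 0" "?g (\<beta>' z) \<noteq> 0" by (auto simp: g.eq_0_iff)
      have "?g (\<delta> z) = max (?g (\<alpha> z) * ?g (\<beta>' z)) (?g (\<alpha>' z) * ?g (\<beta> z))"
        using m[of z] by (simp add: \<delta>_def gauss_norm_add_shift gauss_norm_mult le_imp_less_Suc)
      moreover have "?g (\<alpha> z) * ?g (\<beta>' z) \<le> ?g (\<beta> z) * ?g (\<beta>' z) \<longleftrightarrow> ?g (\<alpha> z) \<le> ?g (\<beta> z)"
        using mult_left_le_cancel_value[OF nz(2)] by (metis mult.commute)
      moreover have "?g (\<alpha>' z) * ?g (\<beta> z) \<le> ?g (\<beta> z) * ?g (\<beta>' z) \<longleftrightarrow> ?g (\<alpha>' z) \<le> ?g (\<beta>' z)"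
        using mult_left_le_cancel_value[OF nz(1)] by (metis mult.commute)
      ultimately show ?thesis using False by (simp add: gauss_norm_mult)
    qed auto
    ultimately show ?case by simp
  next
    case (add f g)
    then show ?case using cspan.add by (simp add: distrib_left)
  next
    case (neg f)
    then show ?case using cspan.neg by simp
  qed
next
  case (add f h)
  then show ?case using cspan.add by (simp add: distrib_right)
next
  case (neg f)
  then show ?case using cspan.neg by simp
qed

lemma cspan_qf:
  assumes F: "funring F" and X: "qf v F X"
  shows "cspan v (fpoly F) (\<lambda>z. of_bool (X z))"
  using X
proof induction
  case (atom X)
  then obtain a b where ab: "a \<in> F" "b \<in> F" "X = (\<lambda>z. v (a z) \<le> v (b z))"
    by (auto simp: val_atoms_def)
  let ?c = "\<lambda>z. of_bool ([:b z:] \<noteq> 0 \<and> gauss_norm v [:a z:] \<le> gauss_norm v [:b z:]) :: int"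
  let ?nz = "\<lambda>a z. of_bool ([:a z:] \<noteq> 0 \<and> gauss_norm v 0 \<le> gauss_norm v [:a z:]) :: int"
  have C: "cspan v (fpoly F) ?c"
    by (rule cspan.base) (intro fpoly_const[OF F] ab)+
  have N: "cspan v (fpoly F) (?nz a)" if "a \<in> F" for a
    by (rule cspan.base) (intro fpoly_const[OF F] funring_0[OF funring_fpoly[OF F]] that)+
  \<comment> \<open>The generator is false wherever \<open>b\<close> vanishes, but the atom holds
    there if \<open>a\<close> vanishes too; the added product is the indicator of
    \<open>a = b = 0\<close>.\<close>
  have "cspan v (fpoly F) (\<lambda>z. ?c z + (1 + - ?nz a z) * (1 + - ?nz b z))"
    by (intro cspan.add C cspan_mult[OF F] cspan_1[OF F] cspan.neg N ab)
  moreover have "?c z + (1 + - ?nz a z) * (1 + - ?nz b z) = of_bool (X z)" for z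
    by (auto simp: ab gauss_norm_eq_0_iff zero_le_value eq_0_iff le_0_iff_value)
  ultimately show ?case by simp
next
  case true
  then show ?case using cspan_1[OF F] by simp
next
  case (neg X)
  have "cspan v (fpoly F) (\<lambda>z. 1 + - of_bool (X z))"
    by (intro cspan.add cspan_1[OF F] cspan.neg neg)
  then show ?case by (simp add: of_bool_not_iff)
next
  case (conj X Y)
  then show ?case using cspan_mult[OF F] by (simp add: of_bool_conj)
qed

lemma qfun_count:
  fixes r :: "'e \<Rightarrow> nat \<Rightarrow> 'k"
  assumes F: "funring F" and p: "p \<in> fpoly F" and r: "\<And>e. p e = (\<Prod>j<d. [:- r e j, 1:])"
    and f: "cspan v (fpoly (feval (\<lambda>x. x) F)) f"
  shows "qfun v F (\<lambda>e. \<Sum>j<d. f (e, r e j))"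
  using f
proof induction
  case (base \<alpha> \<beta>)
  show ?case by (rule qfun_count_base[OF F p r base])
next
  case (add f g)
  then show ?case using qfun_comb[where c = "(+)"] by (simp add: sum.distrib)
next
  case (neg f)
  then show ?case using qfun_comb[OF neg.IH neg.IH, of "\<lambda>x y. - x"] by (simp add: sum_negf)
qed

text \<open>Existence means that the number of roots with the property, counted with multiplicity,
  is nonzero. This number is definable although the enumeration \<open>r\<close> of the roots is
  chosen without any regularity in \<open>e\<close>.\<close>

lemma qf_monic_root:
  assumes F: "funring F" and p: "p \<in> fpoly F" and monic: "\<And>e. degree (p e) = d" "\<And>e. coeff (p e) d = 1"
    and X: "qf v (feval (\<lambda>x. x) F) X"
  shows "qf v F (\<lambda>e. \<exists>x. poly (p e) x = 0 \<and> X (e, x))"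
proof -
  have "\<exists>r. p e = (\<Prod>j<d. [:- r j, 1:])" for e
  proof -
    have "p e \<noteq> 0" using monic[of e] by auto
    then obtain A where A: "size A = degree (p e)" "p e = (\<Prod>x\<in>#A. [:- x, 1:])"
      using alg_closed_imp_factorization[of "p e"] monic[of e] by auto
    obtain xs where xs: "mset xs = A" using ex_mset by blast
    have "(\<Prod>x\<in>#A. [:- x, 1:]) = prod_list (map (\<lambda>x. [:- x, 1:]) xs)"
      by (simp flip: xs mset_map add: prod_mset_prod_list)
    also have "\<dots> = (\<Prod>j<d. [:- (xs ! j), 1:])"
      using A(1) xs monic[of e] by (auto simp: prod.list_conv_set_nth lessThan_atLeast0 intro!: prod.cong)
    finally show ?thesis using A(2) by metis
  qed
  then obtain r where r: "\<And>e. p e = (\<Prod>j<d. [:- r e j, 1:])" by metis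
  have "qfun v F (\<lambda>e. \<Sum>j<d. of_bool (X (e, r e j)))"
    by (rule qfun_count[OF F p r cspan_qf[OF funring_feval[OF F] X]])
  then have "qf v F (\<lambda>e. \<not> (\<Sum>j<d. of_bool (X (e, r e j))) = (0::int))"
    unfolding qfun_def by (intro boolc.neg) blast
  moreover have "(\<exists>x. poly (p e) x = 0 \<and> X (e, x)) \<longleftrightarrow> \<not> (\<Sum>j<d. of_bool (X (e, r e j))) = (0::int)" for e
  proof -
    have "poly (p e) x = 0 \<longleftrightarrow> (\<exists>j<d. x = r e j)" for x
      by (auto simp: r poly_prod)
    then show ?thesis by (auto simp: sum_nonneg_eq_0_iff)
  qed
  ultimately show ?thesis by simp
qed

text \<open>Clearing denominators: multiplied by \<open>c e ^ D\<close>, both sides of a comparison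
  at \<open>x\<close> become polynomials in \<open>c e * x\<close>. It serves the substitution that
  makes a polynomial monic.\<close>

lemma qf_rescale:
  assumes F: "funring F" and c: "c \<in> F" and X: "qf v (feval (\<lambda>x. x) F) X"
  shows "\<exists>Y. qf v (feval (\<lambda>x. x) F) Y \<and> (\<forall>e x. c e \<noteq> 0 \<longrightarrow> Y (e, c e * x) = X (e, x))"
  using X
proof induction
  case (atom X)
  then obtain a' b' where "X = (\<lambda>z. v (a' z) \<le> v (b' z))"
    and *: "a' \<in> feval (\<lambda>x. x) F" "b' \<in> feval (\<lambda>x. x) F"
    unfolding val_atoms_def by blast
  moreover obtain a b where "a \<in> fpoly F" "a' = (\<lambda>(e, x). poly (a e) x)"
    "b \<in> fpoly F" "b' = (\<lambda>(e, x). poly (b e) x)"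
    using * unfolding feval_def by blast
  ultimately have ab: "a \<in> fpoly F" "b \<in> fpoly F"
    "X = (\<lambda>(e, x). v (poly (a e) x) \<le> v (poly (b e) x))" by auto
  obtain m n where mn: "\<And>e. degree (a e) \<le> m" "\<And>e. degree (b e) \<le> n"
    using fpoly_degree[OF ab(1)] fpoly_degree[OF ab(2)] by metis
  define D where "D = max m n"
  have D: "degree (a e) \<le> D" "degree (b e) \<le> D" for e
    using mn[of e] by (auto simp: D_def)
  define s where "s = (\<lambda>a e. \<Sum>i\<le>D. monom (c e ^ (D - i) * coeff (a e) i) i)"
  have s: "s a \<in> fpoly F" if "a \<in> fpoly F" for a
    unfolding s_def
    by (intro funring_sum[OF funring_fpoly[OF F]] fpoly_monom[OF F] funring_mult[OF F] funring_power[OF F] c fpoly_coeff that)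
  have s_eval: "poly (s a e) (c e * x) = c e ^ D * poly (a e) x" if "degree (a e) \<le> D" for a e x
  proof -
    have "poly (s a e) (c e * x) = (\<Sum>i\<le>D. c e ^ (D - i) * coeff (a e) i * (c e * x) ^ i)"
      by (simp add: s_def poly_sum poly_monom)
    also have "\<dots> = (\<Sum>i\<le>D. c e ^ D * (coeff (a e) i * x ^ i))"
    proof (rule sum.cong)
      fix i assume "i \<in> {..D}"
      then have "c e ^ D = c e ^ (D - i) * c e ^ i" by (simp flip: power_add)
      then show "c e ^ (D - i) * coeff (a e) i * (c e * x) ^ i = c e ^ D * (coeff (a e) i * x ^ i)"
        by (simp add: power_mult_distrib)
    qed simp
    also have "\<dots> = c e ^ D * poly (a e) x"
      by (simp add: poly_bounded_degree[OF that] sum_distrib_left)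
    finally show ?thesis .
  qed
  have sF: "(\<lambda>(e, x). poly (s a e) x) \<in> feval (\<lambda>x. x) F" if "a \<in> fpoly F" for a
    by (rule fevalI[OF s[OF that]]) simp
  have "qf v (feval (\<lambda>x. x) F) (\<lambda>z. v (case z of (e, x) \<Rightarrow> poly (s a e) x) \<le> v (case z of (e, x) \<Rightarrow> poly (s b e) x))"
    by (rule qf_le[OF sF[OF ab(1)] sF[OF ab(2)]])
  moreover have "\<forall>e x. c e \<noteq> 0 \<longrightarrow> (v (case (e, c e * x) of (e, x) \<Rightarrow> poly (s a e) x) \<le>
      v (case (e, c e * x) of (e, x) \<Rightarrow> poly (s b e) x)) = X (e, x)"
    by (auto simp: ab s_eval D mult mult_left_le_cancel_value power power_eq_0_value eq_0_iff)
  ultimately show ?case by (intro exI conjI)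
next
  case true
  show ?case by (rule exI[of _ "\<lambda>_. True"]) (simp add: boolc.true)
next
  case (neg X)
  then obtain Y where "qf v (feval (\<lambda>x. x) F) Y" "\<forall>e x. c e \<noteq> 0 \<longrightarrow> Y (e, c e * x) = X (e, x)" by blast
  then show ?case by (intro exI[of _ "\<lambda>z. \<not> Y z"]) (simp add: boolc.neg)
next
  case (conj X X')
  then obtain Y Y' where "qf v (feval (\<lambda>x. x) F) Y" "\<forall>e x. c e \<noteq> 0 \<longrightarrow> Y (e, c e * x) = X (e, x)"
    "qf v (feval (\<lambda>x. x) F) Y'" "\<forall>e x. c e \<noteq> 0 \<longrightarrow> Y' (e, c e * x) = X' (e, x)" by blast
  then show ?case by (intro exI[of _ "\<lambda>z. Y z \<and> Y' z"]) (simp add: boolc.conj)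
qed

text \<open>With leading coefficient c and degree d, c^(d-1) q(x) is monic in y = c x; this is the
  family \<open>p d\<close>. Since the degree depends on \<open>e\<close>, the condition is a
  disjunction over the possible degrees.\<close>

lemma qf_root:
  assumes F: "funring F" and q: "q \<in> fpoly F" and X: "qf v (feval (\<lambda>x. x) F) X"
  shows "qf v F (\<lambda>e. q e \<noteq> 0 \<and> (\<exists>x. poly (q e) x = 0 \<and> X (e, x)))"
proof -
  obtain D where D: "\<And>e. degree (q e) \<le> D" using fpoly_degree[OF q] by blast
  define c where "c = (\<lambda>d e. coeff (q e) d)"
  define p where "p = (\<lambda>d e. monom 1 d + (\<Sum>i<d. monom (c d e ^ (d - 1 - i) * coeff (q e) i) i))"
  have cF: "c d \<in> F" for d unfolding c_def by (rule fpoly_coeff[OF q])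
  have "\<exists>Y. qf v (feval (\<lambda>x. x) F) Y \<and> (\<forall>e x. c d e \<noteq> 0 \<longrightarrow> Y (e, c d e * x) = X (e, x))" for d
    by (rule qf_rescale[OF F cF X])
  then obtain Y where Y: "\<And>d. qf v (feval (\<lambda>x. x) F) (Y d)"
    "\<And>d e x. c d e \<noteq> 0 \<Longrightarrow> Y d (e, c d e * x) = X (e, x)" by metis
  have pF: "p d \<in> fpoly F" for d
    unfolding p_def
    by (intro funring_add[OF funring_fpoly[OF F]] funring_sum[OF funring_fpoly[OF F]] fpoly_monom[OF F]
        funring_1[OF F] funring_mult[OF F] funring_power[OF F] cF fpoly_coeff[OF q])
  have lower: "coeff (\<Sum>i<d. monom (f i) i) n = (0::'k)" if "n \<ge> d" for f d n
    using that by (auto simp: coeff_sum intro!: sum.neutral)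
  have lc: "coeff (p d e) d = 1" for d e by (simp add: p_def lower)
  have deg: "degree (p d e) = d" for d e
  proof (rule antisym)
    show "degree (p d e) \<le> d" by (rule degree_le) (auto simp: p_def lower)
    show "d \<le> degree (p d e)" by (rule le_degree) (simp add: lc)
  qed
  have root: "qf v F (\<lambda>e. \<exists>y. poly (p d e) y = 0 \<and> Y d (e, y))" for d
    by (rule qf_monic_root[OF F pF deg lc Y(1)])
  have "qf v F (\<lambda>e. \<exists>d\<in>{..D}. \<not> coeff (q e) d = 0 \<and> (\<forall>i\<in>{d<..D}. coeff (q e) i = 0) \<and>
      (\<exists>y. poly (p d e) y = 0 \<and> Y d (e, y)))"
    by (intro boolc_bex boolc.conj boolc_ball boolc.neg root qf_eq_0[OF F] fpoly_coeff[OF q]) auto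
  moreover have "(q e \<noteq> 0 \<and> (\<exists>x. poly (q e) x = 0 \<and> X (e, x))) \<longleftrightarrow>
      (\<exists>d\<in>{..D}. \<not> coeff (q e) d = 0 \<and> (\<forall>i\<in>{d<..D}. coeff (q e) i = 0) \<and>
      (\<exists>y. poly (p d e) y = 0 \<and> Y d (e, y)))" for e
  proof (cases "q e = 0")
    case False
    let ?d = "degree (q e)"
    have cnz: "c ?d e \<noteq> 0" using False by (simp add: c_def)
    have "(\<exists>x. poly (q e) x = 0 \<and> X (e, x)) \<longleftrightarrow> (\<exists>y. poly (p ?d e) y = 0 \<and> Y ?d (e, y))"
    \<comment> \<open>Neither a nonzero constant nor \<open>p 0 e\<close>, which is 1, has a root;
      the exponent \<open>?d - 1\<close> in the other case needs \<open>?d > 0\<close>.\<close>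
    proof (cases "?d = 0")
      case True
      then obtain a where "q e = [:a:]" using degree_eq_zeroE by blast
      then show ?thesis using False True by (simp add: p_def)
    next
      case d0: False
      have ev: "poly (p ?d e) (c ?d e * x) = c ?d e ^ (?d - 1) * poly (q e) x" for x
      proof -
        have "poly (p ?d e) (c ?d e * x) = (c ?d e * x) ^ ?d +
            (\<Sum>i<?d. c ?d e ^ (?d - 1 - i) * coeff (q e) i * (c ?d e * x) ^ i)"
          by (simp add: p_def poly_sum poly_monom)
        also have "(c ?d e * x) ^ ?d = c ?d e ^ (?d - 1) * (c ?d e * x ^ ?d)"
          using d0 by (cases ?d) (simp_all add: power_mult_distrib)
        also have "(\<Sum>i<?d. c ?d e ^ (?d - 1 - i) * coeff (q e) i * (c ?d e * x) ^ i) =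
            (\<Sum>i<?d. c ?d e ^ (?d - 1) * (coeff (q e) i * x ^ i))"
        proof (rule sum.cong)
          fix i assume "i \<in> {..<?d}"
          then have "c ?d e ^ (?d - 1) = c ?d e ^ (?d - 1 - i) * c ?d e ^ i" by (simp flip: power_add)
          then show "c ?d e ^ (?d - 1 - i) * coeff (q e) i * (c ?d e * x) ^ i =
              c ?d e ^ (?d - 1) * (coeff (q e) i * x ^ i)"
            by (simp add: power_mult_distrib)
        qed simp
        also have "c ?d e ^ (?d - 1) * (c ?d e * x ^ ?d) + \<dots> =
            c ?d e ^ (?d - 1) * ((\<Sum>i<?d. coeff (q e) i * x ^ i) + coeff (q e) ?d * x ^ ?d)"
          by (simp add: c_def sum_distrib_left algebra_simps)
        also have "\<dots> = c ?d e ^ (?d - 1) * poly (q e) x"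
          by (simp add: poly_altdef flip: lessThan_Suc_atMost)
        finally show ?thesis .
      qed
      show ?thesis
      proof
        assume "\<exists>x. poly (q e) x = 0 \<and> X (e, x)"
        then obtain x where "poly (q e) x = 0" "X (e, x)" by blast
        then show "\<exists>y. poly (p ?d e) y = 0 \<and> Y ?d (e, y)"
          using ev[of x] Y(2)[OF cnz, of x] by (intro exI[of _ "c ?d e * x"]) simp
      next
        assume "\<exists>y. poly (p ?d e) y = 0 \<and> Y ?d (e, y)"
        then obtain y where y: "poly (p ?d e) y = 0" "Y ?d (e, y)" by blast
        define x where "x = y / c ?d e"
        have yx: "y = c ?d e * x" using cnz by (simp add: x_def)
        show "\<exists>x. poly (q e) x = 0 \<and> X (e, x)"
          using y ev[of x] Y(2)[OF cnz, of x] cnz unfolding yx by (intro exI[of _ x]) simp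
      qed
    qed
    moreover have "coeff (q e) d \<noteq> 0 \<and> (\<forall>i\<in>{d<..D}. coeff (q e) i = 0) \<longleftrightarrow> d = ?d" if "d \<le> D" for d
    proof
      assume *: "coeff (q e) d \<noteq> 0 \<and> (\<forall>i\<in>{d<..D}. coeff (q e) i = 0)"
      have "?d \<le> d"
      proof (rule ccontr)
        assume "\<not> ?d \<le> d"
        then have "coeff (q e) ?d = 0" using * D[of e] by simp
        then show False using False by simp
      qed
      then show "d = ?d" using * le_degree[of "q e" d] by simp
    qed (use False in \<open>auto simp: coeff_eq_0\<close>)
    ultimately show ?thesis using False D[of e] by (metis atMost_iff)
  qed auto
  ultimately show ?thesis by simp
qed

end

section \<open>Quantifier elimination\<close>

text \<open>The field variable \<open>t\<close> enters through |t| alone. Comparisons of Gauss norms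
  on balls of radius |t| are combinations of these atoms.\<close>

definition monomial_atoms :: "('k \<Rightarrow> 'g::linordered_comm_group_with_zero) \<Rightarrow> ('e \<Rightarrow> 'k) set \<Rightarrow> ('e \<times> 'k \<Rightarrow> bool) set" where
  "monomial_atoms v F =
     {\<lambda>(e, t). v (a e) * v t ^ i \<le> v (b e) * v t ^ j | a b i j. a \<in> F \<and> b \<in> F}"

lemma ex_min_image:
  fixes f :: "'a \<Rightarrow> 'b::linorder"
  assumes "finite A" "A \<noteq> {}"
  obtains y where "y \<in> A" "\<And>z. z \<in> A \<Longrightarrow> f y \<le> f z"
proof -
  have "Min (f ` A) \<in> f ` A" using assms by (intro Min_in) auto
  then obtain y where "y \<in> A" "Min (f ` A) = f y" by blast
  moreover have "Min (f ` A) \<le> f z" if "z \<in> A" for z using assms that by (intro Min_le) auto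
  ultimately show ?thesis using that by metis
qed

context acval
begin

lemma ex_value_below:
  assumes "finite Y" "\<And>y. y \<in> Y \<Longrightarrow> y \<noteq> 0" and u: "u \<noteq> 0" "v u < 1"
  shows "\<exists>s. s \<noteq> 0 \<and> (\<forall>y\<in>Y. v s < v y)"
proof (cases "Y = {}")
  case False
  then obtain y where y: "y \<in> Y" "\<And>z. z \<in> Y \<Longrightarrow> v y \<le> v z"
    using ex_min_image[OF assms(1)] by metis
  have "v (u * y) < v y"
    using mult_strict_mono_value[OF u(2), of "v y" "v y"] y(1) assms(2) by (simp add: mult eq_0_iff)
  then have "v (u * y) < v z" if "z \<in> Y" for z using y(2)[OF that] by order
  then show ?thesis using y(1) assms(2) u(1) by (intro exI[of _ "u * y"]) auto
qed (auto intro!: exI[of _ 1])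

text \<open>Density of the value group: a square root of \<open>x * y\<close> has the geometric mean
  as its value.\<close>

lemma ex_value_between:
  assumes "x \<noteq> 0" "v x < v y"
  shows "\<exists>z. v x < v z \<and> v z < v y"
proof -
  obtain z where z: "z ^ 2 = x * y" using nth_root_exists[of 2] by auto
  have y: "v y \<noteq> 0" using assms(2) by (metis not_less zero_le_value)
  have x: "v x \<noteq> 0" using assms(1) by (simp add: eq_0_iff)
  have zz: "v z * v z = v x * v y" by (metis mult power2_eq_square z)
  have "v x ^ 2 < v z ^ 2"
    using mult_left_less_cancel_value[OF x, of "v x" "v y"] assms(2)
    by (simp add: zz power2_eq_square)
  moreover have "v z ^ 2 < v y ^ 2"
    using mult_strict_mono_value[OF assms(2) order_refl y]
    by (simp add: zz power2_eq_square)
  ultimately show ?thesis by (metis not_le power_mono_value)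
qed

text \<open>If \<open>Y\<close> has values above |x|, density gives one before the least of them;
  otherwise |x / u| will do.\<close>

lemma ex_value_above:
  assumes "finite Y" and x: "x \<noteq> 0" and u: "u \<noteq> 0" "v u < 1"
  shows "\<exists>s. v x < v s \<and> (\<forall>y\<in>Y. v x < v y \<longrightarrow> v s < v y)"
proof (cases "{y \<in> Y. v x < v y} = {}")
  case True
  have "v u * v (x / u) = v x" using u by (simp add: v_divide)
  moreover have "v u * v (x / u) < 1 * v (x / u)"
    using u x by (intro mult_strict_mono_value) (auto simp: eq_0_iff)
  ultimately show ?thesis using True by (intro exI[of _ "x / u"]) auto
next
  case False
  have "finite {y \<in> Y. v x < v y}" using assms(1) by simp
  then obtain y where "y \<in> {y \<in> Y. v x < v y}" "\<And>z. z \<in> {y \<in> Y. v x < v y} \<Longrightarrow> v y \<le> v z"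
    using ex_min_image[OF _ False, of v] by blast
  then have y: "y \<in> Y" "v x < v y" "\<And>z. z \<in> Y \<Longrightarrow> v x < v z \<Longrightarrow> v y \<le> v z" by blast+
  obtain z where "v x < v z" "v z < v y" using ex_value_between[OF x y(2)] by blast
  moreover have "v z < v w" if "w \<in> Y" "v x < v w" for w
    using y(3)[OF that] calculation(2) by order
  ultimately show ?thesis by blast
qed

text \<open>
  The truth of the atoms at \<open>s\<close> depends on the position of \<open>v s\<close> among the breakpoints
  \<open>v (\<gamma> / \<kappa>)\<close>. The possible positions are below all of them, at one of them, and immediately
  above one of them.
\<close>

lemma qf_ex_value_linear:
  fixes U L :: "'x \<Rightarrow> 'e \<Rightarrow> 'k" and ku kl :: "'x \<Rightarrow> bool"
  assumes F: "funring F" and UL: "\<And>x. x \<in> set as \<Longrightarrow> U x \<in> F" "\<And>x. x \<in> set as \<Longrightarrow> L x \<in> F"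
    and k: "\<And>x. \<not> (ku x \<and> kl x)"
  defines "P \<equiv> \<lambda>x e s. v (U x e * (if ku x then s else 1)) \<le> v (L x e * (if kl x then s else 1))"
  shows "qf v F (\<lambda>e. \<exists>s. s \<noteq> 0 \<and> B (map (\<lambda>x. P x e s) as))"
proof (cases "\<exists>u. u \<noteq> 0 \<and> v u < 1")
  case False
  \<comment> \<open>The valuation is trivial, so there is only one position for a nonzero
    \<open>s\<close>.\<close>
  have v1: "v s = 1" if "s \<noteq> 0" for s
  proof -
    have "v s * v (1 / s) = 1" using that by (simp add: v_divide)
    moreover have "1 \<le> v s" "1 \<le> v (1 / s)" using False that by (metis not_less divide_eq_0_iff zero_neq_one)+
    ultimately show ?thesis
      by (metis antisym mult.right_neutral mult_left_mono_value)
  qed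
  have "P x e s = (v (U x e) \<le> v (L x e))" if "s \<noteq> 0" for x e s
    using v1[OF that] by (simp add: P_def mult)
  then have "s \<noteq> 0 \<and> B (map (\<lambda>x. P x e s) as) \<longleftrightarrow>
      s \<noteq> 0 \<and> B (map (\<lambda>x. v (U x e) \<le> v (L x e)) as)" for e s by (cases "s = 0") simp_all
  then have "(\<exists>s. s \<noteq> 0 \<and> B (map (\<lambda>x. P x e s) as)) \<longleftrightarrow> B (map (\<lambda>x. v (U x e) \<le> v (L x e)) as)" for e
    using zero_neq_one by metis
  moreover have "qf v F (\<lambda>e. B (map (\<lambda>x. v (U x e) \<le> v (L x e)) as))"
    by (rule boolc_map) (intro qf_le UL)
  ultimately show ?thesis by simp
next
  case True
  then obtain u where u: "u \<noteq> 0" "v u < 1" by blast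
  \<comment> \<open>\<open>y = \<gamma> / \<kappa>\<close> is the breakpoint of an atom, meaningful
    where \<open>valid\<close> holds. \<open>P0\<close>, \<open>Pe x'\<close> and
    \<open>Pp x'\<close> are its truth values for |s| below all breakpoints, at that of
    \<open>x'\<close>, and immediately above it, written without division so that they are definable
    over \<open>F\<close>.\<close>
  define \<gamma> where "\<gamma> = (\<lambda>x e. if ku x then L x e else U x e)"
  define \<kappa> where "\<kappa> = (\<lambda>x e. if ku x then U x e else L x e)"
  define valid where "valid = (\<lambda>x e. (ku x \<or> kl x) \<and> U x e \<noteq> 0 \<and> L x e \<noteq> 0)"
  define y where "y = (\<lambda>x e. \<gamma> x e / \<kappa> x e)"
  define P0 where "P0 = (\<lambda>x e. if ku x then U x e = 0 \<or> \<not> L x e = 0 else if kl x then U x e = 0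
      else v (U x e) \<le> v (L x e))"
  define Pe where "Pe = (\<lambda>x' x e. if ku x then v (U x e * \<gamma> x' e) \<le> v (L x e * \<kappa> x' e)
      else if kl x then v (U x e * \<kappa> x' e) \<le> v (L x e * \<gamma> x' e) else v (U x e) \<le> v (L x e))"
  define Pp where "Pp = (\<lambda>x' x e. if ku x then U x e = 0 \<or> \<not> v (L x e * \<kappa> x' e) \<le> v (U x e * \<gamma> x' e)
      else if kl x then v (U x e * \<kappa> x' e) \<le> v (L x e * \<gamma> x' e) else v (U x e) \<le> v (L x e))"
  have \<gamma>F: "\<gamma> x \<in> F" and \<kappa>F: "\<kappa> x \<in> F" if "x \<in> set as" for x
    using UL[OF that] by (cases "ku x"; simp add: \<gamma>_def \<kappa>_def)+
  have nz: "\<gamma> x e \<noteq> 0" "\<kappa> x e \<noteq> 0" "y x e \<noteq> 0" if "valid x e" for x e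
    using that by (auto simp: valid_def \<gamma>_def \<kappa>_def y_def)
  have P_ku: "P x e s \<longleftrightarrow> v s \<le> v (y x e)" if "valid x e" "ku x" "s \<noteq> 0" for x e s
  proof -
    have "U x e \<noteq> 0" using that by (simp add: valid_def)
    then have "v s \<le> v (L x e / U x e) \<longleftrightarrow> v s * v (U x e) \<le> v (L x e)"
      using divide_less_iff[of "U x e" "L x e" "v s"] by (simp flip: not_less)
    then show ?thesis using that k by (auto simp: P_def y_def \<gamma>_def \<kappa>_def mult mult.commute)
  qed
  have P_kl: "P x e s \<longleftrightarrow> v (y x e) \<le> v s" if "valid x e" "kl x" "s \<noteq> 0" for x e s
  proof -
    have "L x e \<noteq> 0" using that by (simp add: valid_def)
    then have "v (U x e / L x e) \<le> v s \<longleftrightarrow> v (U x e) \<le> v s * v (L x e)"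
      by (rule divide_le_iff)
    moreover have "\<not> ku x" using that k by blast
    ultimately show ?thesis using that by (auto simp: P_def y_def \<gamma>_def \<kappa>_def mult mult.commute)
  qed
  have P_k: "P x e s \<longleftrightarrow> v (U x e) \<le> v (L x e)" if "\<not> ku x" "\<not> kl x" for x e s
    using that by (simp add: P_def)
  have P_inv: "P x e s \<longleftrightarrow> U x e = 0" if "\<not> valid x e" "ku x \<or> kl x" "s \<noteq> 0" for x e s
    using that k[of x] by (auto simp: P_def valid_def eq_0_iff le_0_iff_value zero_le_value)
  have y_le: "v (y x e) \<le> v (y x' e) \<longleftrightarrow> v (\<gamma> x e * \<kappa> x' e) \<le> v (\<gamma> x' e * \<kappa> x e)"
    if "valid x e" "valid x' e" for x x' e
  proof -
    have "v (y x e) \<le> v (y x' e) \<longleftrightarrow> v (\<gamma> x e) \<le> v (\<kappa> x e) * v (y x' e)"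
      using nz[OF that(1)] by (simp add: y_def divide_le_iff mult.commute)
    also have "\<dots> \<longleftrightarrow> v (\<kappa> x' e) * v (\<gamma> x e) \<le> v (\<kappa> x' e) * (v (\<kappa> x e) * v (y x' e))"
      using nz[OF that(2)] by (simp add: mult_left_le_cancel_value eq_0_iff)
    also have "v (\<kappa> x' e) * (v (\<kappa> x e) * v (y x' e)) = v (\<gamma> x' e * \<kappa> x e)"
      using nz[OF that(2)] v_divide[of "\<kappa> x' e" "\<gamma> x' e"]
      by (metis mult mult.commute mult.left_commute y_def)
    finally show ?thesis by (simp add: mult mult.commute)
  qed
  have F0: "P x e s = P0 x e" if "s \<noteq> 0" "valid x e \<Longrightarrow> v s < v (y x e)" for x e s
  proof (cases "valid x e")
    case True
    then show ?thesis using that P_ku[OF True] P_kl[OF True] k[of x]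
      by (auto simp: P0_def valid_def)
  next
    case False
    then show ?thesis using P_inv[OF False _ that(1)] P_k[of x e s]
      by (auto simp: P0_def valid_def)
  qed
  have Fe: "P x e s = Pe x' x e" if "s \<noteq> 0" "valid x' e" "v s = v (y x' e)" for x' x e s
  proof (cases "valid x e")
    case True
    then show ?thesis
      using that P_ku[OF True] P_kl[OF True] P_k[of x e s] k[of x] y_le[OF True that(2)] y_le[OF that(2) True]
      by (auto simp: Pe_def \<gamma>_def \<kappa>_def mult.commute valid_def)
  next
    case False
    then show ?thesis using P_inv[OF False _ that(1)] P_k[of x e s] nz[OF that(2)]
      by (auto simp: Pe_def valid_def le_0_iff_value eq_0_iff zero_le_value)
  qed
  have Fp: "P x e s = Pp x' x e"
    if "s \<noteq> 0" "valid x' e" "valid x e \<Longrightarrow> v s \<noteq> v (y x e) \<and> (v (y x e) < v s \<longleftrightarrow> v (y x e) \<le> v (y x' e))" for x' x e s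
  proof (cases "valid x e")
    case True
    then have "v s \<le> v (y x e) \<longleftrightarrow> \<not> v (y x e) \<le> v (y x' e)"
      "v (y x e) \<le> v s \<longleftrightarrow> v (y x e) \<le> v (y x' e)"
      using that(3) by (auto simp: not_less le_less)
    then show ?thesis
      using that P_ku[OF True] P_kl[OF True] P_k[of x e s] k[of x] y_le[OF True that(2)] True
      by (auto simp: Pp_def \<gamma>_def \<kappa>_def mult.commute valid_def)
  next
    case False
    then show ?thesis using P_inv[OF False _ that(1)] P_k[of x e s] nz[OF that(2)]
      by (auto simp: Pp_def valid_def le_0_iff_value eq_0_iff zero_le_value)
  qed
  have main: "(\<exists>s. s \<noteq> 0 \<and> B (map (\<lambda>x. P x e s) as)) \<longleftrightarrow> B (map (\<lambda>x. P0 x e) as) \<or>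
      (\<exists>x'\<in>set as. ((ku x' \<or> kl x') \<and> \<not> U x' e = 0 \<and> \<not> L x' e = 0) \<and>
        (B (map (\<lambda>x. Pe x' x e) as) \<or> B (map (\<lambda>x. Pp x' x e) as)))" (is "?lhs \<longleftrightarrow> ?rhs") for e
  proof
    assume ?lhs
    then obtain s where s: "s \<noteq> 0" "B (map (\<lambda>x. P x e s) as)" by blast
    show ?rhs
    proof (cases "\<exists>x'\<in>set as. valid x' e \<and> v s = v (y x' e)")
      case True
      then obtain x' where x': "x' \<in> set as" "valid x' e" "v s = v (y x' e)" by blast
      have eq: "map (\<lambda>x. P x e s) as = map (\<lambda>x. Pe x' x e) as" using Fe[OF s(1) x'(2,3)] by simp
      have "B (map (\<lambda>x. Pe x' x e) as)" using s(2) unfolding eq .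
      then show ?thesis using x' unfolding valid_def by blast
    next
      case ne: False
      let ?C = "{x \<in> set as. valid x e \<and> v (y x e) < v s}"
      show ?thesis
      proof (cases "?C = {}")
        case True
        then have "P x e s = P0 x e" if "x \<in> set as" for x
          using that ne by (intro F0 s) force
        then have eq: "map (\<lambda>x. P x e s) as = map (\<lambda>x. P0 x e) as" by simp
        have "B (map (\<lambda>x. P0 x e) as)" using s(2) unfolding eq .
        then show ?thesis by blast
      next
        case False
        \<comment> \<open>The largest breakpoint below |s|. As no breakpoint equals |s|, the
          position is immediately above this one.\<close>
        define m where "m = Max ((\<lambda>x. v (y x e)) ` ?C)"
        have "m \<in> (\<lambda>x. v (y x e)) ` ?C" unfolding m_def using False by (intro Max_in) auto
        then obtain x' where x': "x' \<in> ?C" "m = v (y x' e)" by blast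
        have max: "v (y x e) \<le> v (y x' e)" if "x \<in> ?C" for x
          unfolding x'(2)[symmetric] m_def using that by (intro Max_ge) auto
        have "P x e s = Pp x' x e" if "x \<in> set as" for x
        proof (rule Fp[OF s(1)])
          show "valid x' e" using x' by blast
          assume "valid x e"
          then show "v s \<noteq> v (y x e) \<and> (v (y x e) < v s \<longleftrightarrow> v (y x e) \<le> v (y x' e))"
            using that ne max[of x] x'(1) by auto
        qed
        then have eq: "map (\<lambda>x. P x e s) as = map (\<lambda>x. Pp x' x e) as" by simp
        have "B (map (\<lambda>x. Pp x' x e) as)" using s(2) unfolding eq .
        then show ?thesis using x' unfolding valid_def by blast
      qed
    qed
  next
    let ?Y = "(\<lambda>x. y x e) ` {x \<in> set as. valid x e}"
    assume ?rhs
    then consider "B (map (\<lambda>x. P0 x e) as)"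
      | x' where "x' \<in> set as" "valid x' e" "B (map (\<lambda>x. Pe x' x e) as)"
      | x' where "x' \<in> set as" "valid x' e" "B (map (\<lambda>x. Pp x' x e) as)"
      unfolding valid_def by blast
    then show ?lhs
    proof cases
      case 1
      have "\<exists>s. s \<noteq> 0 \<and> (\<forall>z\<in>?Y. v s < v z)"
        by (rule ex_value_below[OF _ _ u]) (use nz in auto)
      then obtain s where s: "s \<noteq> 0" "\<forall>z\<in>?Y. v s < v z" by blast
      have "P x e s = P0 x e" if "x \<in> set as" for x
        using that s by (intro F0) auto
      then have eq: "map (\<lambda>x. P x e s) as = map (\<lambda>x. P0 x e) as" by simp
      have "B (map (\<lambda>x. P x e s) as)" using 1 unfolding eq .
      then show ?thesis using s by blast
    next
      case (2 x')
      have eq: "map (\<lambda>x. P x e (y x' e)) as = map (\<lambda>x. Pe x' x e) as"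
        using Fe[OF nz(3)[OF 2(2)] 2(2)] by simp
      have "B (map (\<lambda>x. P x e (y x' e)) as)" using 2(3) unfolding eq .
      then show ?thesis using nz(3)[OF 2(2)] by blast
    next
      case (3 x')
      obtain s where s: "v (y x' e) < v s" "\<forall>z\<in>?Y. v (y x' e) < v z \<longrightarrow> v s < v z"
        using ex_value_above[OF _ nz(3)[OF 3(2)] u, of ?Y] by auto
      have s0: "s \<noteq> 0" using s(1) zero_le_value[of "v (y x' e)"] by (auto simp: not_less)
      have "P x e s = Pp x' x e" if "x \<in> set as" for x
      proof (rule Fp[OF s0 3(2)])
        assume "valid x e"
        then show "v s \<noteq> v (y x e) \<and> (v (y x e) < v s \<longleftrightarrow> v (y x e) \<le> v (y x' e))"
          using that s by (force simp: not_less)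
      qed
      then have eq: "map (\<lambda>x. P x e s) as = map (\<lambda>x. Pp x' x e) as" by simp
      have "B (map (\<lambda>x. P x e s) as)" using 3(3) unfolding eq .
      then show ?thesis using s0 by blast
    qed
  qed
  have eq0: "qf v F (\<lambda>e. U x e = 0)" "qf v F (\<lambda>e. L x e = 0)" if "x \<in> set as" for x
    by (intro qf_eq_0 F UL that)+
  have P0F: "qf v F (P0 x)" if "x \<in> set as" for x
  proof (cases "ku x")
    case True
    then have "P0 x = (\<lambda>e. U x e = 0 \<or> \<not> L x e = 0)" by (simp add: P0_def)
    then show ?thesis using boolc_disj[OF eq0(1)[OF that] boolc.neg[OF eq0(2)[OF that]]] by simp
  next
    case False
    then have "P0 x = (if kl x then (\<lambda>e. U x e = 0) else (\<lambda>e. v (U x e) \<le> v (L x e)))"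
      by (auto simp: P0_def)
    then show ?thesis using eq0(1)[OF that] qf_le[OF UL[OF that], of v] by simp
  qed
  have PeF: "qf v F (Pe x' x)" if "x \<in> set as" "x' \<in> set as" for x x'
  proof -
    have "Pe x' x = (if ku x then (\<lambda>e. v (U x e * \<gamma> x' e) \<le> v (L x e * \<kappa> x' e))
       else if kl x then (\<lambda>e. v (U x e * \<kappa> x' e) \<le> v (L x e * \<gamma> x' e)) else (\<lambda>e. v (U x e) \<le> v (L x e)))"
      by (auto simp: Pe_def)
    moreover have "qf v F (\<lambda>e. v (U x e * \<gamma> x' e) \<le> v (L x e * \<kappa> x' e))"
      "qf v F (\<lambda>e. v (U x e * \<kappa> x' e) \<le> v (L x e * \<gamma> x' e))" "qf v F (\<lambda>e. v (U x e) \<le> v (L x e))"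
      by (intro qf_le funring_mult[OF F] UL \<gamma>F \<kappa>F that)+
    ultimately show ?thesis by simp
  qed
  have PpF: "qf v F (Pp x' x)" if "x \<in> set as" "x' \<in> set as" for x x'
  proof -
    have "Pp x' x = (if ku x then (\<lambda>e. U x e = 0 \<or> \<not> v (L x e * \<kappa> x' e) \<le> v (U x e * \<gamma> x' e))
       else if kl x then (\<lambda>e. v (U x e * \<kappa> x' e) \<le> v (L x e * \<gamma> x' e)) else (\<lambda>e. v (U x e) \<le> v (L x e)))"
      by (auto simp: Pp_def)
    moreover have "qf v F (\<lambda>e. U x e = 0 \<or> \<not> v (L x e * \<kappa> x' e) \<le> v (U x e * \<gamma> x' e))"
      "qf v F (\<lambda>e. v (U x e * \<kappa> x' e) \<le> v (L x e * \<gamma> x' e))" "qf v F (\<lambda>e. v (U x e) \<le> v (L x e))"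
      by (intro boolc_disj boolc.neg eq0 qf_le funring_mult[OF F] UL \<gamma>F \<kappa>F that)+
    ultimately show ?thesis by simp
  qed
  show ?thesis
    unfolding main
    by (intro boolc_disj boolc_bex boolc.conj boolc_const boolc.neg eq0 boolc_map P0F PeF PpF) simp_all
qed

text \<open>Raising the atoms to suitable powers makes \<open>t\<close> occur in each of them with
  exponent 0 or \<open>M\<close>. Every nonzero \<open>s\<close> is an \<open>M\<close>-th power, so
  quantifying over \<open>t\<close> amounts to quantifying over \<open>s = t ^ M\<close>, which
  occurs linearly.\<close>

lemma qf_ex_value:
  assumes F: "funring F" and \<Psi>: "boolc (monomial_atoms v F) \<Psi>"
  shows "qf v F (\<lambda>e. \<exists>t. t \<noteq> 0 \<and> \<Psi> (e, t))"
proof -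
  obtain as B where as: "set as \<subseteq> monomial_atoms v F" "\<Psi> = (\<lambda>e. B (map (\<lambda>a. a e) as))"
    using boolc_finite_rep[OF \<Psi>] by blast
  have "\<forall>x\<in>set as. \<exists>q. case q of (a, b, i, j) \<Rightarrow> a \<in> F \<and> b \<in> F \<and>
      x = (\<lambda>(e, t). v (a e) * v t ^ i \<le> v (b e) * v t ^ j)"
  proof
    fix x assume "x \<in> set as"
    then obtain a b i j where "a \<in> F" "b \<in> F" "x = (\<lambda>(e, t). v (a e) * v t ^ i \<le> v (b e) * v t ^ j)"
      using as(1) unfolding monomial_atoms_def by blast
    then show "\<exists>q. case q of (a, b, i, j) \<Rightarrow> a \<in> F \<and> b \<in> F \<and>
        x = (\<lambda>(e, t). v (a e) * v t ^ i \<le> v (b e) * v t ^ j)"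
      by (intro exI[of _ "(a, b, i, j)"]) simp
  qed
  from bchoice[OF this] obtain q where q: "\<forall>x\<in>set as. case q x of (a, b, i, j) \<Rightarrow>
      a \<in> F \<and> b \<in> F \<and> x = (\<lambda>(e, t). v (a e) * v t ^ i \<le> v (b e) * v t ^ j)" by blast
  define a b i j where "a = (\<lambda>x. fst (q x))" and "b = (\<lambda>x. fst (snd (q x)))"
    and "i = (\<lambda>x. fst (snd (snd (q x))))" and "j = (\<lambda>x. snd (snd (snd (q x))))"
  have ab: "a x \<in> F" "b x \<in> F" "x = (\<lambda>(e, t). v (a x e) * v t ^ i x \<le> v (b x e) * v t ^ j x)"
    if "x \<in> set as" for x
    using bspec[OF q that] by (simp_all add: a_def b_def i_def j_def split_beta)
  \<comment> \<open>The difference of the two exponents of \<open>t\<close> after cancellation,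
    replaced by 1 if they agree so that it divides the common multiple \<open>M\<close>.\<close>
  define m where "m = (\<lambda>x. if i x = j x then 1 else if i x < j x then j x - i x else i x - j x)"
  define M where "M = (\<Prod>x\<in>set as. m x)"
  define n where "n = (\<lambda>x. M div m x)"
  have mpos: "m x > 0" for x by (simp add: m_def)
  have Mpos: "M > 0" unfolding M_def using mpos by (simp add: prod_pos)
  have mn: "m x * n x = M" and npos: "n x > 0" if "x \<in> set as" for x
  proof -
    have "m x dvd M" unfolding M_def using that by (simp add: dvd_prodI)
    then show "m x * n x = M" by (simp add: n_def)
    then show "n x > 0" using Mpos by (metis gr0I mult_0_right)
  qed
  let ?P = "\<lambda>x e s. v (a x e ^ n x * (if i x > j x then s else 1)) \<le> v (b x e ^ n x * (if i x < j x then s else 1))"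
  have P: "x (e, t) = ?P x e (t ^ M)" if x: "x \<in> set as" and t: "t \<noteq> 0" for x e t
  proof -
    have vt: "v t ^ k \<noteq> 0" for k using t by (simp add: power_eq_0_value eq_0_iff)
    have tM: "v t ^ M = (v t ^ m x) ^ n x" by (simp add: power_mult[symmetric] mn[OF x])
    have *: "x (e, t) \<longleftrightarrow> v (a x e) * v t ^ i x \<le> v (b x e) * v t ^ j x"
      by (subst ab(3)[OF x]) simp
    consider "i x = j x" | "i x < j x" | "i x > j x" by linarith
    then show ?thesis
    proof cases
      case 1
      then have "x (e, t) \<longleftrightarrow> v (a x e) \<le> v (b x e)"
        unfolding * using mult_left_le_cancel_value[OF vt[of "j x"], of "v (a x e)" "v (b x e)"]
        by (simp add: mult.commute)
      then show ?thesis using 1 by (simp add: power power_le_iff_value npos[OF x])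
    next
      case 2
      then have "v t ^ j x = v t ^ i x * v t ^ m x" by (simp add: m_def flip: power_add)
      then have "x (e, t) \<longleftrightarrow> v (a x e) \<le> v (b x e) * v t ^ m x"
        unfolding * using mult_left_le_cancel_value[OF vt[of "i x"], of "v (a x e)" "v (b x e) * v t ^ m x"]
        by (simp add: mult.commute mult.left_commute)
      then show ?thesis using 2 power_le_iff_value[OF npos[OF x], of "v (a x e)" "v (b x e) * v t ^ m x"]
        by (simp add: power mult tM power_mult_distrib)
    next
      case 3
      then have "v t ^ i x = v t ^ j x * v t ^ m x" by (simp add: m_def flip: power_add)
      then have "x (e, t) \<longleftrightarrow> v (a x e) * v t ^ m x \<le> v (b x e)"
        unfolding * using mult_left_le_cancel_value[OF vt[of "j x"], of "v (a x e) * v t ^ m x" "v (b x e)"]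
        by (simp add: mult.commute mult.left_commute)
      then show ?thesis using 3 power_le_iff_value[OF npos[OF x], of "v (a x e) * v t ^ m x" "v (b x e)"]
        by (simp add: power mult tM power_mult_distrib)
    qed
  qed
  have "qf v F (\<lambda>e. \<exists>s. s \<noteq> 0 \<and> B (map (\<lambda>x. ?P x e s) as))"
    by (rule qf_ex_value_linear[OF F]) (auto intro!: funring_power[OF F] ab)
  moreover have "(\<exists>t. t \<noteq> 0 \<and> \<Psi> (e, t)) \<longleftrightarrow> (\<exists>s. s \<noteq> 0 \<and> B (map (\<lambda>x. ?P x e s) as))" for e
  proof
    assume "\<exists>t. t \<noteq> 0 \<and> \<Psi> (e, t)"
    then obtain t where t: "t \<noteq> 0" "B (map (\<lambda>x. x (e, t)) as)" by (auto simp: as(2))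
    have "map (\<lambda>x. x (e, t)) as = map (\<lambda>x. ?P x e (t ^ M)) as"
      by (rule map_cong) (use P[OF _ t(1)] in auto)
    from t(2)[unfolded this] show "\<exists>s. s \<noteq> 0 \<and> B (map (\<lambda>x. ?P x e s) as)"
      using t(1) by (intro exI[of _ "t ^ M"] conjI) simp_all
  next
    assume "\<exists>s. s \<noteq> 0 \<and> B (map (\<lambda>x. ?P x e s) as)"
    then obtain s where s: "s \<noteq> 0" "B (map (\<lambda>x. ?P x e s) as)" by blast
    obtain t where t: "t ^ M = s" using nth_root_exists[OF Mpos] by blast
    have t0: "t \<noteq> 0" using t s Mpos by (auto simp: zero_power)
    have eq: "map (\<lambda>x. x (e, t)) as = map (\<lambda>x. ?P x e (t ^ M)) as"
      by (rule map_cong) (use P[OF _ t0] in auto)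
    have "\<Psi> (e, t)" using s(2) unfolding as(2) eq t .
    then show "\<exists>t. t \<noteq> 0 \<and> \<Psi> (e, t)" using t0 by blast
  qed
  ultimately show ?thesis by simp
qed

section \<open>Elimination of a field quantifier through balls about roots\<close>

lemma coeff_pcompose_scale: "coeff (pcompose p [:0, t:]) i = coeff p i * t ^ i" for p :: "'k poly"
proof (induction p arbitrary: i)
  case (pCons a p)
  have "pcompose (pCons a p) [:0, t:] = [:a:] + pCons 0 (Polynomial.smult t (pcompose p [:0, t:]))"
    by (simp add: pcompose_pCons)
  then show ?case using pCons.IH by (cases i) (simp_all add: mult.commute mult.left_commute)
qed simp

lemma gauss_norm_ball_le_iff:
  assumes "degree p \<le> m" "degree q \<le> n"
  shows "gauss_norm v (pcompose p [:0, t:]) \<le> gauss_norm v (pcompose q [:0, t:]) \<longleftrightarrow>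
    (\<forall>i\<in>{..m}. \<exists>j\<in>{..n}. v (coeff p i) * v t ^ i \<le> v (coeff q j) * v t ^ j)"
proof -
  have "degree (pcompose p [:0, t:]) \<le> m" "degree (pcompose q [:0, t:]) \<le> n"
    using assms degree_pcompose_le[of p "[:0, t:]"] degree_pcompose_le[of q "[:0, t:]"]
    by (simp_all split: if_splits)
  from gauss_norm_le_bounded_iff[OF this] show ?thesis
    by (simp add: coeff_pcompose_scale mult power Ball_def Bex_def)
qed

text \<open>By \<open>nearest_root\<close> and \<open>generic_point_of_ball\<close> the quantifier
  over \<open>x\<close> splits into one over roots \<open>r\<close> of the polynomials in
  \<open>Q\<close> and one over nonzero \<open>t\<close>. The latter is removed first, over the ring
  that contains \<open>r\<close> as an argument, and then the former by
  \<open>qf_root\<close>.\<close>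

theorem qf_ex:
  assumes F: "funring F" and \<phi>: "qf v (feval (\<lambda>x. x) F) \<phi>"
  shows "qf v F (\<lambda>e. \<exists>x. \<phi> (e, x))"
proof -
  let ?F = "feval (\<lambda>x. x) F"
  note F' = funring_feval[OF F, of "\<lambda>x. x"]
  note P = funring_fpoly[OF F] and P' = funring_fpoly[OF F']
  obtain as B where as: "set as \<subseteq> val_atoms v ?F" "\<phi> = (\<lambda>e. B (map (\<lambda>a. a e) as))"
    using boolc_finite_rep[OF \<phi>] by blast
  have "\<forall>x\<in>set as. \<exists>q. case q of (a, b) \<Rightarrow> a \<in> fpoly F \<and> b \<in> fpoly F \<and>
      x = (\<lambda>(e, t). v (poly (a e) t) \<le> v (poly (b e) t))"
  proof
    fix x assume "x \<in> set as"
    then obtain a' b' where x: "x = (\<lambda>z. v (a' z) \<le> v (b' z))" and *: "a' \<in> ?F" "b' \<in> ?F"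
      using as(1) unfolding val_atoms_def by blast
    obtain a b where "a \<in> fpoly F" "a' = (\<lambda>(e, x). poly (a e) x)"
      "b \<in> fpoly F" "b' = (\<lambda>(e, x). poly (b e) x)"
      using * unfolding feval_def by blast
    with x show "\<exists>q. case q of (a, b) \<Rightarrow> a \<in> fpoly F \<and> b \<in> fpoly F \<and>
        x = (\<lambda>(e, t). v (poly (a e) t) \<le> v (poly (b e) t))"
      by (intro exI[of _ "(a, b)"]) auto
  qed
  from bchoice[OF this] obtain q where q: "\<forall>x\<in>set as. case q x of (a, b) \<Rightarrow>
      a \<in> fpoly F \<and> b \<in> fpoly F \<and> x = (\<lambda>(e, t). v (poly (a e) t) \<le> v (poly (b e) t))" by blast
  define a b where "a = (\<lambda>x. fst (q x))" and "b = (\<lambda>x. snd (q x))"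
  have ab: "a x \<in> fpoly F" "b x \<in> fpoly F" "x = (\<lambda>(e, t). v (poly (a x e) t) \<le> v (poly (b x e) t))"
    if "x \<in> set as" for x
    using bspec[OF q that] by (simp_all add: a_def b_def split_beta)
  define Q where "Q = insert (\<lambda>e. [:0, 1:]) (a ` set as \<union> b ` set as)"
  have QF: "q \<in> fpoly F" if "q \<in> Q" for q
  proof -
    have "(\<lambda>e. [:0, 1:]) \<in> fpoly F"
      by (intro fpoly_pCons[OF F] fpoly_const[OF F] funring_0[OF F] funring_1[OF F])
    then show ?thesis using that ab by (auto simp: Q_def)
  qed
  have finQ: "finite Q" by (simp add: Q_def)
  define N where "N = (\<lambda>(a :: 'a \<Rightarrow> 'k poly) e r t. gauss_norm v (pcompose (a e) [:r, t:]))"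
  define \<phi>' where "\<phi>' = (\<lambda>z. B (map (\<lambda>x. N (a x) (fst (fst z)) (snd (fst z)) (snd z) \<le> N (b x) (fst (fst z)) (snd (fst z)) (snd z)) as))"
  have shift: "(\<lambda>(e, r). pcompose (p e) [:r, 1:]) \<in> fpoly ?F" if p: "p \<in> fpoly F" for p
  proof -
    obtain d where d: "\<And>e. degree (p e) \<le> d" using fpoly_degree[OF p] by blast
    have "pcompose (p e) [:r, 1:] = (\<Sum>i\<le>d. [:coeff (p e) i:] * [:r, 1:] ^ i)" for e r
    proof -
      have "pcompose (p e) [:r, 1:] = poly (map_poly (\<lambda>c. [:c:]) (p e)) [:r, 1:]"
        by (simp add: pcompose_altdef)
      also have "\<dots> = (\<Sum>i\<le>d. [:coeff (p e) i:] * [:r, 1:] ^ i)"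
        by (subst poly_bounded_degree[of _ d])
           (auto simp: coeff_map_poly intro: order_trans[OF map_poly_degree_leq d])
      finally show ?thesis .
    qed
    then have eq: "(\<lambda>(e, r). pcompose (p e) [:r, 1:]) =
        (\<lambda>z. \<Sum>i\<le>d. [:case z of (e, r) \<Rightarrow> coeff (p e) i:] * [:case z of (e, r) \<Rightarrow> r, 1:] ^ i)"
      by auto
    show ?thesis
      unfolding eq
      by (intro funring_sum[OF P'] funring_mult[OF P'] funring_power[OF P'] fpoly_pCons[OF F']
          fpoly_const[OF F'] funring_1[OF F'] feval_fst[OF F] feval_snd[OF F] fpoly_coeff[OF p] funring_0[OF P'])
  qed
  have atom: "boolc (monomial_atoms v ?F) (\<lambda>z. N p (fst (fst z)) (snd (fst z)) (snd z) \<le> N q (fst (fst z)) (snd (fst z)) (snd z))"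
    if p: "p \<in> fpoly F" and q: "q \<in> fpoly F" for p q
  proof -
    let ?p = "\<lambda>(e, r). pcompose (p e) [:r, 1:]" and ?q = "\<lambda>(e, r). pcompose (q e) [:r, 1:]"
    obtain m where m: "\<And>z. degree (?p z) \<le> m" using fpoly_degree[OF shift[OF p]] by blast
    obtain n where n: "\<And>z. degree (?q z) \<le> n" using fpoly_degree[OF shift[OF q]] by blast
    \<comment> \<open>Translation comes first and keeps the coefficients polynomial in
      \<open>(e, r)\<close>; the scaling then introduces \<open>t\<close> through powers of |t|
      only.\<close>
    have comp: "N p e r t = gauss_norm v (pcompose (pcompose (p e) [:r, 1:]) [:0, t:])" for p :: "'a \<Rightarrow> 'k poly" and e r t
      by (simp add: N_def pcompose_pCons flip: pcompose_assoc)
    have "boolc (monomial_atoms v ?F) (\<lambda>z. \<forall>i\<in>{..m}. \<exists>j\<in>{..n}.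
        (\<lambda>(e, t). v (coeff (?p e) i) * v t ^ i \<le> v (coeff (?q e) j) * v t ^ j) z)"
      by (intro boolc_ball boolc_bex boolc.atom)
         (use fpoly_coeff[OF shift[OF p]] fpoly_coeff[OF shift[OF q]] in \<open>force simp: monomial_atoms_def\<close>)+
    moreover have "(\<forall>i\<in>{..m}. \<exists>j\<in>{..n}.
        (\<lambda>(e, t). v (coeff (?p e) i) * v t ^ i \<le> v (coeff (?q e) j) * v t ^ j) z) =
        (N p (fst (fst z)) (snd (fst z)) (snd z) \<le> N q (fst (fst z)) (snd (fst z)) (snd z))" for z
    proof -
      obtain e r t where z: "z = ((e, r), t)" by (metis prod.exhaust)
      show ?thesis
        using gauss_norm_ball_le_iff[OF m[of "(e, r)"] n[of "(e, r)"], of t] by (simp add: comp z)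
    qed
    ultimately show ?thesis by simp
  qed
  have "boolc (monomial_atoms v ?F) \<phi>'"
    unfolding \<phi>'_def by (rule boolc_map) (intro atom ab)
  then have "qf v ?F (\<lambda>z. \<phi> z \<or> (\<exists>t. t \<noteq> 0 \<and> \<phi>' (z, t)))"
    by (intro boolc_disj \<phi> qf_ex_value[OF F'])
  then have "qf v F (\<lambda>e. \<exists>q\<in>Q. q e \<noteq> 0 \<and> (\<exists>r. poly (q e) r = 0 \<and> (\<phi> (e, r) \<or> (\<exists>t. t \<noteq> 0 \<and> \<phi>' ((e, r), t)))))"
    by (intro boolc_bex finQ qf_root[OF F QF])
  moreover have "(\<exists>x. \<phi> (e, x)) \<longleftrightarrow>
     (\<exists>q\<in>Q. q e \<noteq> 0 \<and> (\<exists>r. poly (q e) r = 0 \<and> (\<phi> (e, r) \<or> (\<exists>t. t \<noteq> 0 \<and> \<phi>' ((e, r), t)))))" for e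
  proof -
    define L where "L = (\<lambda>q. q e) ` Q"
    have finL: "finite L" using finQ by (simp add: L_def)
    have XL: "[:0, 1:] \<in> L" by (auto simp: L_def Q_def)
    have abL: "a x e \<in> L" "b x e \<in> L" if "x \<in> set as" for x
      using that by (auto simp: L_def Q_def)
    have transfer: "\<phi> (e, x) \<longleftrightarrow> \<phi>' ((e, r), t)"
      if "\<forall>a\<in>L. v (poly a x) = gauss_norm v (pcompose a [:r, t:])" for x r t
    proof -
      have eq: "map (\<lambda>y. y (e, x)) as = map (\<lambda>y. N (a y) e r t \<le> N (b y) e r t) as"
      proof (rule map_cong)
        fix y assume y: "y \<in> set as"
        have "y (e, x) = (v (poly (a y e) x) \<le> v (poly (b y e) x))" by (subst ab(3)[OF y]) simp
        then show "y (e, x) = (N (a y) e r t \<le> N (b y) e r t)"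
          using that abL[OF y] by (simp add: N_def)
      qed simp
      show ?thesis unfolding as(2) eq by (simp add: \<phi>'_def)
    qed
    show ?thesis
    proof
      assume "\<exists>x. \<phi> (e, x)"
      then obtain x where x: "\<phi> (e, x)" by blast
      obtain q where q: "q \<in> L" "q \<noteq> 0" "\<exists>r. poly q r = 0 \<and> (x = r \<or> (\<exists>t. t \<noteq> 0 \<and>
          (\<forall>a\<in>L. v (poly a x) = gauss_norm v (pcompose a [:r, t:]))))"
        using nearest_root[OF finL XL] by metis
      then show "\<exists>q\<in>Q. q e \<noteq> 0 \<and> (\<exists>r. poly (q e) r = 0 \<and> (\<phi> (e, r) \<or> (\<exists>t. t \<noteq> 0 \<and> \<phi>' ((e, r), t))))"
        using x transfer unfolding L_def by blast
    next
      assume "\<exists>q\<in>Q. q e \<noteq> 0 \<and> (\<exists>r. poly (q e) r = 0 \<and> (\<phi> (e, r) \<or> (\<exists>t. t \<noteq> 0 \<and> \<phi>' ((e, r), t))))"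
      then show "\<exists>x. \<phi> (e, x)" using transfer generic_point_of_ball[OF finL] by metis
    qed
  qed
  ultimately show ?thesis by simp
qed

end

section \<open>Polynomial functions and formulas\<close>

text \<open>Functions given by polynomials of total degree at most \<open>d\<close>. The degree is
  carried as a bound, which suffices for the Hilbert function, and functions fit into
  \<open>funring\<close> directly.\<close>

inductive pfd :: "nat set \<Rightarrow> nat \<Rightarrow> ((nat \<Rightarrow> 'k::comm_ring_1) \<Rightarrow> 'k) \<Rightarrow> bool" for I where
  const: "pfd I d (\<lambda>e. c)"
| var: "i \<in> I \<Longrightarrow> d > 0 \<Longrightarrow> pfd I d (\<lambda>e. e i)"
| add: "pfd I d f \<Longrightarrow> pfd I d g \<Longrightarrow> pfd I d (\<lambda>e. f e + g e)"
| mult: "pfd I a f \<Longrightarrow> pfd I b g \<Longrightarrow> a + b \<le> d \<Longrightarrow> pfd I d (\<lambda>e. f e * g e)"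

lemma pfd_mono:
  assumes "pfd I d f" "d \<le> d'"
  shows "pfd I d' f"
  using assms
proof (induction arbitrary: d')
  case (const d c)
  show ?case by (rule pfd.const)
next
  case (var i d)
  then show ?case by (intro pfd.var) auto
next
  case (add d f g)
  then show ?case by (intro pfd.add) auto
next
  case (mult a f b g d)
  show ?case by (rule pfd.mult[OF mult.hyps(1,2)]) (use mult in linarith)
qed

lemma pfd_subset:
  assumes "pfd I d f" "I \<subseteq> J"
  shows "pfd J d f"
  using assms
proof induction
  case (mult a f b g d)
  show ?case by (rule pfd.mult[OF mult.IH]) (use mult in auto)
qed (auto intro: pfd.const pfd.var pfd.add)

lemma pfd_cong:
  assumes "pfd I d f" "\<And>i. i \<in> I \<Longrightarrow> e i = e' i"
  shows "f e = f e'"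
  using assms by induction auto

lemma pfd_compose:
  assumes "pfd I d f" "\<And>i. i \<in> I \<Longrightarrow> pfd J 1 (\<lambda>e. s e i)"
  shows "pfd J d (\<lambda>e. f (s e))"
  using assms
proof induction
  case (const d c)
  show ?case by (rule pfd.const)
next
  case (var i d)
  then show ?case using pfd_mono[of J 1 "\<lambda>e. s e i" d] by auto
next
  case (add d f g)
  then show ?case by (intro pfd.add) auto
next
  case (mult a f b g d)
  show ?case by (rule pfd.mult[OF mult.IH]) (use mult in auto)
qed

lemma pfd_prod:
  assumes "finite A" "\<And>i. i \<in> A \<Longrightarrow> pfd I d (f i)"
  shows "pfd I (card A * d) (\<lambda>e. \<Prod>i\<in>A. f i e)"
  using assms
proof (induction A rule: finite_induct)
  case (insert x A)
  then have "pfd I (card (insert x A) * d) (\<lambda>e. f x e * (\<Prod>i\<in>A. f i e))"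
    by (intro pfd.mult[of I d _ "card A * d"]) auto
  then show ?case using insert by simp
qed (auto intro: pfd.const)

definition polyfun :: "nat set \<Rightarrow> ((nat \<Rightarrow> 'k::comm_ring_1) \<Rightarrow> 'k) set" where
  "polyfun I = {f. \<exists>d. pfd I d f}"

lemma polyfunI: "pfd I d f \<Longrightarrow> f \<in> polyfun I"
  by (auto simp: polyfun_def)

lemma polyfun_const: "(\<lambda>e. c) \<in> polyfun I"
  by (rule polyfunI[of _ 0]) (rule pfd.const)

lemma polyfun_var: "i \<in> I \<Longrightarrow> (\<lambda>e. e i) \<in> polyfun I"
  by (rule polyfunI[of _ 1]) (auto intro: pfd.var)

lemma polyfun_add:
  assumes "f \<in> polyfun I" "g \<in> polyfun I"
  shows "(\<lambda>e. f e + g e) \<in> polyfun I"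
proof -
  obtain a b where "pfd I a f" "pfd I b g" using assms unfolding polyfun_def by blast
  then have "pfd I (max a b) f" "pfd I (max a b) g" by (auto elim: pfd_mono)
  then show ?thesis by (intro polyfunI[OF pfd.add])
qed

lemma polyfun_mult:
  assumes "f \<in> polyfun I" "g \<in> polyfun I"
  shows "(\<lambda>e. f e * g e) \<in> polyfun I"
proof -
  obtain a b where "pfd I a f" "pfd I b g" using assms unfolding polyfun_def by blast
  then show ?thesis by (intro polyfunI[OF pfd.mult[of I a f b g "a + b"]]) auto
qed

lemma polyfun_minus: "f \<in> polyfun I \<Longrightarrow> (\<lambda>e. - f e) \<in> polyfun I"
  using polyfun_mult[OF polyfun_const[of "- 1"], of f I] by simp

lemma funring_polyfun: "funring (polyfun I)"
  unfolding funring_def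
  by (intro conjI ballI polyfun_const polyfun_add polyfun_mult polyfun_minus)

lemma polyfun_induct [consumes 1, case_names const var add mult]:
  assumes "f \<in> polyfun I" "\<And>c. P (\<lambda>e. c)" "\<And>i. i \<in> I \<Longrightarrow> P (\<lambda>e. e i)"
    "\<And>f g. f \<in> polyfun I \<Longrightarrow> g \<in> polyfun I \<Longrightarrow> P f \<Longrightarrow> P g \<Longrightarrow> P (\<lambda>e. f e + g e)"
    "\<And>f g. f \<in> polyfun I \<Longrightarrow> g \<in> polyfun I \<Longrightarrow> P f \<Longrightarrow> P g \<Longrightarrow> P (\<lambda>e. f e * g e)"
  shows "P f"
proof -
  obtain d where "pfd I d f" using assms(1) unfolding polyfun_def by blast
  then show ?thesis
  proof induction
    case (add d f g)
    then show ?case by (intro assms(4) polyfunI[of I d])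
  next
    case (mult a f b g d)
    then show ?case by (intro assms(5) polyfunI[of I a f] polyfunI[of I b g])
  qed (auto intro: assms(2,3))
qed

lemma polyfun_subset: "I \<subseteq> J \<Longrightarrow> polyfun I \<subseteq> polyfun J"
  unfolding polyfun_def using pfd_subset by blast

lemma polyfun_cong: "f \<in> polyfun I \<Longrightarrow> (\<And>i. i \<in> I \<Longrightarrow> e i = e' i) \<Longrightarrow> f e = f e'"
  unfolding polyfun_def using pfd_cong by blast

text \<open>Singling out one variable serves quantifier elimination, Hilbert's basis theorem and the
  extraction of algebraic relations.\<close>

lemma polyfun_univariate:
  assumes "f \<in> polyfun I"
  shows "\<exists>p\<in>fpoly (polyfun (I - {i})). \<forall>e x. f (e(i := x)) = poly (p e) x"
  using assms
proof (induction rule: polyfun_induct)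
  note F = funring_polyfun and P = funring_fpoly[OF funring_polyfun]
  {
    case (const c)
    show ?case
      by (rule bexI[of _ "\<lambda>e. [:c:]"]) (auto intro!: fpoly_const[OF F] polyfun_const)
  next
    case (var j)
    show ?case
    proof (cases "j = i")
      case True
      then show ?thesis
        by (intro bexI[of _ "\<lambda>e. [:0, 1:]"])
           (auto intro!: fpoly_pCons[OF F] fpoly_const[OF F] polyfun_const)
    next
      case False
      then show ?thesis
        using var by (intro bexI[of _ "\<lambda>e. [:e j:]"]) (auto intro!: fpoly_const[OF F] polyfun_var)
    qed
  next
    case (add f g)
    then obtain p q where pq: "p \<in> fpoly (polyfun (I - {i}))" "q \<in> fpoly (polyfun (I - {i}))"
      "\<And>e x. f (e(i := x)) = poly (p e) x" "\<And>e x. g (e(i := x)) = poly (q e) x" by blast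
    show ?case
      by (intro bexI[of _ "\<lambda>e. p e + q e"] funring_add[OF P] allI pq(1,2)) (simp only: poly_add pq)
  next
    case (mult f g)
    then obtain p q where pq: "p \<in> fpoly (polyfun (I - {i}))" "q \<in> fpoly (polyfun (I - {i}))"
      "\<And>e x. f (e(i := x)) = poly (p e) x" "\<And>e x. g (e(i := x)) = poly (q e) x" by blast
    show ?case
      by (intro bexI[of _ "\<lambda>e. p e * q e"] funring_mult[OF P] allI pq(1,2)) (simp only: poly_mult pq)
  }
qed

lemma (in acval) qf_polyfun_ex:
  assumes "qf v (polyfun I) \<phi>"
  shows "qf v (polyfun (I - {i})) (\<lambda>e. \<exists>x. \<phi> (e(i := x)))"
proof -
  have "qf v (feval (\<lambda>x. x) (polyfun (I - {i}))) (\<lambda>z. \<phi> ((fst z)(i := snd z)))"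
    using assms
  proof (rule boolc_subst)
    fix a assume "a \<in> val_atoms v (polyfun I :: ((nat \<Rightarrow> 'k) \<Rightarrow> 'k) set)"
    then obtain f g where a: "a = (\<lambda>e. v (f e) \<le> v (g e))" and fg: "f \<in> polyfun I" "g \<in> polyfun I"
      unfolding val_atoms_def by blast
    have *: "(\<lambda>z. f ((fst z)(i := snd z))) \<in> feval (\<lambda>x. x) (polyfun (I - {i}))" if f: "f \<in> polyfun I"
      for f :: "(nat \<Rightarrow> 'k) \<Rightarrow> 'k"
    proof -
      obtain p where "p \<in> fpoly (polyfun (I - {i}))" "\<forall>e x. f (e(i := x)) = poly (p e) x"
        using polyfun_univariate[OF f] by blast
      then show ?thesis by (intro fevalI[of p]) auto
    qed
    show "qf v (feval (\<lambda>x. x) (polyfun (I - {i}))) (\<lambda>z. a ((fst z)(i := snd z)))"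
      unfolding a by (intro qf_le * fg)
  qed
  from qf_ex[OF funring_polyfun this] show ?thesis by simp
qed

subsection \<open>Formulas\<close>

text \<open>
  Since the valuation is onto, a variable of the value sort is the value of a field variable.
  The field variable \<open>i\<close> is encoded as \<open>2 * i\<close>, the value variable \<open>j\<close> as \<open>2 * j + 1\<close>.
\<close>

lemma fterm_polyfun: "(\<lambda>e. fterm_val (\<lambda>i. e (2 * i)) t) \<in> polyfun UNIV"
  by (induction t) (auto intro: polyfun_const polyfun_var polyfun_add polyfun_mult)

lemma (in acval) vterm_polyfun:
  assumes "surj v"
  shows "\<exists>a\<in>polyfun UNIV. \<forall>e. vterm_val v (\<lambda>i. e (2 * i)) (\<lambda>j. v (e (2 * j + 1))) t = v (a e)"
proof (induction t)
  case (VVar j)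
  show ?case by (rule bexI[of _ "\<lambda>e. e (2 * j + 1)"]) (auto intro: polyfun_var)
next
  case (VConst c)
  obtain x where "c = v x" using assms by (metis surjD)
  then show ?case by (intro bexI[of _ "\<lambda>e. x"]) (auto intro: polyfun_const)
next
  case (VAbs t)
  show ?case by (rule bexI[OF _ fterm_polyfun[of t]]) simp
next
  case (VMul s t)
  then obtain a b where "a \<in> polyfun UNIV" "b \<in> polyfun UNIV"
    "\<forall>e. vterm_val v (\<lambda>i. e (2 * i)) (\<lambda>j. v (e (2 * j + 1))) s = v (a e)"
    "\<forall>e. vterm_val v (\<lambda>i. e (2 * i)) (\<lambda>j. v (e (2 * j + 1))) t = v (b e)" by blast
  then show ?case by (intro bexI[of _ "\<lambda>e. a e * b e"]) (auto simp: mult intro: polyfun_mult)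
qed

theorem (in acval) sat_qf:
  assumes "surj v"
  shows "qf v (polyfun UNIV) (\<lambda>e. sat v (\<lambda>i. e (2 * i)) (\<lambda>j. v (e (2 * j + 1))) \<phi>)"
proof (induction \<phi>)
  case (FEq s t)
  have "qf v (polyfun UNIV) (\<lambda>e. fterm_val (\<lambda>i. e (2 * i)) s - fterm_val (\<lambda>i. e (2 * i)) t = 0)"
    by (intro qf_eq_0 funring_diff funring_polyfun fterm_polyfun)
  then show ?case by simp
next
  case (VEq s t)
  obtain a b where "a \<in> polyfun UNIV" "b \<in> polyfun UNIV"
    and eq: "\<And>e. vterm_val v (\<lambda>i. e (2 * i)) (\<lambda>j. v (e (2 * j + 1))) s = v (a e)"
    "\<And>e. vterm_val v (\<lambda>i. e (2 * i)) (\<lambda>j. v (e (2 * j + 1))) t = v (b e)"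
    using vterm_polyfun[OF assms] by metis
  then have "qf v (polyfun UNIV) (\<lambda>e. v (a e) \<le> v (b e) \<and> v (b e) \<le> v (a e))"
    by (intro boolc.conj qf_le)
  then show ?case by (simp only: sat.simps eq order.eq_iff)
next
  case (VLe s t)
  obtain a b where "a \<in> polyfun UNIV" "b \<in> polyfun UNIV"
    and eq: "\<And>e. vterm_val v (\<lambda>i. e (2 * i)) (\<lambda>j. v (e (2 * j + 1))) s = v (a e)"
    "\<And>e. vterm_val v (\<lambda>i. e (2 * i)) (\<lambda>j. v (e (2 * j + 1))) t = v (b e)"
    using vterm_polyfun[OF assms] by metis
  then have "qf v (polyfun UNIV) (\<lambda>e. v (a e) \<le> v (b e))"
    by (intro qf_le)
  then show ?case by (simp only: sat.simps eq)
next
  case (Neg \<phi>)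
  then show ?case unfolding sat.simps by (rule boolc.neg)
next
  case (Conj \<phi> \<psi>)
  then show ?case unfolding sat.simps by (rule boolc.conj)
next
  case (ExF i \<phi>)
  have "(\<lambda>i'. (e(2 * i := x)) (2 * i')) = (\<lambda>i. e (2 * i))(i := x)" for e :: "nat \<Rightarrow> 'k" and x
    by auto
  moreover have "(\<lambda>j. v ((e(2 * i := x)) (2 * j + 1))) = (\<lambda>j. v (e (2 * j + 1)))" for e :: "nat \<Rightarrow> 'k" and x
    by (metis (mono_tags, opaque_lifting) dvd_triv_left even_plus_one_iff fun_upd_apply)
  moreover note qf_polyfun_ex[OF ExF.IH, of "2 * i"]
  ultimately have "qf v (polyfun (UNIV - {2 * i})) (\<lambda>e. \<exists>x. sat v ((\<lambda>i. e (2 * i))(i := x)) (\<lambda>j. v (e (2 * j + 1))) \<phi>)"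
    by (simp only:)
  then show ?case
    unfolding sat.simps
    by (rule boolc_subst[where f = "\<lambda>e. e"])
       (use polyfun_subset[of "UNIV - {2 * i}" UNIV] in \<open>auto simp: val_atoms_def intro!: boolc.atom\<close>)
next
  case (ExV j \<phi>)
  have "(\<lambda>i'. (e(2 * j + 1 := x)) (2 * i')) = (\<lambda>i. e (2 * i))" for e :: "nat \<Rightarrow> 'k" and x
    by (metis (mono_tags, opaque_lifting) dvd_triv_left even_plus_one_iff fun_upd_apply)
  moreover have "(\<lambda>j'. v ((e(2 * j + 1 := x)) (2 * j' + 1))) = (\<lambda>j. v (e (2 * j + 1)))(j := v x)" for e :: "nat \<Rightarrow> 'k" and x
    by auto
  moreover note qf_polyfun_ex[OF ExV.IH, of "2 * j + 1"]
  ultimately have "qf v (polyfun (UNIV - {2 * j + 1})) (\<lambda>e. \<exists>x. sat v (\<lambda>i. e (2 * i)) ((\<lambda>j. v (e (2 * j + 1)))(j := v x)) \<phi>)"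
    by (simp only:)
  moreover have "(\<exists>x. sat v e ((h)(j := v x)) \<phi>) \<longleftrightarrow> (\<exists>g. sat v e (h(j := g)) \<phi>)" for e h
    using assms by (metis surjD)
  ultimately have "qf v (polyfun (UNIV - {2 * j + 1})) (\<lambda>e. \<exists>g. sat v (\<lambda>i. e (2 * i)) ((\<lambda>j. v (e (2 * j + 1)))(j := g)) \<phi>)"
    by (simp only:)
  then show ?case
    unfolding sat.simps
    by (rule boolc_subst[where f = "\<lambda>e. e"])
       (use polyfun_subset[of "UNIV - {2 * j + 1}" UNIV] in \<open>auto simp: val_atoms_def intro!: boolc.atom\<close>)
qed

section \<open>Closed sets as zero sets of polynomial functions\<close>

definition monom_fun :: "(nat \<Rightarrow>\<^sub>0 nat) \<Rightarrow> (nat \<Rightarrow> 'k::comm_ring_1) \<Rightarrow> 'k" where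
  "monom_fun m e = (\<Prod>i\<in>Poly_Mapping.keys m. e i ^ Poly_Mapping.lookup m i)"

lemma monom_fun_superset:
  assumes "finite A" "Poly_Mapping.keys m \<subseteq> A"
  shows "monom_fun m e = (\<Prod>i\<in>A. e i ^ Poly_Mapping.lookup m i)"
  unfolding monom_fun_def
  by (rule prod.mono_neutral_left) (use assms in \<open>auto simp: in_keys_iff\<close>)

lemma monom_fun_add: "monom_fun (m + m') e = monom_fun m e * monom_fun m' e"
proof -
  let ?A = "Poly_Mapping.keys m \<union> Poly_Mapping.keys m'"
  have fin: "finite ?A" by simp
  have *: "monom_fun (m + m') e = (\<Prod>i\<in>?A. e i ^ Poly_Mapping.lookup (m + m') i)"
    by (rule monom_fun_superset[OF fin Poly_Mapping.keys_add])
  show ?thesis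
    unfolding * monom_fun_superset[OF fin Un_upper1] monom_fun_superset[OF fin Un_upper2]
    by (simp add: lookup_add power_add prod.distrib)
qed

lemma mpoly_eval_superset:
  assumes "finite A" "Poly_Mapping.keys p \<subseteq> A"
  shows "mpoly_eval e p = (\<Sum>m\<in>A. Poly_Mapping.lookup p m * monom_fun m e)"
  unfolding mpoly_eval_def monom_fun_def[symmetric]
  by (rule sum.mono_neutral_left) (use assms in \<open>auto simp: in_keys_iff\<close>)

lemma mpoly_eval_add: "mpoly_eval e (p + q) = mpoly_eval e p + mpoly_eval e q"
proof -
  let ?A = "Poly_Mapping.keys p \<union> Poly_Mapping.keys q"
  have fin: "finite ?A" by simp
  have *: "mpoly_eval e (p + q) = (\<Sum>m\<in>?A. Poly_Mapping.lookup (p + q) m * monom_fun m e)"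
    by (rule mpoly_eval_superset[OF fin Poly_Mapping.keys_add])
  show ?thesis
    unfolding * mpoly_eval_superset[OF fin Un_upper1] mpoly_eval_superset[OF fin Un_upper2]
    by (simp add: lookup_add distrib_right sum.distrib)
qed

lemma mpoly_eval_single: "mpoly_eval e (Poly_Mapping.single m c) = c * monom_fun m e"
  by (subst mpoly_eval_superset[of "{m}"]) auto

text \<open>The link back to the formal polynomials in terms of which closed subvarieties are
  defined.\<close>

definition representable :: "nat set \<Rightarrow> ((nat \<Rightarrow> 'k::comm_ring_1) \<Rightarrow> 'k) \<Rightarrow> bool" where
  "representable I f \<longleftrightarrow> (\<exists>p. mpoly_vars p \<subseteq> I \<and> (\<forall>e. mpoly_eval e p = f e))"

lemma representable_single:
  assumes "Poly_Mapping.keys m \<subseteq> I"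
  shows "representable I (\<lambda>e. c * monom_fun m e)"
  unfolding representable_def
  by (rule exI[of _ "Poly_Mapping.single m c"]) (use assms in \<open>auto simp: mpoly_eval_single mpoly_vars_def\<close>)

lemma representable_add:
  assumes "representable I f" "representable I g"
  shows "representable I (\<lambda>e. f e + g e)"
proof -
  obtain p q where "mpoly_vars p \<subseteq> I" "mpoly_vars q \<subseteq> I"
    and *: "\<forall>e. mpoly_eval e p = f e" "\<forall>e. mpoly_eval e q = g e"
    using assms unfolding representable_def by blast
  then have "mpoly_vars (p + q) \<subseteq> I"
    using Poly_Mapping.keys_add[of p q] unfolding mpoly_vars_def by blast
  then show ?thesis
    unfolding representable_def by (intro exI[of _ "p + q"]) (simp add: mpoly_eval_add *)
qed

lemma representable_sum:
  assumes "finite A" "\<And>i. i \<in> A \<Longrightarrow> representable I (f i)"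
  shows "representable I (\<lambda>e. \<Sum>i\<in>A. f i e)"
  using assms
proof (induction A rule: finite_induct)
  case empty
  then show ?case using representable_single[of 0 I 0] by simp
next
  case (insert x A)
  then show ?case by (simp add: representable_add)
qed

lemma representable_polyfun:
  assumes "f \<in> polyfun I"
  shows "representable I f"
  using assms
proof (induction rule: polyfun_induct)
  case (const c)
  then show ?case using representable_single[of 0 I c] by (simp add: monom_fun_def)
next
  case (var i)
  then show ?case
    using representable_single[of "Poly_Mapping.single i 1" I 1] by (simp add: monom_fun_def)
next
  case (add f g)
  then show ?case by (intro representable_add)
next
  case (mult f g)
  then obtain p q where p: "mpoly_vars p \<subseteq> I" "\<And>e. mpoly_eval e p = f e"
    and q: "mpoly_vars q \<subseteq> I" "\<And>e. mpoly_eval e q = g e"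
    unfolding representable_def by blast
  have "f e * g e = (\<Sum>m\<in>Poly_Mapping.keys p. \<Sum>m'\<in>Poly_Mapping.keys q.
      (Poly_Mapping.lookup p m * Poly_Mapping.lookup q m') * monom_fun (m + m') e)" for e
    unfolding p(2)[symmetric] q(2)[symmetric] mpoly_eval_def monom_fun_def[symmetric] sum_product
    by (simp add: monom_fun_add mult.commute mult.left_commute)
  moreover have "representable I (\<lambda>e. \<Sum>m\<in>Poly_Mapping.keys p. \<Sum>m'\<in>Poly_Mapping.keys q.
      (Poly_Mapping.lookup p m * Poly_Mapping.lookup q m') * monom_fun (m + m') e)"
  proof (intro representable_sum representable_single)
    fix m m' assume "m \<in> Poly_Mapping.keys p" "m' \<in> Poly_Mapping.keys q"
    then show "Poly_Mapping.keys (m + m') \<subseteq> I"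
      using p(1) q(1) Poly_Mapping.keys_add[of m m'] unfolding mpoly_vars_def by blast
  qed simp_all
  ultimately show ?case by simp
qed

lemma polyfun_mpoly_eval:
  assumes "mpoly_vars p \<subseteq> I"
  shows "(\<lambda>e. mpoly_eval e p) \<in> polyfun I"
  unfolding mpoly_eval_def
proof (rule funring_sum[OF funring_polyfun], rule funring_mult[OF funring_polyfun polyfun_const],
    rule funring_prod[OF funring_polyfun], rule funring_power[OF funring_polyfun], rule polyfun_var)
  show "i \<in> I" if "m \<in> Poly_Mapping.keys p" "i \<in> Poly_Mapping.keys m" for m i
    using assms that unfolding mpoly_vars_def by blast
qed

definition zeros :: "nat \<Rightarrow> ((nat \<Rightarrow> 'k::comm_ring_1) \<Rightarrow> 'k) set \<Rightarrow> 'k list set" where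
  "zeros N P = {x. length x = N \<and> (\<forall>p\<in>P. p ((!) x) = 0)}"

lemma closed_subvariety_iff_zeros:
  "closed_subvariety N V \<longleftrightarrow> (\<exists>P\<subseteq>polyfun {..<N}. V = zeros N P)"
proof
  assume "closed_subvariety N V"
  then obtain P where P: "\<forall>p\<in>P. mpoly_vars p \<subseteq> {..<N}"
    "V = {x. length x = N \<and> (\<forall>p\<in>P. mpoly_eval ((!) x) p = 0)}"
    unfolding closed_subvariety_def by blast
  then have "(\<lambda>p e. mpoly_eval e p) ` P \<subseteq> polyfun {..<N}" by (auto intro: polyfun_mpoly_eval)
  moreover have "V = zeros N ((\<lambda>p e. mpoly_eval e p) ` P)" unfolding P(2) zeros_def by auto
  ultimately show "\<exists>P\<subseteq>polyfun {..<N}. V = zeros N P" by blast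
next
  assume "\<exists>P\<subseteq>polyfun {..<N}. V = zeros N P"
  then obtain P where P: "P \<subseteq> polyfun {..<N}" "V = zeros N P" by blast
  let ?Q = "{q. mpoly_vars q \<subseteq> {..<N} \<and> (\<exists>p\<in>P. \<forall>e. mpoly_eval e q = p e)}"
  have "(\<forall>p\<in>P. p e = 0) \<longleftrightarrow> (\<forall>q\<in>?Q. mpoly_eval e q = 0)" for e
  proof
    assume *: "\<forall>q\<in>?Q. mpoly_eval e q = 0"
    show "\<forall>p\<in>P. p e = 0"
    proof
      fix p assume p: "p \<in> P"
      then obtain q where "mpoly_vars q \<subseteq> {..<N}" "\<forall>e. mpoly_eval e q = p e"
        using P(1) representable_polyfun unfolding representable_def by blast
      then show "p e = 0" using * p by force
    qed
  qed force
  then have "V = {x. length x = N \<and> (\<forall>q\<in>?Q. mpoly_eval ((!) x) q = 0)}"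
    unfolding P(2) zeros_def by simp
  moreover have "\<forall>q\<in>?Q. mpoly_vars q \<subseteq> {..<N}" by blast
  ultimately show "closed_subvariety N V"
    unfolding closed_subvariety_def by (intro exI[of _ ?Q] conjI)
qed

lemma closed_subvariety_Int_zeros:
  assumes "closed_subvariety N V" "f \<in> polyfun {..<N}"
  shows "closed_subvariety N (V \<inter> {x. f ((!) x) = 0})"
proof -
  obtain P where "P \<subseteq> polyfun {..<N}" "V = zeros N P"
    using assms(1) unfolding closed_subvariety_iff_zeros by blast
  then show ?thesis
    unfolding closed_subvariety_iff_zeros using assms(2)
    by (intro exI[of _ "insert f P"]) (auto simp: zeros_def)
qed

section \<open>Hilbert's basis theorem\<close>

inductive_set fideal :: "('e \<Rightarrow> 'a::comm_ring_1) set \<Rightarrow> ('e \<Rightarrow> 'a) set \<Rightarrow> ('e \<Rightarrow> 'a) set" for F S where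
  zero: "(\<lambda>e. 0) \<in> fideal F S"
| step: "f \<in> fideal F S \<Longrightarrow> c \<in> F \<Longrightarrow> s \<in> S \<Longrightarrow> (\<lambda>e. f e + c e * s e) \<in> fideal F S"

lemma fideal_mono:
  assumes "f \<in> fideal F S" "S \<subseteq> T"
  shows "f \<in> fideal F T"
  using assms(1)
proof induction
  case zero
  show ?case by (rule fideal.zero)
next
  case (step f c s)
  then show ?case using assms(2) by (intro fideal.step) auto
qed

lemma fideal_gen:
  assumes "funring F" "s \<in> S"
  shows "s \<in> fideal F S"
  using fideal.step[OF fideal.zero funring_1[OF assms(1)] assms(2)] by simp

lemma fideal_add:
  assumes "f \<in> fideal F S" "g \<in> fideal F S"
  shows "(\<lambda>e. f e + g e) \<in> fideal F S"
  using assms(2)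
proof induction
  case zero
  then show ?case using assms(1) by simp
next
  case (step g c s)
  from fideal.step[OF step.IH step.hyps(2,3)] show ?case by (simp add: add.assoc)
qed

lemma fideal_mult:
  assumes "funring F" "f \<in> fideal F S" "c \<in> F"
  shows "(\<lambda>e. c e * f e) \<in> fideal F S"
  using assms(2)
proof induction
  case zero
  then show ?case by (simp add: fideal.zero)
next
  case (step g c' s)
  from fideal.step[OF step.IH funring_mult[OF assms(1,3) step.hyps(2)] step.hyps(3)]
  show ?case by (simp add: distrib_left mult.assoc)
qed

lemma fideal_trans:
  assumes "funring F" "f \<in> fideal F T" "T \<subseteq> fideal F S"
  shows "f \<in> fideal F S"
  using assms(2)
proof induction
  case (step g c s)
  then show ?case using fideal_add[OF step.IH fideal_mult[OF assms(1) _ step.hyps(2), of s]] assms(3) by blast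
qed (rule fideal.zero)

lemma fideal_finite:
  assumes "f \<in> fideal F S"
  shows "\<exists>T\<subseteq>S. finite T \<and> f \<in> fideal F T"
  using assms
proof induction
  case zero
  then show ?case by (intro exI[of _ "{}"]) (auto intro: fideal.zero)
next
  case (step g c s)
  then obtain T where "T \<subseteq> S" "finite T" "g \<in> fideal F T" by blast
  then have "(\<lambda>e. g e + c e * s e) \<in> fideal F (insert s T)"
    using step.hyps fideal_mono[of g F T "insert s T"] by (intro fideal.step) auto
  then show ?case using step.hyps \<open>T \<subseteq> S\<close> \<open>finite T\<close> by (intro exI[of _ "insert s T"]) auto
qed

lemma fideal_finite_subset:
  assumes "finite A" "A \<subseteq> fideal F S"
  shows "\<exists>T\<subseteq>S. finite T \<and> A \<subseteq> fideal F T"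
  using assms
proof (induction A rule: finite_induct)
  case empty
  then show ?case by blast
next
  case (insert a A)
  then obtain T where T: "T \<subseteq> S" "finite T" "A \<subseteq> fideal F T" by auto
  obtain T' where T': "T' \<subseteq> S" "finite T'" "a \<in> fideal F T'"
    using fideal_finite[of a F S] insert.prems by blast
  have "insert a A \<subseteq> fideal F (T \<union> T')"
    using T(3) T'(3) fideal_mono[of _ F T "T \<union> T'"] fideal_mono[of _ F T' "T \<union> T'"] by blast
  then show ?case using T T' by (intro exI[of _ "T \<union> T'"]) auto
qed

lemma fideal_vanish:
  assumes "f \<in> fideal F S" "\<And>s. s \<in> S \<Longrightarrow> s e = 0"
  shows "f e = 0"
  using assms
proof induction
  case (step f c s)
  have "s e = 0" by (rule step.prems[OF step.hyps(3)])
  moreover have "f e = 0" using step.IH step.prems by blast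
  ultimately show ?case by simp
qed simp

text \<open>Generators are taken from \<open>S\<close> itself, so a system of equations reduces to
  finitely many of its own members.\<close>

definition noetherian :: "('e \<Rightarrow> 'a::comm_ring_1) set \<Rightarrow> bool" where
  "noetherian F \<longleftrightarrow> (\<forall>S\<subseteq>F. \<exists>T\<subseteq>S. finite T \<and> S \<subseteq> fideal F T)"

lemma noetherian_sequence:
  assumes "noetherian F" "\<And>n::nat. f n \<in> F"
  shows "\<exists>n. f n \<in> fideal F (f ` {..<n})"
proof -
  have "range f \<subseteq> F" using assms(2) by blast
  then obtain T where T: "T \<subseteq> range f" "finite T" "range f \<subseteq> fideal F T"
    using assms(1)[unfolded noetherian_def, rule_format, of "range f"] by auto
  obtain A where A: "finite A" "T = f ` A" using finite_subset_image[OF T(2,1)] by blast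
  obtain n where "A \<subseteq> {..<n}" using A(1) finite_nat_iff_bounded by blast
  then have "T \<subseteq> f ` {..<n}" using A(2) by blast
  moreover have "f n \<in> fideal F T" using T(3) by blast
  ultimately have "f n \<in> fideal F (f ` {..<n})" by (rule fideal_mono[rotated])
  then show ?thesis by (rule exI)
qed

lemma noetherian_const: "noetherian (polyfun {} :: ((nat \<Rightarrow> 'k::field) \<Rightarrow> 'k) set)"
  unfolding noetherian_def
proof (intro allI impI)
  let ?F = "polyfun {} :: ((nat \<Rightarrow> 'k) \<Rightarrow> 'k) set"
  fix S assume S: "S \<subseteq> ?F"
  have c: "\<exists>c. f = (\<lambda>e. c)" if "f \<in> ?F" for f
    using polyfun_cong[OF that] by (intro exI[of _ "f (\<lambda>_. 0)"]) auto
  show "\<exists>T\<subseteq>S. finite T \<and> S \<subseteq> fideal ?F T"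
  proof (cases "\<exists>s\<in>S. s \<noteq> (\<lambda>e. 0)")
    case True
    then obtain s where s: "s \<in> S" "s \<noteq> (\<lambda>e. 0)" by blast
    then obtain a where a: "s = (\<lambda>e. a)" "a \<noteq> 0" using c S by blast
    have "f \<in> fideal ?F {s}" if f: "f \<in> S" for f
    proof -
      obtain b where b: "f = (\<lambda>e. b)" using c S f by blast
      have "(\<lambda>e. (b / a) * s e) \<in> fideal ?F {s}"
        by (intro fideal_mult funring_polyfun fideal_gen polyfun_const) auto
      then show ?thesis using a b by simp
    qed
    then show ?thesis using s by (intro exI[of _ "{s}"]) auto
  next
    case False
    then have "S \<subseteq> fideal ?F {}" using fideal.zero[of ?F "{}"] by auto
    then show ?thesis by blast
  qed
qed

text \<open>\<open>d\<close> and \<open>a\<close> are data of a chosen representation in powers of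
  the last variable. \<open>a (d - 1)\<close> acts as leading coefficient, and minimality of
  \<open>d\<close> replaces the notion of degree.\<close>

definition truncated :: "nat \<Rightarrow> nat \<Rightarrow> (nat \<Rightarrow> (nat \<Rightarrow> 'k::comm_ring_1) \<Rightarrow> 'k) \<Rightarrow> (nat \<Rightarrow> 'k) \<Rightarrow> 'k" where
  "truncated n d a e = (\<Sum>i<d. a i e * e n ^ i)"

lemma polyfun_truncated:
  assumes "f \<in> polyfun {..<Suc n}"
  shows "\<exists>d a. (\<forall>i. a i \<in> polyfun {..<n}) \<and> f = truncated n d a"
proof -
  obtain p where p: "p \<in> fpoly (polyfun ({..<Suc n} - {n}))" "\<And>e x. f (e(n := x)) = poly (p e) x"
    using polyfun_univariate[OF assms] by blast
  obtain d where d: "\<And>e. degree (p e) \<le> d" using fpoly_degree[OF p(1)] by blast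
  have "f e = truncated n (Suc d) (\<lambda>i e. coeff (p e) i) e" for e
  proof -
    have "f e = f (e(n := e n))" by simp
    also have "\<dots> = poly (p e) (e n)" by (rule p(2))
    finally have "f e = (\<Sum>i\<le>d. coeff (p e) i * e n ^ i)" by (simp add: poly_bounded_degree[OF d])
    then show ?thesis by (simp add: truncated_def lessThan_Suc_atMost)
  qed
  moreover have "{..<Suc n} - {n} = {..<n}" by auto
  ultimately show ?thesis using fpoly_coeff[OF p(1)] by (intro exI[of _ "Suc d"] exI conjI) auto
qed

text \<open>The classical argument by minimal degree: from a non-finitely generated ideal choose
  elements \<open>f k\<close> of least length outside the ideal of the earlier ones. Some leading
  coefficient is a combination of earlier ones, and subtracting the corresponding combination of the
  \<open>f k\<close> contradicts minimality.\<close>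

lemma noetherian_Suc:
  assumes "noetherian (polyfun {..<n} :: ((nat \<Rightarrow> 'k::comm_ring_1) \<Rightarrow> 'k) set)"
  shows "noetherian (polyfun {..<Suc n} :: ((nat \<Rightarrow> 'k) \<Rightarrow> 'k) set)"
  unfolding noetherian_def
proof (intro allI impI)
  let ?F = "polyfun {..<n} :: ((nat \<Rightarrow> 'k) \<Rightarrow> 'k) set"
  let ?G = "polyfun {..<Suc n} :: ((nat \<Rightarrow> 'k) \<Rightarrow> 'k) set"
  have F: "funring ?F" and G: "funring ?G" by (rule funring_polyfun)+
  have FG: "?F \<subseteq> ?G" by (rule polyfun_subset) auto
  fix S assume S: "S \<subseteq> ?G"
  define J where "J = fideal ?G S"
  have JG: "f \<in> ?G" if "f \<in> J" for f
    using that unfolding J_def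
    by induction (use S in \<open>auto intro!: funring_0[OF G] funring_add[OF G] funring_mult[OF G]\<close>)
  have "\<exists>T\<subseteq>J. finite T \<and> J \<subseteq> fideal ?G T"
  proof (rule ccontr)
    assume contra: "\<not> ?thesis"
    define cand where "cand = (\<lambda>T d f a. f \<in> J - fideal ?G T \<and> (\<forall>i. a i \<in> ?F) \<and> f = truncated n d a)"
    define D where "D = (\<lambda>T. LEAST d. \<exists>f a. cand T d f a)"
    have ex: "\<exists>d f a. cand T d f a" if T: "finite T" "T \<subseteq> J" for T
    proof -
      obtain f where "f \<in> J - fideal ?G T" using contra T by blast
      then show ?thesis using polyfun_truncated[of f n] JG[of f] unfolding cand_def by blast
    qed
    have least: "\<exists>f a. cand T (D T) f a" if "finite T" "T \<subseteq> J" for T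
      unfolding D_def using ex[OF that] by (rule LeastI_ex)
    have least_le: "D T \<le> d" if "cand T d f a" for T d f a
      unfolding D_def by (rule Least_le) (use that in blast)
    define fa where "fa = (\<lambda>T. SOME p. cand T (D T) (fst p) (snd p))"
    have fa: "cand T (D T) (fst (fa T)) (snd (fa T))" if "finite T" "T \<subseteq> J" for T
    proof -
      have "\<exists>p. cand T (D T) (fst p) (snd p)" using least[OF that] by auto
      then show ?thesis unfolding fa_def by (rule someI_ex)
    qed
    define Ts where "Ts = rec_nat {} (\<lambda>_ T. insert (fst (fa T)) T)"
    have Ts: "Ts 0 = {}" "Ts (Suc k) = insert (fst (fa (Ts k))) (Ts k)" for k by (simp_all add: Ts_def)
    have TsJ: "finite (Ts k) \<and> Ts k \<subseteq> J" for k
    proof (induction k)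
      case (Suc k)
      then show ?case using fa[of "Ts k"] by (auto simp: Ts cand_def)
    qed (simp add: Ts)
    define f a d where "f = (\<lambda>k. fst (fa (Ts k)))" and "a = (\<lambda>k. snd (fa (Ts k)))" and "d = (\<lambda>k. D (Ts k))"
    have cand: "cand (Ts k) (d k) (f k) (a k)" for k
      using fa[of "Ts k"] TsJ[of k] by (simp add: f_def a_def d_def)
    have Ts_mono: "Ts k \<subseteq> Ts l" if "k \<le> l" for k l
      using that by (induction rule: dec_induct) (auto simp: Ts)
    have fTs: "f k \<in> Ts l" if "k < l" for k l
      using Ts_mono[of "Suc k" l] that by (auto simp: Ts f_def)
    have d_mono: "d k \<le> d l" if "k \<le> l" for k l
    proof -
      have "cand (Ts k) (d l) (f l) (a l)"
        using cand[of l] fideal_mono[OF _ Ts_mono[OF that]] unfolding cand_def by blast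
      then show ?thesis by (simp add: least_le d_def)
    qed
    have d_pos: "d k > 0" for k
    proof (rule ccontr)
      assume "\<not> d k > 0"
      then have "f k = (\<lambda>e. 0)" using cand[of k] by (simp add: cand_def truncated_def[abs_def])
      then show False using cand[of k] fideal.zero[of ?G "Ts k"] by (simp add: cand_def)
    qed
    define b where "b = (\<lambda>k. a k (d k - 1))"
    have "b k \<in> ?F" for k using cand[of k] by (simp add: b_def cand_def)
    then obtain m where m: "b m \<in> fideal ?F (b ` {..<m})"
      using noetherian_sequence[OF assms] by blast
    \<comment> \<open>Every combination \<open>c\<close> of earlier leading coefficients is the
      leading coefficient of some \<open>h\<close> of length exactly \<open>d m\<close> in the ideal
      of the earlier elements.\<close>
    have "\<exists>h a'. h \<in> fideal ?G (Ts m) \<and> h \<in> J \<and> (\<forall>i. a' i \<in> ?F) \<and> h = truncated n (d m) a' \<and> a' (d m - 1) = c"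
      if "c \<in> fideal ?F (b ` {..<m})" for c
      using that
    proof induction
      case zero
      have "(\<lambda>e. 0) = truncated n (d m) (\<lambda>i e. 0 :: 'k)" by (simp add: truncated_def[abs_def])
      moreover have "(\<lambda>e. 0) \<in> fideal ?G (Ts m)" "(\<lambda>e. 0) \<in> J" unfolding J_def by (rule fideal.zero)+
      moreover have "\<forall>i::nat. (\<lambda>e. 0) \<in> ?F" using funring_0[OF F] by blast
      ultimately show ?case
        by (intro exI[of _ "\<lambda>e. 0"] exI[of _ "\<lambda>i e. 0"] conjI refl)
    next
      case (step g c s)
      then obtain k where k: "k < m" "s = b k" by blast
      obtain h a' where h: "h \<in> fideal ?G (Ts m)" "h \<in> J" "\<forall>i. a' i \<in> ?F" "h = truncated n (d m) a'"
        "a' (d m - 1) = g" using step.IH by blast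
      \<comment> \<open>Multiplication by the \<open>t\<close>-th power of the last variable raises
        the length of \<open>f k\<close> to \<open>d m\<close>; the lengths are nondecreasing by
        minimality.\<close>
      define t where "t = d m - d k"
      have dk: "d m = d k + t" using d_mono[of k m] k(1) by (simp add: t_def)
      define u where "u = (\<lambda>e::nat \<Rightarrow> 'k. c e * e n ^ t)"
      have uG: "u \<in> ?G"
        unfolding u_def using step.hyps(2) FG
        by (intro funring_mult[OF G] funring_power[OF G] polyfun_var) auto
      define a'' where "a'' = (\<lambda>i e. a' i e + (if i < t then 0 else c e * a k (i - t) e))"
      have a'': "a'' i \<in> ?F" for i
        unfolding a''_def using h(3) step.hyps(2) cand[of k]
        by (cases "i < t") (auto simp: cand_def intro!: funring_add[OF F] funring_mult[OF F])
      have "(\<lambda>e. h e + u e * f k e) = truncated n (d m) a''"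
      proof (rule ext)
        fix e
        have "u e * f k e = (\<Sum>i<d k. c e * a k i e * e n ^ (i + t))"
          using cand[of k] unfolding cand_def u_def
          by (simp add: truncated_def sum_distrib_left power_add mult.commute mult.left_commute)
        also have "\<dots> = (\<Sum>i\<in>{t..<d k + t}. c e * a k (i - t) e * e n ^ i)"
          using sum.shift_bounds_nat_ivl[of "\<lambda>i. c e * a k (i - t) e * e n ^ i" 0 t "d k"]
          by (simp add: lessThan_atLeast0)
        also have "\<dots> = (\<Sum>i<d m. (if i < t then 0 else c e * a k (i - t) e) * e n ^ i)"
          unfolding dk by (rule sum.mono_neutral_cong_left) auto
        finally show "h e + u e * f k e = truncated n (d m) a'' e"
          by (simp add: h(4) truncated_def a''_def distrib_right sum.distrib)
      qed
      moreover have "(\<lambda>e. h e + u e * f k e) \<in> fideal ?G (Ts m)"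
        by (intro fideal.step h(1) uG fTs k(1))
      moreover have "(\<lambda>e. h e + u e * f k e) \<in> J"
        unfolding J_def using h(2) cand[of k]
        by (intro fideal_add fideal_mult[OF G] uG) (auto simp: J_def cand_def)
      moreover have "a'' (d m - 1) = (\<lambda>e. g e + c e * s e)"
        using d_pos[of k] h(5) by (auto simp: a''_def dk k(2) b_def)
      ultimately show ?case using a'' by (intro exI[of _ "\<lambda>e. h e + u e * f k e"] exI[of _ a'']) auto
    qed
    from this[OF m] obtain h a' where h: "h \<in> fideal ?G (Ts m)" "h \<in> J" "\<forall>i. a' i \<in> ?F"
      "h = truncated n (d m) a'" "a' (d m - 1) = b m" by blast
    have neg: "(\<lambda>e. - x e) \<in> fideal ?G T" if "x \<in> fideal ?G T" for x T
      using fideal_mult[OF G that polyfun_const[of "- 1"]] by simp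
    \<comment> \<open>The leading terms cancel, so \<open>f'\<close> has a representation of length
      \<open>d m - 1\<close> while still lying outside the ideal.\<close>
    define f' where "f' = (\<lambda>e. f m e + - h e)"
    have "f' \<in> J"
      unfolding f'_def J_def using cand[of m] h(2) by (intro fideal_add neg) (auto simp: cand_def J_def)
    moreover have "f' \<notin> fideal ?G (Ts m)"
    proof
      assume "f' \<in> fideal ?G (Ts m)"
      from fideal_add[OF this h(1)] show False using cand[of m] by (simp add: f'_def cand_def)
    qed
    moreover have "f' = truncated n (d m - 1) (\<lambda>i e. a m i e + - a' i e)"
    proof (rule ext)
      fix e
      obtain d' where d': "d m = Suc d'" using d_pos[of m] gr0_implies_Suc by blast
      have "f m e = truncated n (d m) (a m) e" using cand[of m] by (simp add: cand_def)
      moreover have "a' d' = a m d'" using h(5) by (simp add: b_def d')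
      ultimately show "f' e = truncated n (d m - 1) (\<lambda>i e. a m i e + - a' i e) e"
        by (simp add: f'_def h(4) truncated_def d' left_diff_distrib sum_subtractf)
    qed
    moreover have "(\<lambda>e. a m i e + - a' i e) \<in> ?F" for i
      using cand[of m] h(3) by (intro funring_add[OF F] funring_minus[OF F]) (auto simp: cand_def)
    ultimately have "cand (Ts m) (d m - 1) f' (\<lambda>i e. a m i e + - a' i e)"
      unfolding cand_def by blast
    from least_le[OF this] show False using d_pos[of m] by (simp add: d_def)
  qed
  then obtain T where T: "T \<subseteq> J" "finite T" "J \<subseteq> fideal ?G T" by blast
  obtain T' where T': "T' \<subseteq> S" "finite T'" "T \<subseteq> fideal ?G T'"
    using fideal_finite_subset[OF T(2) T(1)[unfolded J_def]] by auto
  have "S \<subseteq> fideal ?G T'"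
  proof
    fix s assume "s \<in> S"
    then have "s \<in> J" unfolding J_def by (rule fideal_gen[OF G])
    then have "s \<in> fideal ?G T" using T(3) by (rule rev_subsetD)
    then show "s \<in> fideal ?G T'" by (rule fideal_trans[OF G _ T'(3)])
  qed
  then show "\<exists>T\<subseteq>S. finite T \<and> S \<subseteq> fideal ?G T" using T' by blast
qed

lemma noetherian_polyfun: "noetherian (polyfun {..<n} :: ((nat \<Rightarrow> 'k::field) \<Rightarrow> 'k) set)"
  by (induction n) (simp_all add: noetherian_const noetherian_Suc)

lemma closed_subvariety_finite:
  fixes V :: "'k::field list set"
  assumes "closed_subvariety N V"
  shows "\<exists>P\<subseteq>polyfun {..<N}. finite P \<and> V = zeros N P"
proof -
  obtain P where P: "P \<subseteq> polyfun {..<N}" "V = zeros N P"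
    using assms unfolding closed_subvariety_iff_zeros by blast
  obtain T where T: "T \<subseteq> P" "finite T" "P \<subseteq> fideal (polyfun {..<N}) T"
    using noetherian_polyfun[unfolded noetherian_def, rule_format, OF P(1)] by auto
  have "zeros N T \<subseteq> zeros N P"
  proof
    fix x assume x: "x \<in> zeros N T"
    have "p ((!) x) = 0" if "p \<in> P" for p
      using T(3) that x by (intro fideal_vanish[of p _ T]) (auto simp: zeros_def)
    then show "x \<in> zeros N P" using x by (simp add: zeros_def)
  qed
  moreover have "zeros N P \<subseteq> zeros N T" using T(1) unfolding zeros_def by blast
  ultimately show ?thesis using T(1,2) P by (intro exI[of _ T]) auto
qed

text \<open>Along a descending chain choose \<open>f i\<close> vanishing on the next set but not on
  the present one. Some \<open>f n\<close> is a combination of its predecessors, all of which vanish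
  on \<open>V n\<close>.\<close>

lemma wf_closed_subvariety:
  "wf {(A, B). closed_subvariety N A \<and> closed_subvariety N B \<and> A \<subset> (B :: 'k::field list set)}"
  unfolding wf_iff_no_infinite_down_chain
proof
  assume "\<exists>f. \<forall>i. (f (Suc i), f i) \<in> {(A, B). closed_subvariety N A \<and> closed_subvariety N B \<and> A \<subset> (B :: 'k list set)}"
  then obtain V where V: "\<And>i. closed_subvariety N (V i)" "\<And>i. V (Suc i) \<subset> (V i :: 'k list set)"
    by blast
  have "\<exists>f\<in>polyfun {..<N}. (\<forall>x\<in>V (Suc i). f ((!) x) = 0) \<and> (\<exists>x\<in>V i. f ((!) x) \<noteq> 0)" for i
  proof -
    obtain P where P: "P \<subseteq> polyfun {..<N}" "V (Suc i) = zeros N P"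
      using V(1) unfolding closed_subvariety_iff_zeros by blast
    obtain x where x: "x \<in> V i" "x \<notin> V (Suc i)" using V(2) by blast
    have "length x = N" using V(1)[of i] x(1) unfolding closed_subvariety_def by blast
    then obtain f where "f \<in> P" "f ((!) x) \<noteq> 0" using x(2) unfolding P(2) zeros_def by blast
    then show ?thesis using P x(1) by (intro bexI[of _ f]) (auto simp: zeros_def)
  qed
  then obtain f where f: "\<And>i. f i \<in> polyfun {..<N}" "\<And>i x. x \<in> V (Suc i) \<Longrightarrow> f i ((!) x) = 0"
    "\<And>i. \<exists>x\<in>V i. f i ((!) x) \<noteq> 0" by metis
  obtain n where n: "f n \<in> fideal (polyfun {..<N}) (f ` {..<n})"
    using noetherian_sequence[of "polyfun {..<N}" f, OF noetherian_polyfun f(1)] by blast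
  have anti: "V j \<subseteq> V i" if "i \<le> j" for i j
    using that by (induction rule: dec_induct) (use V(2) in blast)+
  have "f n ((!) x) = 0" if "x \<in> V n" for x
  proof (rule fideal_vanish[OF n])
    fix s assume "s \<in> f ` {..<n}"
    then obtain i where "i < n" "s = f i" by blast
    then show "s ((!) x) = 0" using f(2)[of x i] anti[of "Suc i" n] that by auto
  qed
  then show False using f(3) by blast
qed

section \<open>Dimension and independent coordinates\<close>

text \<open>A root \<open>t\<close> of X p(X) - 1 satisfies t p(t) = 1.\<close>

lemma ex_nonroot:
  fixes p :: "'k::alg_closed_field poly"
  assumes "p \<noteq> 0"
  shows "\<exists>t. poly p t \<noteq> 0"
proof -
  have "degree (pCons (- 1) p) > 0" using assms by simp
  then obtain t where "poly (pCons (- 1) p) t = 0" using alg_closed_imp_poly_has_root by blast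
  then have "t * poly p t = 1" by simp
  then show ?thesis by (intro exI[of _ t]) auto
qed

lemma polyfun_line:
  assumes "f \<in> polyfun I"
  shows "\<exists>p. \<forall>t. f (\<lambda>i. e i + t * d i) = poly p t"
  using assms
proof (induction rule: polyfun_induct)
  case (const c)
  show ?case by (rule exI[of _ "[:c:]"]) simp
next
  case (var i)
  show ?case by (rule exI[of _ "[:e i, d i:]"]) simp
next
  case (add f g)
  then obtain p q where pq: "\<And>t. f (\<lambda>i. e i + t * d i) = poly p t" "\<And>t. g (\<lambda>i. e i + t * d i) = poly q t"
    by blast
  show ?case by (rule exI[of _ "p + q"]) (simp add: pq)
next
  case (mult f g)
  then obtain p q where pq: "\<And>t. f (\<lambda>i. e i + t * d i) = poly p t" "\<And>t. g (\<lambda>i. e i + t * d i) = poly q t"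
    by blast
  show ?case by (rule exI[of _ "p * q"]) (simp add: pq)
qed

text \<open>On the line through \<open>a\<close> and \<open>b\<close> both functions become nonzero
  univariate polynomials, whose product has a nonroot.\<close>

lemma polyfun_no_zero_divisors:
  fixes f g :: "(nat \<Rightarrow> 'k::alg_closed_field) \<Rightarrow> 'k"
  assumes "f \<in> polyfun I" "g \<in> polyfun I" "f a \<noteq> 0" "g b \<noteq> 0"
  shows "\<exists>e. f e * g e \<noteq> 0"
proof -
  let ?l = "\<lambda>t i. a i + t * (b i - a i)"
  obtain p where p: "\<And>t. f (?l t) = poly p t" using polyfun_line[OF assms(1), of a "\<lambda>i. b i - a i"] by auto
  obtain q where q: "\<And>t. g (?l t) = poly q t" using polyfun_line[OF assms(2), of a "\<lambda>i. b i - a i"] by auto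
  have "poly p 0 \<noteq> 0" "poly q 1 \<noteq> 0" using assms(3,4) p[of 0] q[of 1] by auto
  then have "p * q \<noteq> 0" by auto
  then obtain t where "poly (p * q) t \<noteq> 0" using ex_nonroot by blast
  then show ?thesis using p[of t] q[of t] by (intro exI[of _ "?l t"]) simp
qed

lemma polyfun_prod_nonzero:
  fixes f :: "'j \<Rightarrow> (nat \<Rightarrow> 'k::alg_closed_field) \<Rightarrow> 'k"
  assumes "finite A" "\<And>j. j \<in> A \<Longrightarrow> f j \<in> polyfun I" "\<And>j. j \<in> A \<Longrightarrow> \<exists>e. f j e \<noteq> 0"
  shows "\<exists>e. (\<Prod>j\<in>A. f j e) \<noteq> 0"
  using assms
proof (induction A rule: finite_induct)
  case (insert j A)
  then obtain a b where ab: "f j a \<noteq> 0" "(\<Prod>j\<in>A. f j b) \<noteq> 0" by blast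
  have "(\<lambda>e. \<Prod>j\<in>A. f j e) \<in> polyfun I"
    using insert by (intro funring_prod[OF funring_polyfun]) auto
  from polyfun_no_zero_divisors[of "f j" I, OF _ this ab] show ?case using insert by simp
qed auto

text \<open>Algebraic independence of the coordinates in \<open>I\<close> as functions on
  \<open>V\<close>; equivalently, the projection to the \<open>I\<close>-coordinates is
  dominant.\<close>

definition indep_coords :: "nat set \<Rightarrow> 'k::comm_ring_1 list set \<Rightarrow> bool" where
  "indep_coords I V \<longleftrightarrow> (\<forall>q\<in>polyfun I. (\<forall>x\<in>V. q ((!) x) = 0) \<longrightarrow> (\<forall>e. q e = 0))"

context acval
begin

text \<open>For the trivial valuation an atom depends only on which of its two polynomials vanish,
  and a polynomial is identically 0 or nonzero on a nonempty open set. Such open sets meet, so every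
  definable condition is constant on one of them.\<close>

lemma qf_generic:
  assumes "qf v (polyfun I) X" and v01: "\<And>x. x \<noteq> 0 \<Longrightarrow> v x = 1"
  shows "\<exists>h\<in>polyfun I. (\<exists>e. h e \<noteq> 0) \<and> (\<exists>b. \<forall>e. h e \<noteq> 0 \<longrightarrow> X e = b)"
  using assms(1)
proof induction
  case (atom X)
  then obtain f g where fg: "f \<in> polyfun I" "g \<in> polyfun I" "X = (\<lambda>e. v (f e) \<le> v (g e))"
    unfolding val_atoms_def by blast
  have const: "\<exists>h\<in>polyfun I. (\<exists>e. h e \<noteq> 0) \<and> (\<exists>b. \<forall>e. h e \<noteq> 0 \<longrightarrow> (f e = 0) = b)"
    if "f \<in> polyfun I" for f :: "(nat \<Rightarrow> 'k) \<Rightarrow> 'k"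
  proof (cases "\<exists>e. f e \<noteq> 0")
    case True
    then show ?thesis using that by (intro bexI[of _ f] conjI exI[of _ False]) auto
  next
    case False
    then show ?thesis
      by (intro bexI[of _ "\<lambda>e. 1"] conjI exI[of _ True]) (auto intro: polyfun_const)
  qed
  obtain h b h' b' where h: "h \<in> polyfun I" "\<exists>e. h e \<noteq> 0" "\<forall>e. h e \<noteq> 0 \<longrightarrow> (f e = 0) = b"
    and h': "h' \<in> polyfun I" "\<exists>e. h' e \<noteq> 0" "\<forall>e. h' e \<noteq> 0 \<longrightarrow> (g e = 0) = b'"
    using const[OF fg(1)] const[OF fg(2)] by blast
  have "\<exists>e. h e * h' e \<noteq> 0"
    using polyfun_no_zero_divisors[OF h(1) h'(1)] h(2) h'(2) by blast
  moreover have "v x \<le> v y \<longleftrightarrow> x = 0 \<or> y \<noteq> 0" for x y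
    using v01[of x] v01[of y] by (cases "x = 0"; cases "y = 0") (auto simp: zero_le_value le_0_iff_value)
  then have "\<forall>e. h e * h' e \<noteq> 0 \<longrightarrow> X e = (b \<or> \<not> b')" using h(3) h'(3) unfolding fg(3) by auto
  ultimately show ?case
    using polyfun_mult[OF h(1) h'(1)] by (intro bexI[of _ "\<lambda>e. h e * h' e"]) blast+
next
  case true
  show ?case by (rule bexI[of _ "\<lambda>e. 1"]) (auto intro: polyfun_const)
next
  case (neg X)
  then show ?case by blast
next
  case (conj X Y)
  then obtain h b h' b' where h: "h \<in> polyfun I" "\<exists>e. h e \<noteq> 0" "\<forall>e. h e \<noteq> 0 \<longrightarrow> X e = b"
    and h': "h' \<in> polyfun I" "\<exists>e. h' e \<noteq> 0" "\<forall>e. h' e \<noteq> 0 \<longrightarrow> Y e = b'" by blast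
  have "\<exists>e. h e * h' e \<noteq> 0"
    using polyfun_no_zero_divisors[OF h(1) h'(1)] h(2) h'(2) by blast
  then show ?case
    using h h' polyfun_mult[OF h(1) h'(1)]
    by (intro bexI[of _ "\<lambda>e. h e * h' e"] conjI exI[of _ "b \<and> b'"]) auto
qed

lemma qf_project:
  assumes "finite J" "qf v (polyfun A) X"
  shows "qf v (polyfun (A - J)) (\<lambda>e. \<exists>e'. (\<forall>i. i \<notin> J \<longrightarrow> e' i = e i) \<and> X e')"
  using assms
proof (induction J rule: finite_induct)
  case empty
  have "(\<exists>e'. (\<forall>i. e' i = e i) \<and> X e') \<longleftrightarrow> X e" for e by (metis ext)
  then show ?case using empty by simp
next
  case (insert j J)
  have "A - J - {j} = A - insert j J" by auto
  moreover have "(\<exists>x e'. (\<forall>i. i \<notin> J \<longrightarrow> e' i = (e(j := x)) i) \<and> X e') \<longleftrightarrow>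
      (\<exists>e'. (\<forall>i. i \<notin> insert j J \<longrightarrow> e' i = e i) \<and> X e')" for e
  proof
    assume "\<exists>e'. (\<forall>i. i \<notin> insert j J \<longrightarrow> e' i = e i) \<and> X e'"
    then obtain e' where "\<forall>i. i \<notin> insert j J \<longrightarrow> e' i = e i" "X e'" by blast
    then show "\<exists>x e'. (\<forall>i. i \<notin> J \<longrightarrow> e' i = (e(j := x)) i) \<and> X e'"
      by (intro exI[of _ "e' j"] exI[of _ e']) auto
  next
    assume "\<exists>x e'. (\<forall>i. i \<notin> J \<longrightarrow> e' i = (e(j := x)) i) \<and> X e'"
    then obtain x e' where "\<forall>i. i \<notin> J \<longrightarrow> e' i = (e(j := x)) i" "X e'" by blast
    then show "\<exists>e'. (\<forall>i. i \<notin> insert j J \<longrightarrow> e' i = e i) \<and> X e'"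
      by (intro exI[of _ e']) auto
  qed
  ultimately show ?case
    using qf_polyfun_ex[OF insert.IH[OF insert.prems], of j] by simp
qed

end

text \<open>Quantifier elimination for the trivial valuation gives Chevalley's theorem.\<close>

lemma (in acval) dominant_projection:
  assumes V: "closed_subvariety N (V :: 'k list set)" and I: "I \<subseteq> {..<N}" and indep: "indep_coords I V"
  shows "\<exists>h\<in>polyfun I. (\<exists>e. h e \<noteq> 0) \<and> (\<forall>e. h e \<noteq> 0 \<longrightarrow> (\<exists>x\<in>V. \<forall>i\<in>I. x ! i = e i))"
proof -
  \<comment> \<open>The value sort is kept, since \<open>acval\<close> does not ask the valuation to
    be onto.\<close>
  define w where "w = (\<lambda>x::'k. if x = 0 then 0 else 1 :: 'g)"
  interpret w: acval w
    by unfold_locales (auto simp: w_def zero_le_value max_def)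
  obtain P where P: "P \<subseteq> polyfun {..<N}" "finite P" "V = zeros N P"
    using closed_subvariety_finite[OF V] by blast
  have "qf w (polyfun {..<N}) (\<lambda>e. \<forall>p\<in>P. p e = 0)"
    using P by (intro boolc_ball w.qf_eq_0 funring_polyfun) auto
  from w.qf_project[OF _ this, of "{..<N} - I"]
  have "qf w (polyfun ({..<N} - ({..<N} - I)))
      (\<lambda>e. \<exists>e'. (\<forall>i. i \<notin> {..<N} - I \<longrightarrow> e' i = e i) \<and> (\<forall>p\<in>P. p e' = 0))" by simp
  moreover have "{..<N} - ({..<N} - I) = I" using I by auto
  ultimately obtain h b where h: "h \<in> polyfun I" "\<exists>e. h e \<noteq> 0"
    "\<forall>e. h e \<noteq> 0 \<longrightarrow> (\<exists>e'. (\<forall>i. i \<notin> {..<N} - I \<longrightarrow> e' i = e i) \<and> (\<forall>p\<in>P. p e' = 0)) = b"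
    using w.qf_generic[of I "\<lambda>e. \<exists>e'. (\<forall>i. i \<notin> {..<N} - I \<longrightarrow> e' i = e i) \<and> (\<forall>p\<in>P. p e' = 0)"]
    unfolding w_def by auto
  \<comment> \<open>Independence prevents \<open>h\<close> from vanishing on \<open>V\<close>; this
    point shows that the generic truth value is \<open>True\<close>.\<close>
  obtain x where x: "x \<in> V" "h ((!) x) \<noteq> 0"
    using indep h(1,2) unfolding indep_coords_def by blast
  have "\<forall>p\<in>P. p ((!) x) = 0" using x(1) unfolding P(3) zeros_def by blast
  then have b: "b = True" using h(3) x(2) by blast
  have "\<exists>x\<in>V. \<forall>i\<in>I. x ! i = e i" if e: "h e \<noteq> 0" for e
  proof -
    obtain e' where e': "\<And>i. i \<notin> {..<N} - I \<Longrightarrow> e' i = e i" "\<And>p. p \<in> P \<Longrightarrow> p e' = 0"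
      using h(3) e b by blast
    define x where "x = map e' [0..<N]"
    have xi: "x ! i = e' i" if "i < N" for i using that by (simp add: x_def)
    have "p ((!) x) = 0" if "p \<in> P" for p
      using polyfun_cong[of p "{..<N}" "(!) x" e'] P(1) that e'(2) xi by auto
    then have "x \<in> V" unfolding P(3) zeros_def by (simp add: x_def)
    moreover have "\<forall>i\<in>I. x ! i = e i" using I xi e'(1) by auto
    ultimately show ?thesis by blast
  qed
  then show ?thesis using h(1,2) by blast
qed

text \<open>A minimal closed subset keeping the independence is irreducible: for a proper
  decomposition, nonzero polynomials vanishing on the two pieces would have a nonzero product
  vanishing on the whole.\<close>

lemma minimal_irreducible:
  fixes V :: "'k::alg_closed_field list set"
  assumes "closed_subvariety N V" "indep_coords I V"
  shows "\<exists>Z. irreducible_subvariety N Z \<and> Z \<subseteq> V \<and> indep_coords I Z"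
proof -
  let ?Q = "{Z. closed_subvariety N Z \<and> Z \<subseteq> V \<and> indep_coords I Z}"
  obtain Z where Z: "Z \<in> ?Q"
    "\<And>Y. (Y, Z) \<in> {(A, B). closed_subvariety N A \<and> closed_subvariety N B \<and> A \<subset> B} \<Longrightarrow> Y \<notin> ?Q"
    using wfE_min[OF wf_closed_subvariety, of V ?Q] assms by blast
  have "Z \<noteq> {}"
    using Z(1) polyfun_const[of 1 I] unfolding indep_coords_def by force
  moreover have "Z = A \<or> Z = B" if AB: "closed_subvariety N A" "closed_subvariety N B" "Z = A \<union> B" for A B
  proof (rule ccontr)
    assume "\<not> ?thesis"
    then have "A \<subset> Z" "B \<subset> Z" using AB(3) by auto
    then have "\<not> indep_coords I A" "\<not> indep_coords I B"
      using Z(2)[of A] Z(2)[of B] Z(1) AB by auto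
    then obtain f a g b where "f \<in> polyfun I" "\<forall>x\<in>A. f ((!) x) = 0" "f a \<noteq> 0"
      and "g \<in> polyfun I" "\<forall>x\<in>B. g ((!) x) = 0" "g b \<noteq> 0"
      unfolding indep_coords_def by blast
    then have fg: "\<forall>x\<in>Z. f ((!) x) * g ((!) x) = 0" "(\<lambda>e. f e * g e) \<in> polyfun I"
      "\<exists>e. f e * g e \<noteq> 0"
      using AB(3) polyfun_no_zero_divisors[of f I g a b] by (auto intro: polyfun_mult)
    have "indep_coords I Z" using Z(1) by blast
    from this[unfolded indep_coords_def, rule_format, OF fg(2)] fg(1,3) show False by blast
  qed
  ultimately show ?thesis using Z(1) unfolding irreducible_subvariety_def by blast
qed

lemma (in acval) irreducible_chain:
  assumes "finite I" "I \<subseteq> {..<N}" "closed_subvariety N (V :: 'k list set)" "indep_coords I V"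
  shows "\<exists>Z. (\<forall>i\<le>card I. irreducible_subvariety N (Z i) \<and> Z i \<subseteq> V) \<and> (\<forall>i<card I. Z i \<subset> Z (Suc i))"
  using assms
proof (induction I arbitrary: V rule: finite_induct)
  case empty
  then obtain Z where "irreducible_subvariety N Z" "Z \<subseteq> V" using minimal_irreducible[of N V "{}"] by blast
  then show ?case by (intro exI[of _ "\<lambda>_. Z"]) auto
next
  case (insert i I)
  let ?I = "insert i I"
  obtain Z where Z: "irreducible_subvariety N Z" "Z \<subseteq> V" "indep_coords ?I Z"
    using minimal_irreducible[OF insert.prems(2,3)] by blast
  have Zc: "closed_subvariety N Z" using Z(1) unfolding irreducible_subvariety_def by blast
  obtain h e0 where h: "h \<in> polyfun ?I" "h e0 \<noteq> 0"
    "\<And>e. h e \<noteq> 0 \<Longrightarrow> \<exists>x\<in>Z. \<forall>i\<in>?I. x ! i = e i"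
    using dominant_projection[OF Zc insert.prems(1) Z(3)] by blast
  \<comment> \<open>With this constant \<open>h\<close> does not vanish identically on the
    hyperplane, so the section still has points over a nonempty open set of the remaining
    coordinates.\<close>
  define c where "c = e0 i"
  define Y where "Y = Z \<inter> {x. x ! i - c = 0}"
  have iN: "i < N" "I \<subseteq> {..<N}" using insert.prems(1) by auto
  have lin: "(\<lambda>e. e i - c) \<in> polyfun A" if "i \<in> A" for A
    by (rule funring_diff[OF funring_polyfun polyfun_var[OF that] polyfun_const])
  have "closed_subvariety N Y"
    unfolding Y_def using closed_subvariety_Int_zeros[OF Zc lin[of "{..<N}"]] iN by simp
  moreover have "indep_coords I Y"
    unfolding indep_coords_def
  proof (intro ballI impI)
    fix q assume q: "q \<in> polyfun I" "\<forall>x\<in>Y. q ((!) x) = 0"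
    show "\<forall>e. q e = 0"
    proof (rule ccontr)
      assume "\<not> (\<forall>e. q e = 0)"
      then obtain e1 where e1: "q e1 \<noteq> 0" by blast
      define h' where "h' = (\<lambda>e. h (e(i := c)))"
      obtain d where "pfd ?I d h" using h(1) unfolding polyfun_def by blast
      then have "pfd UNIV d h'"
        unfolding h'_def
      proof (rule pfd_compose)
        show "pfd UNIV 1 (\<lambda>e. (e(i := c)) j)" for j
          by (cases "j = i") (auto intro: pfd.const pfd.var)
      qed
      then have "h' \<in> polyfun UNIV" by (rule polyfunI)
      moreover have "q \<in> polyfun UNIV" using q(1) polyfun_subset[of I UNIV] by blast
      moreover have "h' e0 \<noteq> 0" using h(2) by (simp add: h'_def c_def)
      ultimately obtain e where e: "q e * h' e \<noteq> 0"
        using polyfun_no_zero_divisors e1 by metis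
      then obtain x where x: "x \<in> Z" "\<forall>j\<in>?I. x ! j = (e(i := c)) j"
        using h(3)[of "e(i := c)"] by (auto simp: h'_def)
      then have "x \<in> Y" by (simp add: Y_def)
      then have "q ((!) x) = 0" using q(2) by blast
      moreover have "q ((!) x) = q e"
        by (rule polyfun_cong[OF q(1)]) (use x(2) insert.hyps(2) in auto)
      ultimately show False using e by simp
    qed
  qed
  ultimately have "\<exists>Z'. (\<forall>j\<le>card I. irreducible_subvariety N (Z' j) \<and> Z' j \<subseteq> Y) \<and>
      (\<forall>j<card I. Z' j \<subset> Z' (Suc j))" by (rule insert.IH[OF iN(2)])
  then obtain Z' where Z': "\<forall>j\<le>card I. irreducible_subvariety N (Z' j) \<and> Z' j \<subseteq> Y"
    "\<forall>j<card I. Z' j \<subset> Z' (Suc j)"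
    by blast
  have "Y \<subset> Z"
  proof -
    have "Y \<noteq> Z"
    proof
      assume "Y = Z"
      then have "\<forall>x\<in>Z. x ! i - c = 0" unfolding Y_def by blast
      then have "e i - c = 0" for e
        using Z(3)[unfolded indep_coords_def, rule_format, OF lin[of ?I]] by blast
      from this[of "\<lambda>_. c + 1"] show False by simp
    qed
    then show ?thesis unfolding Y_def by blast
  qed
  then have Z'_sub: "Z' j \<subset> Z" "Z' j \<subseteq> V" if "j \<le> card I" for j
    using Z' Z(2) that by blast+
  moreover have "card ?I = Suc (card I)" using insert.hyps by simp
  ultimately show ?case
    using Z' Z(1,2)
    by (intro exI[of _ "Z'(Suc (card I) := Z)"]) (simp add: le_Suc_eq less_Suc_eq all_conj_distrib)
qed

section \<open>The Hilbert function\<close>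

interpretation fs: vector_space "\<lambda>(c :: 'k::field) (f :: 'b \<Rightarrow> 'k) x. c * f x"
  by unfold_locales (auto simp: fun_eq_iff algebra_simps)

text \<open>Exponents will be bounded one by one rather than in total; the box is easy to count and
  has the same order of growth.\<close>

definition box_monom :: "nat set \<Rightarrow> (nat \<Rightarrow> nat) \<Rightarrow> (nat \<Rightarrow> 'k::comm_ring_1) \<Rightarrow> 'k" where
  "box_monom I \<alpha> e = (\<Prod>i\<in>I. e i ^ \<alpha> i)"

lemma pfd_span_box_monom:
  fixes f :: "(nat \<Rightarrow> 'k::field) \<Rightarrow> 'k"
  assumes "finite I" "pfd I d f"
  shows "f \<in> fs.span {box_monom I \<alpha> | \<alpha>. \<forall>i\<in>I. \<alpha> i \<le> d}"
  using assms(2)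
proof induction
  case (const d c)
  have "(box_monom I (\<lambda>_. 0) :: (nat \<Rightarrow> 'k) \<Rightarrow> 'k) \<in> fs.span {box_monom I \<alpha> | \<alpha>. \<forall>i\<in>I. \<alpha> i \<le> d}"
    by (rule fs.span_base) force
  from fs.span_scale[OF this, of c] show ?case by (simp add: box_monom_def[of _ "\<lambda>_. 0"])
next
  case (var i d)
  have "(box_monom I (\<lambda>j. if j = i then 1 else 0) :: (nat \<Rightarrow> 'k) \<Rightarrow> 'k) \<in> fs.span {box_monom I \<alpha> | \<alpha>. \<forall>i\<in>I. \<alpha> i \<le> d}"
    using var by (intro fs.span_base) force
  moreover have "box_monom I (\<lambda>j. if j = i then 1 else 0) = (\<lambda>e::nat \<Rightarrow> 'k. e i)"
    unfolding box_monom_def using assms(1) var(1)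
    by (intro ext) (simp add: if_distrib[of "\<lambda>n. _ ^ n"] cong: if_cong)
  ultimately show ?case by (simp only:)
next
  case (add d f g)
  from fs.span_add[OF add.IH] show ?case by (simp add: plus_fun_def)
next
  case (mult a f b g d)
  let ?M = "\<lambda>d. {box_monom I \<alpha> :: (nat \<Rightarrow> 'k) \<Rightarrow> 'k | \<alpha>. \<forall>i\<in>I. \<alpha> i \<le> d}"
  have 1: "(\<lambda>e. m e * g e) \<in> fs.span (?M d)" if m: "m \<in> ?M a" for m
    using mult.IH(2)
  proof (induction rule: fs.span_induct_alt)
    case base
    show ?case using fs.span_zero by (simp add: zero_fun_def)
  next
    case (step c x y)
    obtain \<alpha> \<beta> where "m = box_monom I \<alpha>" "x = box_monom I \<beta>" "\<forall>i\<in>I. \<alpha> i \<le> a" "\<forall>i\<in>I. \<beta> i \<le> b"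
      using m step(1) by blast
    then have "(\<lambda>e. m e * x e) = box_monom I (\<lambda>i. \<alpha> i + \<beta> i)" "\<forall>i\<in>I. \<alpha> i + \<beta> i \<le> d"
      using mult.hyps(3) by (simp_all add: box_monom_def fun_eq_iff power_add prod.distrib) force
    then have "(\<lambda>e. m e * x e) \<in> fs.span (?M d)" by (intro fs.span_base) blast
    from fs.span_add[OF fs.span_scale[OF this, of c] step(2)]
    show ?case by (simp add: plus_fun_def algebra_simps)
  qed
  show ?case
    using mult.IH(1)
  proof (induction rule: fs.span_induct_alt)
    case base
    show ?case using fs.span_zero by (simp add: zero_fun_def)
  next
    case (step c x y)
    from fs.span_add[OF fs.span_scale[OF 1[OF step(1)], of c] step(2)]
    show ?case by (simp add: plus_fun_def algebra_simps)
  qed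
qed

lemma card_box_monom:
  assumes "finite I"
  shows "finite {box_monom I \<alpha> :: (nat \<Rightarrow> 'k::comm_ring_1) \<Rightarrow> 'k | \<alpha>. \<forall>i\<in>I. \<alpha> i \<le> d} \<and>
    card {box_monom I \<alpha> :: (nat \<Rightarrow> 'k::comm_ring_1) \<Rightarrow> 'k | \<alpha>. \<forall>i\<in>I. \<alpha> i \<le> d} \<le> Suc d ^ card I"
proof -
  let ?B = "PiE I (\<lambda>_. {..d})"
  have sub: "{box_monom I \<alpha> :: (nat \<Rightarrow> 'k::comm_ring_1) \<Rightarrow> 'k | \<alpha>. \<forall>i\<in>I. \<alpha> i \<le> d} \<subseteq> (box_monom I ` ?B :: ((nat \<Rightarrow> 'k) \<Rightarrow> 'k) set)"
  proof clarify
    fix \<alpha> assume "\<forall>i\<in>I. \<alpha> i \<le> d"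
    then have "restrict \<alpha> I \<in> ?B" by auto
    moreover have "box_monom I \<alpha> = box_monom I (restrict \<alpha> I)" by (simp add: box_monom_def fun_eq_iff)
    ultimately show "box_monom I \<alpha> \<in> (box_monom I ` ?B :: ((nat \<Rightarrow> 'k) \<Rightarrow> 'k) set)" by blast
  qed
  have fin: "finite ?B" using assms by (intro finite_PiE) auto
  have cardB: "card ?B = Suc d ^ card I" using assms by (simp add: card_PiE)
  have "card {box_monom I \<alpha> :: (nat \<Rightarrow> 'k::comm_ring_1) \<Rightarrow> 'k | \<alpha>. \<forall>i\<in>I. \<alpha> i \<le> d} \<le> card ((box_monom I ` ?B :: ((nat \<Rightarrow> 'k) \<Rightarrow> 'k) set))"
    by (rule card_mono[OF finite_imageI[OF fin] sub])
  also have "\<dots> \<le> card ?B" by (rule card_image_le[OF fin])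
  finally show ?thesis
    using finite_subset[OF sub finite_imageI[OF fin]] cardB by simp
qed

text \<open>Expand a nonzero polynomial vanishing on \<open>V\<close> in powers of the new
  coordinate and take the highest coefficient that is not identically 0. Its index is positive,
  since otherwise the coordinates in \<open>I\<close> would already be dependent.\<close>

lemma algebraic_relation:
  assumes I: "indep_coords I V" "\<not> indep_coords (insert j I) V" "j \<notin> I"
  shows "\<exists>l c. l > 0 \<and> (\<forall>i. c i \<in> polyfun I) \<and> (\<exists>e. c l e \<noteq> 0) \<and>
    (\<forall>x\<in>V. (\<Sum>i\<le>l. c i ((!) x) * x ! j ^ i) = 0)"
proof -
  obtain q e1 where q: "q \<in> polyfun (insert j I)" "\<forall>x\<in>V. q ((!) x) = 0" "q e1 \<noteq> 0"
    using I(2) unfolding indep_coords_def by blast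
  obtain p where "p \<in> fpoly (polyfun (insert j I - {j}))" and pq: "\<And>e x. q (e(j := x)) = poly (p e) x"
    using polyfun_univariate[OF q(1)] by blast
  then have p: "p \<in> fpoly (polyfun I)" using I(3) by simp
  obtain D where D: "\<And>e. degree (p e) \<le> D" using fpoly_degree[OF p] by blast
  define c where "c = (\<lambda>i e. coeff (p e) i)"
  have cI: "c i \<in> polyfun I" for i unfolding c_def by (rule fpoly_coeff[OF p])
  have qe: "q e = (\<Sum>i\<le>D. c i e * e j ^ i)" for e
    using pq[of e "e j"] by (simp add: poly_bounded_degree[OF D] c_def)
  define A where "A = {i. i \<le> D \<and> (\<exists>e. c i e \<noteq> 0)}"
  have finA: "finite A" by (simp add: A_def)
  have "A \<noteq> {}"
  proof
    assume "A = {}"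
    then have "c i e1 = 0" if "i \<le> D" for i using that by (auto simp: A_def)
    then show False using q(3) qe[of e1] by simp
  qed
  define l where "l = Max A"
  have l: "l \<in> A" unfolding l_def by (rule Max_in) fact+
  have above: "c i e = 0" if "l < i" "i \<le> D" for i e
    using Max_ge[OF finA, of i] that unfolding l_def[symmetric] by (auto simp: A_def)
  have qe': "q e = (\<Sum>i\<le>l. c i e * e j ^ i)" for e
    unfolding qe by (rule sum.mono_neutral_right) (use l above in \<open>auto simp: A_def not_le\<close>)
  have "l > 0"
  proof (rule ccontr)
    assume "\<not> l > 0"
    then have "q e = c 0 e" for e by (simp add: qe')
    then have "\<forall>x\<in>V. c 0 ((!) x) = 0" "c 0 e1 \<noteq> 0" using q(2,3) by auto
    then show False using I(1)[unfolded indep_coords_def, rule_format, OF cI[of 0]] by blast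
  qed
  moreover have "(\<Sum>i\<le>l. c i ((!) x) * x ! j ^ i) = 0" if "x \<in> V" for x
    using q(2) that by (simp add: qe')
  ultimately show ?thesis using cI l unfolding A_def by blast
qed

text \<open>Extension by 0 lets the restrictions to an open set and to its complement be added as
  functions on one domain.\<close>

definition restr :: "'k list set \<Rightarrow> ((nat \<Rightarrow> 'k) \<Rightarrow> 'k) \<Rightarrow> 'k list \<Rightarrow> 'k::zero" where
  "restr W f x = (if x \<in> W then f ((!) x) else 0)"

text \<open>Normal forms modulo the equations: degree at most \<open>t\<close> in the independent
  coordinates, bounded exponents in the others. Rule \<open>cong\<close> expresses that only values
  on \<open>V\<close> count.\<close>

inductive reduced :: "'k::comm_ring_1 list set \<Rightarrow> nat set \<Rightarrow> nat set \<Rightarrow> (nat \<Rightarrow> nat) \<Rightarrow> nat \<Rightarrow>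
    ((nat \<Rightarrow> 'k) \<Rightarrow> 'k) \<Rightarrow> bool" for V I J l t where
  base: "pfd I t u \<Longrightarrow> (\<And>j. j \<in> J \<Longrightarrow> \<beta> j < l j) \<Longrightarrow> reduced V I J l t (\<lambda>e. u e * box_monom J \<beta> e)"
| add: "reduced V I J l t f \<Longrightarrow> reduced V I J l t g \<Longrightarrow> reduced V I J l t (\<lambda>e. f e + g e)"
| cong: "reduced V I J l t f \<Longrightarrow> (\<And>x. x \<in> V \<Longrightarrow> g ((!) x) = f ((!) x)) \<Longrightarrow> reduced V I J l t g"

text \<open>
  The coordinates in \<open>J\<close> satisfy equations of degree \<open>l j\<close> over those in \<open>I\<close> whose leading
  coefficient is \<open>g\<close>; multiplication by \<open>g\<close> makes up for its not being invertible.
\<close>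

locale reduction =
  fixes V :: "'k::field list set" and I J :: "nat set" and l :: "nat \<Rightarrow> nat"
    and g :: "(nat \<Rightarrow> 'k) \<Rightarrow> 'k" and b :: "nat \<Rightarrow> nat \<Rightarrow> (nat \<Rightarrow> 'k) \<Rightarrow> 'k" and \<Gamma> :: nat
  assumes fin: "finite I" "finite J" and l_pos: "j \<in> J \<Longrightarrow> l j > 0"
    and g: "pfd I \<Gamma> g" and gx: "i \<in> I \<Longrightarrow> pfd I \<Gamma> (\<lambda>e. g e * e i)"
    and b: "j \<in> J \<Longrightarrow> pfd I \<Gamma> (b j i)"
    and rel: "x \<in> V \<Longrightarrow> j \<in> J \<Longrightarrow> g ((!) x) * x ! j ^ l j = (\<Sum>i<l j. b j i ((!) x) * x ! j ^ i)"
begin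

lemma reduced_pfd: "pfd I t u \<Longrightarrow> reduced V I J l t u"
  using reduced.base[of I t u J "\<lambda>_. 0" l V] l_pos by (simp add: box_monom_def)

lemma reduced_sum:
  assumes "finite A" "\<And>i. i \<in> A \<Longrightarrow> reduced V I J l t (f i)"
  shows "reduced V I J l t (\<lambda>e. \<Sum>i\<in>A. f i e)"
  using assms
proof (induction A rule: finite_induct)
  case empty
  show ?case using reduced_pfd[OF pfd.const[of I t 0]] by simp
next
  case (insert x A)
  have "reduced V I J l t (\<lambda>e. f x e + (\<Sum>i\<in>A. f i e))"
    by (rule reduced.add) (use insert in auto)
  then show ?case using insert by simp
qed

lemma reduced_mult_pfd:
  assumes "reduced V I J l t f" "pfd I s u"
  shows "reduced V I J l (t + s) (\<lambda>e. u e * f e)"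
  using assms(1)
proof induction
  case (base w \<beta>)
  have "pfd I (t + s) (\<lambda>e. u e * w e)" by (rule pfd.mult[OF assms(2) base(1)]) simp
  from reduced.base[OF this base(2)] show ?case by (simp add: mult.assoc)
next
  case (add f h)
  from reduced.add[OF add.IH] show ?case by (simp add: distrib_left)
next
  case (cong f h)
  from cong.IH show ?case by (rule reduced.cong) (simp add: cong.hyps(2))
qed

text \<open>A coordinate in \<open>J\<close> whose exponent reaches \<open>l i\<close> is rewritten
  by its equation, at the price of one factor \<open>g\<close> and of \<open>\<Gamma>\<close> in the
  degree. Coordinates in \<open>I\<close> pay the same price for uniformity.\<close>

lemma reduced_var:
  assumes "reduced V I J l t f" "i \<in> I \<union> J"
  shows "reduced V I J l (t + \<Gamma>) (\<lambda>e. g e * e i * f e)"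
proof (cases "i \<in> I")
  case True
  show ?thesis by (rule reduced_mult_pfd[OF assms(1) gx[OF True]])
next
  case False
  then have i: "i \<in> J" using assms(2) by blast
  show ?thesis
    using assms(1)
  proof induction
    case (base u \<beta>)
    have split: "box_monom J \<beta>' e = e i ^ \<beta>' i * box_monom (J - {i}) \<beta>' e" for \<beta>' and e :: "nat \<Rightarrow> 'k"
      unfolding box_monom_def by (rule prod.remove[OF fin(2) i])
    have same: "box_monom (J - {i}) (\<beta>(i := n)) e = box_monom (J - {i}) \<beta> e" for n and e :: "nat \<Rightarrow> 'k"
      unfolding box_monom_def by (rule prod.cong) auto
    have upd: "box_monom J (\<beta>(i := n)) e = e i ^ n * box_monom (J - {i}) \<beta> e" for n and e :: "nat \<Rightarrow> 'k"
      using split[of "\<beta>(i := n)" e] by (simp add: same)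
    show ?case
    proof (cases "Suc (\<beta> i) < l i")
      case True
      have "pfd I (t + \<Gamma>) (\<lambda>e. g e * u e)" by (rule pfd.mult[OF g base(1)]) simp
      then have "reduced V I J l (t + \<Gamma>) (\<lambda>e. g e * u e * box_monom J (\<beta>(i := Suc (\<beta> i))) e)"
        by (rule reduced.base) (use base(2) True in auto)
      then show ?thesis
        by (rule reduced.cong) (simp add: upd split[of \<beta>] mult.commute mult.left_commute)
    next
      case False
      then have li: "l i = Suc (\<beta> i)" using base(2)[OF i] by simp
      have "reduced V I J l (t + \<Gamma>) (\<lambda>e. b i n e * u e * box_monom J (\<beta>(i := n)) e)" if "n < l i" for n
      proof (rule reduced.base)
        show "pfd I (t + \<Gamma>) (\<lambda>e. b i n e * u e)" by (rule pfd.mult[OF b[OF i] base(1)]) simp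
      qed (use base(2) that in auto)
      then have "reduced V I J l (t + \<Gamma>) (\<lambda>e. \<Sum>n<l i. b i n e * u e * box_monom J (\<beta>(i := n)) e)"
        by (intro reduced_sum) auto
      then show ?thesis
      proof (rule reduced.cong)
        fix x assume x: "x \<in> V"
        have "g ((!) x) * x ! i * (u ((!) x) * box_monom J \<beta> ((!) x)) =
            (g ((!) x) * x ! i ^ l i) * (u ((!) x) * box_monom (J - {i}) \<beta> ((!) x))"
          by (simp add: split[of \<beta>] li mult.commute mult.left_commute)
        also have "\<dots> = (\<Sum>n<l i. b i n ((!) x) * u ((!) x) * box_monom J (\<beta>(i := n)) ((!) x))"
          unfolding rel[OF x i] sum_distrib_right
          by (simp add: upd ac_simps)
        finally show "g ((!) x) * x ! i * (u ((!) x) * box_monom J \<beta> ((!) x)) =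
            (\<Sum>n<l i. b i n ((!) x) * u ((!) x) * box_monom J (\<beta>(i := n)) ((!) x))" .
      qed
    qed
  next
    case (add f h)
    from reduced.add[OF add.IH] show ?case by (simp add: distrib_left)
  next
    case (cong f h)
    from cong.IH show ?case by (rule reduced.cong) (simp add: cong.hyps(2))
  qed
qed

lemma reduced_power:
  assumes "reduced V I J l t f"
  shows "reduced V I J l (t + n * \<Gamma>) (\<lambda>e. g e ^ n * f e)"
proof (induction n)
  case 0
  then show ?case using assms by simp
next
  case (Suc n)
  from reduced_mult_pfd[OF Suc g] show ?case by (simp add: mult.assoc add.commute add.left_commute)
qed

text \<open>One factor \<open>g\<close> per degree suffices. The extra factor \<open>h\<close> makes
  the product case an iteration: apply the claim for one factor to the result for the other.\<close>

lemma reduced_polynomial: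
  assumes "pfd (I \<union> J) d f" "reduced V I J l t h"
  shows "reduced V I J l (t + d * \<Gamma>) (\<lambda>e. g e ^ d * f e * h e)"
  using assms
proof (induction arbitrary: t h)
  case (const d c)
  from reduced_mult_pfd[OF reduced_power[OF const, of d] pfd.const[of I 0 c]]
  show ?case by (simp add: mult.commute mult.left_commute)
next
  case (var i d)
  obtain d' where d': "d = Suc d'" using var(2) gr0_implies_Suc by blast
  from reduced_power[OF reduced_var[OF var.prems var.hyps(1)], of d']
  show ?case by (simp add: d' ac_simps)
next
  case (add d f f')
  from reduced.add[OF add.IH(1)[OF add.prems] add.IH(2)[OF add.prems]]
  show ?case by (simp add: distrib_left distrib_right)
next
  case (mult a f b f' d)
  obtain c where c: "d = a + b + c" using mult.hyps(3) le_Suc_ex by blast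
  from reduced_power[OF mult.IH(1)[OF mult.IH(2)[OF mult.prems]], of c]
  show ?case
    by (simp add: c power_add distrib_left distrib_right ac_simps)
qed

text \<open>On the open set where \<open>g\<close> is nonzero, dividing by \<open>g ^ d\<close>
  undoes the multiplications needed for the reduction.\<close>

lemma span_reduced:
  fixes d t :: nat
  defines "W \<equiv> {x \<in> V. g ((!) x) \<noteq> 0}"
  defines "G \<equiv> (\<lambda>(m, m') x. if x \<in> W then m ((!) x) * m' ((!) x) / g ((!) x) ^ d else 0) `
    ({box_monom I \<alpha> | \<alpha>. \<forall>i\<in>I. \<alpha> i \<le> t} \<times> {box_monom J \<beta> | \<beta>. \<forall>j\<in>J. \<beta> j \<le> (\<Sum>j\<in>J. l j)})"
  assumes "reduced V I J l t f"
  shows "(\<lambda>x. if x \<in> W then f ((!) x) / g ((!) x) ^ d else 0) \<in> fs.span G"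
  using assms(3)
proof induction
  case (base u \<beta>)
  have "\<forall>j\<in>J. \<beta> j \<le> (\<Sum>j\<in>J. l j)"
  proof
    fix j assume j: "j \<in> J"
    have "\<beta> j \<le> l j" using base(2)[OF j] by simp
    also have "l j \<le> (\<Sum>j\<in>J. l j)" by (rule member_le_sum[OF j]) (use fin in auto)
    finally show "\<beta> j \<le> (\<Sum>j\<in>J. l j)" .
  qed
  then have m': "box_monom J \<beta> \<in> {box_monom J \<beta> :: (nat \<Rightarrow> 'k) \<Rightarrow> 'k | \<beta>. \<forall>j\<in>J. \<beta> j \<le> (\<Sum>j\<in>J. l j)}" by blast
  show ?case
    using pfd_span_box_monom[OF fin(1) base(1)]
  proof (induction rule: fs.span_induct_alt)
    case base
    show ?case using fs.span_zero[of G] by (simp add: zero_fun_def cong: if_cong)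
  next
    case (step c x y)
    have "(\<lambda>z. if z \<in> W then x ((!) z) * box_monom J \<beta> ((!) z) / g ((!) z) ^ d else 0) \<in> G"
      unfolding G_def using step(1) m' by (intro image_eqI[of _ _ "(x, box_monom J \<beta>)"]) auto
    from fs.span_add[OF fs.span_scale[OF fs.span_base[OF this], of c] step(2)]
    show ?case
      by (rule back_subst[of "\<lambda>f. f \<in> fs.span G"]) (auto simp: fun_eq_iff algebra_simps add_divide_distrib)
  qed
next
  case (add f h)
  from fs.span_add[OF add.IH] show ?case
    by (rule back_subst[of "\<lambda>f. f \<in> fs.span G"]) (auto simp: fun_eq_iff algebra_simps add_divide_distrib)
next
  case (cong f h)
  from cong.IH show ?case
    by (rule back_subst[of "\<lambda>f. f \<in> fs.span G"]) (auto simp: fun_eq_iff cong.hyps(2) W_def)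
qed

text \<open>Only the exponents in \<open>I\<close> grow with \<open>d\<close>, up to
  \<open>d * \<Gamma>\<close>; those in \<open>J\<close> stay bounded. For positive \<open>d\<close>
  one has \<open>Suc (d * \<Gamma>) \<le> d * Suc \<Gamma>\<close>, which explains the
  constant.\<close>

lemma hilbert_bound_open:
  defines "W \<equiv> {x \<in> V. g ((!) x) \<noteq> 0}"
  shows "\<exists>C::nat. \<forall>d>0. \<exists>G. finite G \<and> card G \<le> C * d ^ card I \<and>
    (\<forall>f. pfd (I \<union> J) d f \<longrightarrow> restr W f \<in> fs.span G)"
proof (rule exI[of _ "Suc \<Gamma> ^ card I * Suc (\<Sum>j\<in>J. l j) ^ card J"], intro allI impI)
  fix d :: nat assume d: "d > 0"
  let ?L = "\<Sum>j\<in>J. l j"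
  let ?MI = "{box_monom I \<alpha> :: (nat \<Rightarrow> 'k) \<Rightarrow> 'k | \<alpha>. \<forall>i\<in>I. \<alpha> i \<le> d * \<Gamma>}"
  let ?MJ = "{box_monom J \<beta> :: (nat \<Rightarrow> 'k) \<Rightarrow> 'k | \<beta>. \<forall>j\<in>J. \<beta> j \<le> ?L}"
  let ?G = "(\<lambda>(m, m') x. if x \<in> W then m ((!) x) * m' ((!) x) / g ((!) x) ^ d else 0) ` (?MI \<times> ?MJ)"
  have MI: "finite ?MI" "card ?MI \<le> Suc (d * \<Gamma>) ^ card I"
    and MJ: "finite ?MJ" "card ?MJ \<le> Suc ?L ^ card J"
    using card_box_monom[OF fin(1)] card_box_monom[OF fin(2)] by blast+
  have "card ?G \<le> card ?MI * card ?MJ"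
    using card_image_le[of "?MI \<times> ?MJ"] MI(1) MJ(1) by (simp add: card_cartesian_product)
  also have "\<dots> \<le> (d * Suc \<Gamma>) ^ card I * Suc ?L ^ card J"
  proof (rule mult_le_mono)
    have "Suc (d * \<Gamma>) \<le> d * Suc \<Gamma>" using d by simp
    from power_mono[OF this] show "card ?MI \<le> (d * Suc \<Gamma>) ^ card I" using MI(2) order_trans by blast
  qed (rule MJ(2))
  finally have "card ?G \<le> (Suc \<Gamma> ^ card I * Suc ?L ^ card J) * d ^ card I"
    by (simp only: power_mult_distrib mult.commute mult.left_commute)
  moreover have "finite ?G" using MI(1) MJ(1) by blast
  moreover have "restr W f \<in> fs.span ?G" if f: "pfd (I \<union> J) d f" for f
  proof -
    have "reduced V I J l (0 + d * \<Gamma>) (\<lambda>e. g e ^ d * f e * 1)"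
      by (intro reduced_polynomial f reduced_pfd pfd.const)
    from span_reduced[OF this[simplified], of d] show ?thesis
      unfolding W_def
      by (rule back_subst[of "\<lambda>f. f \<in> fs.span _"]) (auto simp: fun_eq_iff restr_def)
  qed
  ultimately show "\<exists>G. finite G \<and> card G \<le> (Suc \<Gamma> ^ card I * Suc ?L ^ card J) * d ^ card I \<and>
    (\<forall>f. pfd (I \<union> J) d f \<longrightarrow> restr W f \<in> fs.span G)" by blast
qed

end

section \<open>The Hilbert function of a closed set, by induction on closed subsets\<close>

lemma common_degree:
  assumes "finite S" "S \<subseteq> polyfun I"
  shows "\<exists>d. \<forall>f\<in>S. pfd I d f"
  using assms
proof (induction S rule: finite_induct)
  case (insert f S)
  then obtain d d' where d: "\<forall>f\<in>S. pfd I d f" "pfd I d' f" unfolding polyfun_def by blast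
  have "\<forall>f\<in>insert f S. pfd I (max d d') f"
    using d pfd_mono[of I d _ "max d d'"] pfd_mono[of I d' _ "max d d'"] by auto
  then show ?case by blast
qed simp

text \<open>For a maximal independent set \<open>I\<close> every other coordinate satisfies an
  algebraic relation over \<open>I\<close>, so the preceding reduction applies.\<close>

lemma hilbert_bound_nonempty:
  fixes V :: "'k::alg_closed_field list set"
  assumes "V \<noteq> {}"
  shows "\<exists>I g. I \<subseteq> {..<N} \<and> indep_coords I V \<and> g \<in> polyfun I \<and> (\<exists>e. g e \<noteq> 0) \<and>
    (\<exists>C::nat. \<forall>d>0. \<exists>G. finite G \<and> card G \<le> C * d ^ card I \<and>
      (\<forall>f. pfd {..<N} d f \<longrightarrow> restr {x \<in> V. g ((!) x) \<noteq> 0} f \<in> fs.span G))"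
proof -
  let ?A = "{I. I \<subseteq> {..<N} \<and> indep_coords I V}"
  have "indep_coords {} V"
    unfolding indep_coords_def
  proof (intro ballI impI allI)
    fix q :: "(nat \<Rightarrow> 'k) \<Rightarrow> 'k" and e
    assume q: "q \<in> polyfun {}" "\<forall>x\<in>V. q ((!) x) = 0"
    obtain x where "x \<in> V" using assms by blast
    then show "q e = 0" using q(2) polyfun_cong[OF q(1), of e "(!) x"] by auto
  qed
  then have "?A \<noteq> {}" "finite ?A" by auto
  then obtain I where I: "I \<in> ?A" "\<forall>I'\<in>?A. I \<subseteq> I' \<longrightarrow> I = I'"
    using finite_has_maximal[of ?A] by blast
  have finI: "finite I" using I(1) finite_subset by blast
  define J where "J = {..<N} - I"
  have finJ: "finite J" by (simp add: J_def)
  have IJ: "I \<union> J = {..<N}" using I(1) by (auto simp: J_def)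
  have "\<forall>j\<in>J. \<exists>lc. fst lc > 0 \<and> (\<forall>i. snd lc i \<in> polyfun I) \<and> (\<exists>e. snd lc (fst lc) e \<noteq> 0) \<and>
    (\<forall>x\<in>V. (\<Sum>i\<le>fst lc. snd lc i ((!) x) * x ! j ^ i) = 0)"
  proof
    fix j assume j: "j \<in> J"
    then have "\<not> indep_coords (insert j I) V" using I unfolding J_def by blast
    from algebraic_relation[OF _ this] I(1) j
    obtain l c where "l > 0" "\<forall>i. c i \<in> polyfun I" "\<exists>e. c l e \<noteq> 0"
      "\<forall>x\<in>V. (\<Sum>i\<le>l. c i ((!) x) * x ! j ^ i) = 0"
      unfolding J_def by blast
    then show "\<exists>lc. fst lc > 0 \<and> (\<forall>i. snd lc i \<in> polyfun I) \<and> (\<exists>e. snd lc (fst lc) e \<noteq> 0) \<and>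
      (\<forall>x\<in>V. (\<Sum>i\<le>fst lc. snd lc i ((!) x) * x ! j ^ i) = 0)"
      by (intro exI[of _ "(l, c)"]) auto
  qed
  from bchoice[OF this] obtain lc where lc: "\<forall>j\<in>J. fst (lc j) > 0 \<and> (\<forall>i. snd (lc j) i \<in> polyfun I) \<and>
    (\<exists>e. snd (lc j) (fst (lc j)) e \<noteq> 0) \<and>
    (\<forall>x\<in>V. (\<Sum>i\<le>fst (lc j). snd (lc j) i ((!) x) * x ! j ^ i) = 0)" by blast
  define l c where "l = (\<lambda>j. fst (lc j))" and "c = (\<lambda>j. snd (lc j))"
  have l_pos: "l j > 0" and c_I: "c j i \<in> polyfun I" and c_nz: "\<exists>e. c j (l j) e \<noteq> 0"
    and c_rel: "x \<in> V \<Longrightarrow> (\<Sum>i\<le>l j. c j i ((!) x) * x ! j ^ i) = 0" if "j \<in> J" for j i x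
    using bspec[OF lc that] by (auto simp: l_def c_def)
  \<comment> \<open>The product of all leading coefficients is a common leading coefficient once
    each relation is multiplied by those of the others. \<open>b\<close> is set to 0 beyond
    \<open>l j\<close>, so that finitely many functions need a degree bound.\<close>
  define g where "g = (\<lambda>e. \<Prod>j\<in>J. c j (l j) e)"
  define b where "b = (\<lambda>j i e. if i < l j then - c j i e * (\<Prod>j'\<in>J - {j}. c j' (l j') e) else 0)"
  have gI: "g \<in> polyfun I"
    unfolding g_def by (intro funring_prod[OF funring_polyfun] c_I)
  have bI: "b j i \<in> polyfun I" if "j \<in> J" for j i
  proof (cases "i < l j")
    case True
    then have "b j i = (\<lambda>e. - c j i e * (\<Prod>j'\<in>J - {j}. c j' (l j') e))" by (simp add: b_def)
    also have "\<dots> \<in> polyfun I"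
      by (intro polyfun_mult polyfun_minus funring_prod[OF funring_polyfun] c_I that) auto
    finally show ?thesis .
  next
    case False
    then have "b j i = (\<lambda>e. 0)" by (simp add: b_def)
    then show ?thesis by (simp add: polyfun_const)
  qed
  let ?S = "{g} \<union> (\<lambda>i e. g e * e i) ` I \<union> (\<Union>j\<in>J. b j ` {..l j})"
  have "?S \<subseteq> polyfun I" using gI bI by (auto intro: polyfun_mult polyfun_var)
  then obtain \<Gamma> where \<Gamma>: "\<forall>f\<in>?S. pfd I \<Gamma> f"
    using common_degree[of ?S I] finI finJ by auto
  interpret reduction V I J l g b \<Gamma>
  proof
    show "pfd I \<Gamma> (b j i)" if "j \<in> J" for j i
    proof (cases "i \<le> l j")
      case True
      then show ?thesis using \<Gamma> that by blast
    next
      case False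
      then have "b j i = (\<lambda>e. 0)" by (simp add: b_def)
      then show ?thesis by (simp add: pfd.const)
    qed
    show "g ((!) x) * x ! j ^ l j = (\<Sum>i<l j. b j i ((!) x) * x ! j ^ i)" if x: "x \<in> V" and j: "j \<in> J" for x j
    proof -
      let ?P = "\<Prod>j'\<in>J - {j}. c j' (l j') ((!) x)"
      have "c j (l j) ((!) x) * x ! j ^ l j = - (\<Sum>i<l j. c j i ((!) x) * x ! j ^ i)"
        using c_rel[OF j x] by (simp add: eq_neg_iff_add_eq_0 add.commute flip: lessThan_Suc_atMost)
      moreover have "g ((!) x) = c j (l j) ((!) x) * ?P"
        unfolding g_def by (rule prod.remove[OF finJ j])
      then have "g ((!) x) * x ! j ^ l j = (c j (l j) ((!) x) * x ! j ^ l j) * ?P"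
        by (simp only: ac_simps)
      ultimately have "g ((!) x) * x ! j ^ l j = - (\<Sum>i<l j. c j i ((!) x) * x ! j ^ i) * ?P"
        by (simp only:)
      also have "\<dots> = (\<Sum>i<l j. b j i ((!) x) * x ! j ^ i)"
        by (simp add: b_def sum_distrib_left ac_simps flip: sum_negf)
      finally show ?thesis .
    qed
  qed (use finI finJ l_pos \<Gamma> in auto)
  have "\<exists>e. g e \<noteq> 0"
    unfolding g_def by (rule polyfun_prod_nonzero[OF finJ]) (use c_I c_nz in auto)
  then show ?thesis
    using I(1) gI hilbert_bound_open unfolding IJ by blast
qed

text \<open>\<open>V\<close> is the union of an open part covered by the reduction and of the
  smaller closed set where \<open>g\<close> vanishes. Bounding independent coordinates on all closed
  subsets makes the hypothesis hereditary.\<close>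

theorem hilbert_bound:
  fixes V :: "'k::alg_closed_field list set"
  assumes "closed_subvariety N V"
    and "\<And>I Y. closed_subvariety N Y \<Longrightarrow> Y \<subseteq> V \<Longrightarrow> I \<subseteq> {..<N} \<Longrightarrow> indep_coords I Y \<Longrightarrow> card I \<le> k"
  shows "\<exists>C::nat. \<forall>d>0. \<exists>G. finite G \<and> card G \<le> C * d ^ k \<and>
    (\<forall>f. pfd {..<N} d f \<longrightarrow> restr V f \<in> fs.span G)"
  using assms
proof (induction V rule: wf_induct_rule[OF wf_closed_subvariety[of N]])
  case (1 V)
  show ?case
  proof (cases "V = {}")
    case True
    have "restr V f \<in> fs.span {}" for f :: "(nat \<Rightarrow> 'k) \<Rightarrow> 'k"
      using fs.span_zero[of "{}"] by (simp add: True restr_def[abs_def] zero_fun_def)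
    then show ?thesis by (intro exI[of _ 0] allI impI exI[of _ "{}"]) auto
  next
    case False
    then obtain I g C where I: "I \<subseteq> {..<N}" "indep_coords I V" and g: "g \<in> polyfun I" "\<exists>e. g e \<noteq> 0"
      and C: "\<forall>d>0. \<exists>G. finite G \<and> card G \<le> C * d ^ card I \<and>
        (\<forall>f. pfd {..<N} d f \<longrightarrow> restr {x \<in> V. g ((!) x) \<noteq> 0} f \<in> fs.span G)"
      using hilbert_bound_nonempty[OF False, of N] by blast
    define W Y where "W = {x \<in> V. g ((!) x) \<noteq> 0}" and "Y = V \<inter> {x. g ((!) x) = 0}"
    have cI: "card I \<le> k" by (rule "1.prems"(2)[OF "1.prems"(1) order_refl I])
    have Yc: "closed_subvariety N Y"
      unfolding Y_def using g(1) polyfun_subset[OF I(1)] by (intro closed_subvariety_Int_zeros "1.prems"(1)) auto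
    have "\<exists>x\<in>V. g ((!) x) \<noteq> 0"
      using I(2)[unfolded indep_coords_def, rule_format, OF g(1)] g(2) by blast
    then have "Y \<subset> V" unfolding Y_def by blast
    then have "(Y, V) \<in> {(A, B). closed_subvariety N A \<and> closed_subvariety N B \<and> A \<subset> B}"
      using Yc "1.prems"(1) by blast
    moreover have "card I \<le> k" if "closed_subvariety N Y'" "Y' \<subseteq> Y" "I \<subseteq> {..<N}" "indep_coords I Y'" for I Y'
      using "1.prems"(2)[of Y' I] that \<open>Y \<subset> V\<close> by blast
    ultimately have "\<exists>C'::nat. \<forall>d>0. \<exists>G. finite G \<and> card G \<le> C' * d ^ k \<and>
        (\<forall>f. pfd {..<N} d f \<longrightarrow> restr Y f \<in> fs.span G)"
      using "1.IH"[of Y] Yc by blast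
    then obtain C' where C': "\<forall>d>0. \<exists>G. finite G \<and> card G \<le> C' * d ^ k \<and>
        (\<forall>f. pfd {..<N} d f \<longrightarrow> restr Y f \<in> fs.span G)" by blast
    show ?thesis
    proof (rule exI[of _ "C + C'"], intro allI impI)
      fix d :: nat assume d: "d > 0"
      obtain G where G: "finite G" "card G \<le> C * d ^ card I"
        "\<And>f. pfd {..<N} d f \<Longrightarrow> restr W f \<in> fs.span G"
        using C[folded W_def, rule_format, OF d] by blast
      obtain G' where G': "finite G'" "card G' \<le> C' * d ^ k"
        "\<And>f. pfd {..<N} d f \<Longrightarrow> restr Y f \<in> fs.span G'"
        using C'[rule_format, OF d] by blast
      have "card (G \<union> G') \<le> card G + card G'" by (rule card_Un_le)
      also have "\<dots> \<le> C * d ^ k + C' * d ^ k"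
      proof (rule add_mono[OF _ G'(2)])
        have "d ^ card I \<le> d ^ k" using cI d by (intro power_increasing) auto
        then show "card G \<le> C * d ^ k" using G(2) by (meson mult_le_mono2 order_trans)
      qed
      finally have "card (G \<union> G') \<le> (C + C') * d ^ k" by (simp add: distrib_right)
      moreover have "restr V f \<in> fs.span (G \<union> G')" if f: "pfd {..<N} d f" for f
      proof -
        have "restr V f = restr W f + restr Y f"
          by (auto simp: fun_eq_iff restr_def W_def Y_def)
        moreover have "restr W f \<in> fs.span (G \<union> G')" "restr Y f \<in> fs.span (G \<union> G')"
          using G(3)[OF f] G'(3)[OF f] fs.span_mono[of G "G \<union> G'"] fs.span_mono[of G' "G \<union> G'"] by auto
        ultimately show ?thesis using fs.span_add by metis
      qed
      ultimately show "\<exists>G. finite G \<and> card G \<le> (C + C') * d ^ k \<and>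
          (\<forall>f. pfd {..<N} d f \<longrightarrow> restr V f \<in> fs.span G)"
        using G(1) G'(1) by blast
    qed
  qed
qed

text \<open>The point where the Krull dimension enters: independent coordinates produce a chain of
  that length.\<close>

lemma (in acval) indep_coords_card_le_dim:
  assumes "closed_subvariety N (Y :: 'k list set)" "Y \<subseteq> V" "I \<subseteq> {..<N}" "indep_coords I Y"
    and "variety_dim N V = enat k"
  shows "card I \<le> k"
proof -
  obtain Z where Z: "\<forall>i\<le>card I. irreducible_subvariety N (Z i) \<and> Z i \<subseteq> Y" "\<forall>i<card I. Z i \<subset> Z (Suc i)"
    using irreducible_chain[OF finite_subset[OF assms(3)] assms(3,1,4)] by auto
  have "Z i \<subseteq> V" if "i \<le> card I" for i using Z(1) assms(2) that by blast
  then have "enat (card I) \<le> variety_dim N V"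
    unfolding variety_dim_def using Z by (intro SUP_upper) (auto intro!: exI[of _ Z])
  then show ?thesis using assms(5) by simp
qed

section \<open>Counting patterns\<close>

lemma prod_mono_value:
  fixes a b :: "'i \<Rightarrow> 'g::linordered_comm_group_with_zero"
  assumes "\<And>i. i \<in> A \<Longrightarrow> a i \<le> b i"
  shows "prod a A \<le> prod b A"
  using assms
proof (induction A rule: infinite_finite_induct)
  case (insert i A)
  have "a i * prod a A \<le> b i * prod b A"
    by (rule mult_mono_value) (use insert in auto)
  then show ?case using insert.hyps by simp
qed simp_all

text \<open>The indexed form of independence also gives injectivity: two equal members would have
  the relation with coefficients 1 and -1.\<close>

lemma card_le_of_trivial_relations:
  fixes b :: "'q \<Rightarrow> 'b \<Rightarrow> 'k::field"
  assumes "finite Q" "finite G" "\<And>q. q \<in> Q \<Longrightarrow> b q \<in> fs.span G"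
    and triv: "\<And>c. (\<And>y. (\<Sum>q\<in>Q. c q * b q y) = 0) \<Longrightarrow> \<forall>q\<in>Q. c q = 0"
  shows "card Q \<le> card G"
proof -
  have inj: "inj_on b Q"
  proof (rule inj_onI, rule ccontr)
    fix p q assume pq: "p \<in> Q" "q \<in> Q" "b p = b q" "p \<noteq> q"
    define c where "c = (\<lambda>r. if r = p then 1 else if r = q then - 1 else (0::'k))"
    have "(\<Sum>r\<in>Q. c r * b r y) = 0" for y
    proof -
      have "(\<Sum>r\<in>Q. c r * b r y) = (\<Sum>r\<in>{p, q}. c r * b r y)"
        by (rule sum.mono_neutral_right) (use assms(1) pq in \<open>auto simp: c_def\<close>)
      also have "\<dots> = c p * b p y + c q * b q y" using pq(4) by simp
      also have "\<dots> = 0"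
        unfolding pq(3) using pq(4) by (simp add: c_def)
      finally show ?thesis .
    qed
    then have "\<forall>q\<in>Q. c q = 0" by (rule triv)
    then have "c p = 0" using pq(1) by (rule bspec)
    then show False by (simp add: c_def)
  qed
  have "\<not> fs.dependent (b ` Q)"
  proof
    assume "fs.dependent (b ` Q)"
    then have "\<exists>u. (\<exists>w\<in>b ` Q. u w \<noteq> 0) \<and> (\<Sum>w\<in>b ` Q. (\<lambda>x. u w * w x)) = 0"
      by (simp only: fs.dependent_finite[OF finite_imageI[OF assms(1)]])
    then obtain u where u: "\<exists>w\<in>b ` Q. u w \<noteq> 0" "(\<Sum>w\<in>b ` Q. (\<lambda>x. u w * w x)) = 0"
      by blast
    have "(\<Sum>q\<in>Q. u (b q) * b q y) = 0" for y
    proof -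
      have eq: "(\<Sum>w\<in>A. (\<lambda>x. u w * w x)) y = (\<Sum>w\<in>A. u w * w y)" for A
        by (induction A rule: infinite_finite_induct) simp_all
      have "(\<Sum>w\<in>b ` Q. u w * w y) = 0"
        using fun_cong[OF u(2), of y] unfolding eq by simp
      then show ?thesis using sum.reindex[OF inj, of "\<lambda>w. u w * w y"] by simp
    qed
    then have "\<forall>q\<in>Q. u (b q) = 0" by (rule triv)
    then show False using u(1) by simp
  qed
  moreover have "b ` Q \<subseteq> fs.span G" using assms(3) by (rule image_subsetI)
  ultimately have "card (b ` Q) \<le> card G"
    using fs.independent_span_bound[OF assms(2)] by simp
  then show ?thesis by (simp add: card_image[OF inj])
qed

text \<open>
  To the pattern of a point, recorded as the set of indices where \<open>f\<close> and \<open>g\<close> both vanish and the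
  set of the other indices with \<open>|f| \<le> |g|\<close>, belongs the product of the factors that are maximal at
  this point. The matrix of the values of these products at points realizing the patterns is
  triangular in an ultrametric sense, so the products are linearly independent.
\<close>

definition full_pattern :: "('k::zero \<Rightarrow> 'g::ord) \<Rightarrow> 'i set \<Rightarrow> ('i \<Rightarrow> 'x \<Rightarrow> 'k) \<Rightarrow> ('i \<Rightarrow> 'x \<Rightarrow> 'k) \<Rightarrow> 'x \<Rightarrow> 'i set \<times> 'i set" where
  "full_pattern v S f g x =
     ({i \<in> S. f i x = 0 \<and> g i x = 0},
      {i \<in> S. \<not> (f i x = 0 \<and> g i x = 0) \<and> v (f i x) \<le> v (g i x)})"

text \<open>The value 1 at common zeros keeps the product nonzero at points realizing the
  pattern.\<close>

definition pattern_factor :: "('i \<Rightarrow> 'x \<Rightarrow> 'k) \<Rightarrow> ('i \<Rightarrow> 'x \<Rightarrow> 'k) \<Rightarrow> 'i set \<times> 'i set \<Rightarrow> 'i \<Rightarrow> 'x \<Rightarrow> 'k::comm_ring_1" where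
  "pattern_factor f g p i x = (if i \<in> fst p then 1 else if i \<in> snd p then g i x else f i x)"

lemma (in acval) full_pattern_iff:
  assumes "i \<in> S"
  shows "i \<in> fst (full_pattern v S f g x) \<union> snd (full_pattern v S f g x) \<longleftrightarrow> v (f i x) \<le> v (g i x)"
  using assms by (auto simp: full_pattern_def)

text \<open>In a nontrivial relation choose \<open>q\<close> by three criteria in turn: largest set
  of common zeros, largest |c q|, smallest \<open>snd q\<close>. At a point realizing
  \<open>q\<close> its term strictly exceeds all others in norm, so the sum cannot be 0.\<close>

lemma (in acval) pattern_products_independent:
  fixes f g :: "'i \<Rightarrow> 'x \<Rightarrow> 'k" and S :: "'i set" and V :: "'x set"
  defines "P \<equiv> full_pattern v S f g"
  defines "F \<equiv> \<lambda>p x. \<Prod>i\<in>S. pattern_factor f g p i x"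
  assumes S: "finite S" and rel: "\<And>x. x \<in> V \<Longrightarrow> (\<Sum>p\<in>P ` V. c p * F p x) = 0"
  shows "\<forall>p\<in>P ` V. c p = 0"
proof (rule ccontr)
  assume contra: "\<not> ?thesis"
  have PS: "fst p \<subseteq> S" "snd p \<subseteq> S - fst p" if "p \<in> P ` V" for p
    using that by (auto simp: P_def full_pattern_def)
  have "P ` V \<subseteq> Pow S \<times> Pow S" using PS by fastforce
  then have finP: "finite (P ` V)" using S finite_subset by blast
  define Q where "Q = {p \<in> P ` V. c p \<noteq> 0}"
  have Q: "finite Q" "Q \<noteq> {}" using finP contra unfolding Q_def by (simp, blast)
  \<comment> \<open>At a point with common zero set \<open>Z = fst p1\<close>, the product of
    \<open>p\<close> vanishes unless \<open>fst p\<close> contains \<open>Z\<close>; by maximality a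
    nonvanishing term then has \<open>fst p = Z\<close>.\<close>
  obtain p1 where p1': "p1 \<in> Q" "\<And>p. p \<in> Q \<Longrightarrow> - int (card (fst p1)) \<le> - int (card (fst p))"
    by (rule ex_min_image[OF Q, of "\<lambda>p. - int (card (fst p))"]) blast
  then have p1: "p1 \<in> Q" "\<And>p. p \<in> Q \<Longrightarrow> card (fst p) \<le> card (fst p1)" by simp_all
  define Z where "Z = fst p1"
  define Q1 where "Q1 = {p \<in> Q. fst p = Z}"
  have Q1: "finite Q1" "Q1 \<noteq> {}" using Q(1) p1(1) unfolding Q1_def Z_def by (simp, blast)
  define m where "m = Max ((\<lambda>p. v (c p)) ` Q1)"
  have m_max: "v (c p) \<le> m" if "p \<in> Q1" for p
    unfolding m_def using Q1 that by (intro Max_ge) auto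
  have "m \<in> (\<lambda>p. v (c p)) ` Q1" unfolding m_def using Q1 by (intro Max_in) auto
  then have Q2: "finite {p \<in> Q1. v (c p) = m}" "{p \<in> Q1. v (c p) = m} \<noteq> {}"
    using Q1(1) by (simp, blast)
  \<comment> \<open>Minimality breaks the ties in |c p|: \<open>snd p\<close> is not contained in
    \<open>snd q\<close>, and at an index of \<open>snd p\<close> outside \<open>snd q\<close> the
    product of \<open>p\<close> uses the strictly smaller \<open>g\<close>. Indices of
    \<open>snd q\<close> would not do, as |f| = |g| is possible there.\<close>
  obtain q where "q \<in> {p \<in> Q1. v (c p) = m}"
    "\<And>p. p \<in> {p \<in> Q1. v (c p) = m} \<Longrightarrow> card (snd q) \<le> card (snd p)"
    by (rule ex_min_image[OF Q2, of "\<lambda>p. card (snd p)"]) blast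
  then have q: "q \<in> Q1" "v (c q) = m"
    "\<And>p. p \<in> Q1 \<Longrightarrow> v (c p) = m \<Longrightarrow> card (snd q) \<le> card (snd p)" by simp_all
  have qPV: "q \<in> P ` V" and qZ: "fst q = Z" and cq: "c q \<noteq> 0"
    using q(1) by (auto simp: Q1_def Q_def)
  obtain x where x: "x \<in> V" "q = P x" using qPV by blast
  let ?\<phi> = "\<lambda>p i. pattern_factor f g p i x"
  have ZI: "i \<in> Z \<longleftrightarrow> i \<in> S \<and> f i x = 0 \<and> g i x = 0" for i
    using qZ by (auto simp: x(2) P_def full_pattern_def)
  have TI: "i \<in> snd q \<longleftrightarrow> i \<in> S \<and> \<not> (f i x = 0 \<and> g i x = 0) \<and> v (f i x) \<le> v (g i x)" for i
    by (auto simp: x(2) P_def full_pattern_def)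
  have \<phi>q: "v (?\<phi> q i) = (if i \<in> Z then 1 else max (v (f i x)) (v (g i x)))" if "i \<in> S" for i
    using that ZI[of i] TI[of i] qZ by (auto simp: pattern_factor_def max_def)
  have \<phi>q_nz: "v (?\<phi> q i) \<noteq> 0" if "i \<in> S" for i
    using \<phi>q[OF that] that ZI[of i] by (auto simp: max_def eq_0_iff le_0_iff_value zero_le_value split: if_splits)
  have prod_nz: "(\<Prod>i\<in>A. v (?\<phi> q i)) \<noteq> 0" if "A \<subseteq> S" for A
    using that \<phi>q_nz by (induction A rule: infinite_finite_induct) (auto simp: mult_eq_0_iff_value)
  have Fq: "v (F q x) \<noteq> 0" using prod_nz[of S] by (simp add: F_def prod)
  have cq': "v (c q) \<noteq> 0" using cq by (simp add: eq_0_iff)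
  have less: "v (c p * F p x) < v (c q * F q x)" if p: "p \<in> P ` V - {q}" for p
  proof (cases "c p * F p x = 0")
    case True
    show ?thesis
      unfolding True using Fq cq' by (simp add: mult[of "c q"] pos_iff_value mult_eq_0_iff_value)
  next
    case False
    then have pQ: "p \<in> Q" and Fp: "F p x \<noteq> 0" using p by (auto simp: Q_def)
    have pS: "fst p \<subseteq> S" "snd p \<subseteq> S - fst p" using PS p by blast+
    have "Z \<subseteq> fst p"
    proof
      fix i assume i: "i \<in> Z"
      show "i \<in> fst p"
      proof (rule ccontr)
        assume "i \<notin> fst p"
        then have "?\<phi> p i = 0" using i ZI[of i] by (simp add: pattern_factor_def)
        then have "F p x = 0" unfolding F_def using S i ZI[of i] by auto
        then show False using Fp by simp
      qed
    qed
    moreover have "card (fst p) \<le> card Z" using p1(2)[OF pQ] by (simp add: Z_def)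
    ultimately have fp: "fst p = Z"
      using card_seteq[of "fst p" Z] finite_subset[OF pS(1) S] by simp
    then have pQ1: "p \<in> Q1" using pQ by (simp add: Q1_def)
    have le: "v (?\<phi> p i) \<le> v (?\<phi> q i)" if "i \<in> S" for i
      using \<phi>q[OF that] fp by (simp add: pattern_factor_def)
    then have Fle: "v (F p x) \<le> v (F q x)" unfolding F_def prod by (rule prod_mono_value)
    show ?thesis
    proof (cases "v (c p) = m")
      case False
      then have "v (c p) < v (c q)" using m_max[OF pQ1] q(2) by simp
      from mult_strict_mono_value[OF this Fle Fq] show ?thesis by (simp add: mult)
    next
      case True
      have "\<not> snd p \<subseteq> snd q"
      proof
        assume sub: "snd p \<subseteq> snd q"
        have "finite (snd q)" using PS(2)[OF qPV] S finite_subset by blast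
        then have "snd p = snd q" using card_seteq[OF _ sub] q(3)[OF pQ1 True] by simp
        then show False using fp qZ p by (simp add: prod_eq_iff)
      qed
      then obtain i where i: "i \<in> snd p" "i \<notin> snd q" by blast
      then have iS: "i \<in> S" "i \<notin> Z" using pS(2) fp by auto
      have "v (g i x) < v (f i x)" using i(2) TI[of i] ZI[of i] iS by auto
      then have lt: "v (?\<phi> p i) < v (?\<phi> q i)"
        using i iS fp \<phi>q[OF iS(1)] by (simp add: pattern_factor_def max_def)
      have "(\<Prod>j\<in>S - {i}. v (?\<phi> p j)) \<le> (\<Prod>j\<in>S - {i}. v (?\<phi> q j))"
        using le by (intro prod_mono_value) auto
      from mult_strict_mono_value[OF lt this prod_nz]
      have "v (F p x) < v (F q x)"
        unfolding F_def prod by (subst (1 2) prod.remove[OF S iS(1)]) auto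
      from mult_strict_mono_value[OF this _ cq', of "v (c p)"] show ?thesis
        using True q(2) by (simp add: mult mult.commute)
    qed
  qed
  have "v (\<Sum>p\<in>P ` V - {q}. c p * F p x) < v (c q * F q x)"
    by (rule sum_less[OF _ less]) (use Fq cq' in \<open>auto simp: mult mult_eq_0_iff_value\<close>)
  then have "v ((\<Sum>p\<in>P ` V - {q}. c p * F p x) + c q * F q x) = v (c q * F q x)"
    by (rule add_eq_right)
  also have "(\<Sum>p\<in>P ` V - {q}. c p * F p x) + c q * F q x = (\<Sum>p\<in>P ` V. c p * F p x)"
    using finP qPV by (simp add: sum.remove add.commute)
  finally show False using rel[OF x(1)] Fq cq' by (simp add: mult mult_eq_0_iff_value)
qed

text \<open>The products have degree at most \<open>card S * D\<close> and are independent on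
  \<open>V\<close>, so there are no more of them than spanning functions.\<close>

lemma (in acval) card_full_patterns:
  fixes f g :: "'i \<Rightarrow> (nat \<Rightarrow> 'k) \<Rightarrow> 'k"
  assumes "finite S" "\<And>i. i \<in> S \<Longrightarrow> pfd {..<N} D (f i)" "\<And>i. i \<in> S \<Longrightarrow> pfd {..<N} D (g i)"
    and "card S * D \<le> d" "finite G" "\<And>h. pfd {..<N} d h \<Longrightarrow> restr V h \<in> fs.span G"
  shows "card ((\<lambda>x. full_pattern v S f g ((!) x)) ` V) \<le> card G"
proof -
  let ?f = "\<lambda>i x. f i ((!) x)" and ?g = "\<lambda>i x. g i ((!) x)"
  let ?P = "full_pattern v S ?f ?g"
  let ?F = "\<lambda>p e. \<Prod>i\<in>S. pattern_factor f g p i e"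
  have "?P ` V \<subseteq> Pow S \<times> Pow S" by (auto simp: full_pattern_def)
  then have fin: "finite (?P ` V)" using assms(1) finite_subset by blast
  have "card (?P ` V) \<le> card G"
  proof (rule card_le_of_trivial_relations[where b = "\<lambda>p. restr V (?F p)"])
    show "restr V (?F p) \<in> fs.span G" for p
    proof -
      have "pfd {..<N} D (\<lambda>e. pattern_factor f g p i e)" if "i \<in> S" for i
        using assms(2,3)[OF that]
        by (cases "i \<in> fst p"; cases "i \<in> snd p") (simp_all add: pattern_factor_def pfd.const)
      then have "pfd {..<N} (card S * D) (?F p)" by (rule pfd_prod[OF assms(1)])
      then show ?thesis using assms(4,6) pfd_mono by blast
    qed
    fix c assume *: "\<And>y. (\<Sum>p\<in>?P ` V. c p * restr V (?F p) y) = 0"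
    show "\<forall>p\<in>?P ` V. c p = 0"
    proof (rule pattern_products_independent[OF assms(1)])
      fix x assume "x \<in> V"
      then show "(\<Sum>p\<in>?P ` V. c p * (\<Prod>i\<in>S. pattern_factor ?f ?g p i x)) = 0"
        using *[of x] by (simp add: restr_def pattern_factor_def)
    qed
  qed (use fin assms(5) in auto)
  moreover have "?P x = full_pattern v S f g ((!) x)" for x by (simp add: full_pattern_def)
  ultimately show ?thesis by simp
qed

text \<open>Follows the parity encoding of variables: odd positions stand for value variables and
  receive 0, whose value is the default 0 of \<open>realization\<close>.\<close>

definition list_env :: "'k::zero list \<Rightarrow> nat \<Rightarrow> 'k" where
  "list_env z m = (if even m \<and> m div 2 < length z then z ! (m div 2) else 0)"

theorem theorem2p1:
  fixes abv :: "'k::alg_closed_field \<Rightarrow> 'g::linordered_comm_group_with_zero"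
    and N M k :: nat
    and V W :: "'k list set"
    and \<phi> :: "('k, 'g) fm"
  assumes "valuation abv"
    and "closed_subvariety N V"
    and "closed_subvariety M W"
    and "free_fvars \<phi> \<subseteq> {..<N + M}"
    and "free_vvars \<phi> = {}"
    and "variety_dim N V = enat k"
  shows "\<exists>C::real. \<forall>n>0.
    real (pattern_number
      {(x, y) \<in> V \<times> W. x @ y \<in> realization abv \<phi> (affine_prod V W)} V W n)
    \<le> C * real n ^ k"
proof -
  interpret acval abv
    using assms(1) by unfold_locales (auto simp: valuation_def)
  have surj: "surj abv" using assms(1) by (simp add: valuation_def)
  let ?X = "{(x, y) \<in> V \<times> W. x @ y \<in> realization abv \<phi> (affine_prod V W)}"
  define \<psi> where "\<psi> = (\<lambda>e. sat abv (\<lambda>i. e (2 * i)) (\<lambda>j. abv (e (2 * j + 1))) \<phi>)"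
  have "qf abv (polyfun UNIV) \<psi>" unfolding \<psi>_def by (rule sat_qf[OF surj])
  then obtain as B where as: "set as \<subseteq> val_atoms abv (polyfun UNIV)" "\<psi> = (\<lambda>e. B (map (\<lambda>a. a e) as))"
    using boolc_finite_rep by blast
  have "\<forall>\<alpha>\<in>set as. \<exists>q. fst q \<in> polyfun UNIV \<and> snd q \<in> polyfun UNIV \<and>
      \<alpha> = (\<lambda>e. abv (fst q e) \<le> abv (snd q e))"
  proof
    fix \<alpha> assume "\<alpha> \<in> set as"
    then obtain a b where "a \<in> polyfun UNIV" "b \<in> polyfun UNIV" "\<alpha> = (\<lambda>e. abv (a e) \<le> abv (b e))"
      using as(1) unfolding val_atoms_def by blast
    then show "\<exists>q. fst q \<in> polyfun UNIV \<and> snd q \<in> polyfun UNIV \<and>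
        \<alpha> = (\<lambda>e. abv (fst q e) \<le> abv (snd q e))" by (intro exI[of _ "(a, b)"]) simp
  qed
  from bchoice[OF this] obtain q where q: "\<forall>\<alpha>\<in>set as. fst (q \<alpha>) \<in> polyfun UNIV \<and>
      snd (q \<alpha>) \<in> polyfun UNIV \<and> \<alpha> = (\<lambda>e. abv (fst (q \<alpha>) e) \<le> abv (snd (q \<alpha>) e))" by blast
  define a b where "a = (\<lambda>\<alpha>. fst (q \<alpha>))" and "b = (\<lambda>\<alpha>. snd (q \<alpha>))"
  have "a ` set as \<union> b ` set as \<subseteq> polyfun UNIV" using q by (auto simp: a_def b_def)
  then obtain D where "\<forall>f\<in>a ` set as \<union> b ` set as. pfd UNIV D f"
    using common_degree[of "a ` set as \<union> b ` set as" UNIV] by auto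
  then have D: "pfd UNIV D (a \<alpha>)" "pfd UNIV D (b \<alpha>)" if "\<alpha> \<in> set as" for \<alpha>
    using that by blast+
  have atom: "\<alpha> e \<longleftrightarrow> abv (a \<alpha> e) \<le> abv (b \<alpha> e)" if "\<alpha> \<in> set as" for \<alpha> e
    using bspec[OF q that] unfolding a_def b_def by metis
  define L where "L = card (set as)"
  have dim: "card I \<le> k"
    if "closed_subvariety N Y" "Y \<subseteq> V" "I \<subseteq> {..<N}" "indep_coords I Y" for I Y
    by (rule indep_coords_card_le_dim[OF that assms(6)])
  obtain C where C: "\<forall>d>0. \<exists>G. finite G \<and> card G \<le> C * d ^ k \<and>
      (\<forall>f. pfd {..<N} d f \<longrightarrow> restr V f \<in> fs.span G)"
    using hilbert_bound[OF assms(2) dim] by (rule exE)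
  have bound: "card ((\<lambda>x. pattern ?X V x ws) ` V) \<le> C * Suc (L * D) ^ k * n ^ k"
    if ws: "set ws \<subseteq> W" "length ws = n" and n: "n > 0" for ws n
  proof -
    \<comment> \<open>The \<open>n * L\<close> comparisons give products of degree at most
      \<open>n * L * D\<close>; \<open>Suc\<close> keeps \<open>d\<close> positive even if there is
      no comparison or \<open>D\<close> is 0.\<close>
    define d where "d = n * Suc (L * D)"
    have d: "d > 0" using n by (simp add: d_def)
    obtain G where G: "finite G" "card G \<le> C * d ^ k" "\<And>f. pfd {..<N} d f \<Longrightarrow> restr V f \<in> fs.span G"
      using C[rule_format, OF d] by blast
    \<comment> \<open>The coordinates of \<open>w\<close> are substituted as constants, so the
      comparisons become functions of the point of \<open>V\<close> alone, of no larger
      degree.\<close>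
    define s where "s = (\<lambda>w e m. if even m \<and> m div 2 < N then e (m div 2)
        else if even m \<and> m div 2 < N + length w then w ! (m div 2 - N) else (0::'k))"
    have s_pfd: "pfd {..<N} D (\<lambda>e. h (s w e))" if "pfd UNIV D h" for h w
    proof (rule pfd_compose[OF that])
      fix m
      show "pfd {..<N} 1 (\<lambda>e. s w e m)"
        by (cases "even m \<and> m div 2 < N") (auto simp: s_def intro: pfd.var pfd.const)
    qed
    let ?S = "{..<n} \<times> set as"
    define f g where "f = (\<lambda>(i, \<alpha>) e. a \<alpha> (s (ws ! i) e))" and "g = (\<lambda>(i, \<alpha>) e. b \<alpha> (s (ws ! i) e))"
    let ?P = "\<lambda>x. full_pattern abv ?S f g ((!) x)"
    have cardP: "card (?P ` V) \<le> card G"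
    proof (rule card_full_patterns[where N = N and D = D and d = d])
      show "pfd {..<N} D (f i)" "pfd {..<N} D (g i)" if "i \<in> ?S" for i
        using that D s_pfd by (auto simp: f_def g_def)
      show "card ?S * D \<le> d" by (simp add: d_def L_def card_cartesian_product)
    qed (use G in auto)
    have "pattern ?X V x ws = map (\<lambda>i. if B (map (\<lambda>\<alpha>. (i, \<alpha>) \<in> fst (?P x) \<union> snd (?P x)) as) then 1 else 0) [0..<n]"
      if x: "x \<in> V" for x
    proof -
      have lx: "length x = N" using x assms(2) unfolding closed_subvariety_def by blast
      have "x \<in> fiber ?X V (ws ! i) \<longleftrightarrow> B (map (\<lambda>\<alpha>. (i, \<alpha>) \<in> fst (?P x) \<union> snd (?P x)) as)" if i: "i < n" for i
      proof -
        let ?w = "ws ! i"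
        have w: "?w \<in> W" using ws i by auto
        have env: "list_env (x @ ?w) = s ?w ((!) x)"
          by (rule ext) (simp add: list_env_def s_def lx nth_append)
        have "x \<in> fiber ?X V ?w \<longleftrightarrow> sat abv (\<lambda>j. if j < length (x @ ?w) then (x @ ?w) ! j else 0) (\<lambda>_. 0) \<phi>"
          using x w by (auto simp: fiber_def realization_def affine_prod_def)
        also have "\<dots> \<longleftrightarrow> \<psi> (list_env (x @ ?w))"
        proof -
          have "(\<lambda>j. if j < length (x @ ?w) then (x @ ?w) ! j else 0) = (\<lambda>j. list_env (x @ ?w) (2 * j))"
            by (rule ext) (simp add: list_env_def)
          moreover have "(\<lambda>_. 0) = (\<lambda>j. abv (list_env (x @ ?w) (2 * j + 1)))"
            by (rule ext) (simp add: list_env_def)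
          ultimately show ?thesis unfolding \<psi>_def by (simp only:)
        qed
        also have "\<dots> \<longleftrightarrow> B (map (\<lambda>\<alpha>. (i, \<alpha>) \<in> fst (?P x) \<union> snd (?P x)) as)"
        proof -
          have "map (\<lambda>\<alpha>. \<alpha> (s ?w ((!) x))) as = map (\<lambda>\<alpha>. (i, \<alpha>) \<in> fst (?P x) \<union> snd (?P x)) as"
          proof (rule map_cong)
            fix \<alpha> assume \<alpha>: "\<alpha> \<in> set as"
            have "(i, \<alpha>) \<in> ?S" using \<alpha> i by simp
            from full_pattern_iff[OF this, of f g "(!) x"]
            show "\<alpha> (s ?w ((!) x)) = ((i, \<alpha>) \<in> fst (?P x) \<union> snd (?P x))"
              by (simp add: f_def g_def atom[OF \<alpha>])
          qed simp
          then show ?thesis unfolding as(2) env by (simp only:)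
        qed
        finally show ?thesis .
      qed
      then show ?thesis
        unfolding pattern_def using ws(2) by (intro nth_equalityI) auto
    qed
    \<comment> \<open>The pattern of the fibers is a function of the full pattern.\<close>
    then have image_eq: "(\<lambda>x. pattern ?X V x ws) ` V =
        (\<lambda>p. map (\<lambda>i. if B (map (\<lambda>\<alpha>. (i, \<alpha>) \<in> fst p \<union> snd p) as) then 1 else 0) [0..<n]) ` ?P ` V"
      unfolding image_image by (intro image_cong) auto
    have "?P ` V \<subseteq> Pow ?S \<times> Pow ?S" by (auto simp: full_pattern_def)
    then have "finite (?P ` V)" by (rule finite_subset) simp
    then have "card ((\<lambda>x. pattern ?X V x ws) ` V) \<le> card (?P ` V)"
      unfolding image_eq by (rule card_image_le)
    also have "\<dots> \<le> card G" by (rule cardP)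
    also have "\<dots> \<le> C * d ^ k" by (rule G(2))
    also have "\<dots> = C * Suc (L * D) ^ k * n ^ k" by (simp only: d_def power_mult_distrib ac_simps)
    finally show ?thesis .
  qed
  have "pattern_number ?X V W n \<le> C * Suc (L * D) ^ k * n ^ k" if n: "n > 0" for n
  proof (cases "{ws. set ws \<subseteq> W \<and> length ws = n} = {}")
    \<comment> \<open>Here \<open>W\<close> is empty, and the supremum of the empty set of naturals
      is 0.\<close>
    case True
    then show ?thesis unfolding pattern_number_def True by (simp add: Sup_nat_def)
  next
    case False
    then show ?thesis unfolding pattern_number_def
      by (rule cSUP_least) (use bound n in auto)
  qed
  then have "real (pattern_number ?X V W n) \<le> real (C * Suc (L * D) ^ k * n ^ k)" if "n > 0" for n
    using that by (intro of_nat_mono)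
  then have "real (pattern_number ?X V W n) \<le> real (C * Suc (L * D) ^ k) * real n ^ k" if "n > 0" for n
    using that by (simp only: of_nat_mult of_nat_power)
  then show ?thesis by blast
qed

end
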